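(* Let $G=(V,E)$ be an $\mathcal{M}(2,2)$-connected graph with an ear decomposition $C_1,\dots,C_t$ with $t\geq 2$, and for $1\leq i\leq t$ let $H_i=(V_i,C_i)$ be the subgraph induced by $C_i$ (with $V_i$ the set of endpoints of edges in $C_i$). Let $Y=V_t\setminus\bigcup_{i=1}^{t-1}V_i$ and $X=V_t\setminus Y$. Suppose that no 3-edge-separation $(F_1,F_2)$ of $H_t$ has the property that $|V(F_1)|,|V(F_2)|\geq 2$ and $F_i$ is a subgraph of $H_t[Y]$ for some $i\in\{1,2\}$. Then there is an admissible edge-reduction, an admissible edge-deletion or an admissible $K_4^-$-reduction of $G$.
   Context: All graphs are finite and simple. A graph is $(2,2)$-sparse if every subgraph $(V',E')$ with $E'\neq\emptyset$ has $|E'|\leq 2|V'|-2$. A $(2,2)$-circuit is a graph $(V',E')$ with $|E'|=2|V'|-1$ all of whose proper subgraphs $(V'',E'')$ with $E''\neq\emptyset$ satisfy $|E''|\leq 2|V''|-2$. $\mathcal{M}(2,2)$ is the matroid on the edges of a complete graph in which an edge set is independent iff it is empty or the graph it induces is $(2,2)$-sparse; its circuits are exactly the edge sets of $(2,2)$-circuits. A graph is $\mathcal{M}(2,2)$-connected if it has no isolated vertices, at least 2 edges, and every pair of edges lies in a common $(2,2)$-circuit subgraph. For circuits $C_1,\dots,C_t$ of $\mathcal{M}(2,2)$ restricted to $E$, let $D_i=C_1\cup\dots\cup C_i$; this is an ear decomposition of $G$ if $D_t=E$ and for all $2\leq i\leq t$: (E1) $C_i\cap D_{i-1}\neq\emptyset$;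 (E2) $C_i\setminus D_{i-1}\neq\emptyset$; (E3) no circuit $C'$ satisfying (E1),(E2) has $C'\setminus D_{i-1}\subsetneq C_i\setminus D_{i-1}$. $H[Y]$ is the induced subgraph on $Y$. A 3-edge-separation of $H$ is a pair of vertex-disjoint induced subgraphs $F_1,F_2$ of $H$ with $F_1\cup F_2=H-S$ for some edge set $S$ with $|S|=3$. A generalised vertex split chooses a vertex $v$ and a partition $N_1,N_2$ of its neighbours, deletes $v$, adds new vertices $v_1,v_2$ joined to $N_1$ and $N_2$ respectively, and adds edges $v_1v_2$ and $v_1x$ for some vertex $x\neq v$ not in $N_1$; an edge-reduction is the inverse operation (a graph $G'$ is an edge-reduction of $G$ if $G$ is a generalised vertex split of $G'$). A $K_4^-$-reduction deletes two adjacent degree-3 vertices $u_1,u_2$ with $N(u_1)\cap N(u_2)=\{v_1,v_2\}$ and $v_1v_2\notin E$, and adds the edge $v_1v_2$. An edge-deletion removes one edge. Such a reduction or deletion is admissible if the resulting graph is $\mathcal{M}(2,2)$-connected. *)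

theory Defs
  imports Main
begin

type_synonym 'a graph = "'a set \<times> 'a set set"

abbreviation verts :: "'a graph \<Rightarrow> 'a set" where "verts \<equiv> fst"
abbreviation edges :: "'a graph \<Rightarrow> 'a set set" where "edges \<equiv> snd"

definition simple_graph :: "'a graph \<Rightarrow> bool" where
  "simple_graph G \<longleftrightarrow> finite (verts G) \<and> (\<forall>e\<in>edges G. e \<subseteq> verts G \<and> card e = 2)"

definition subgraph :: "'a graph \<Rightarrow> 'a graph \<Rightarrow> bool" where
  "subgraph H G \<longleftrightarrow> simple_graph H \<and> verts H \<subseteq> verts G \<and> edges H \<subseteq> edges G"

definition neighbours :: "'a graph \<Rightarrow> 'a \<Rightarrow> 'a set" where
  "neighbours G v = {w. {v, w} \<in> edges G}"

definition degree :: "'a graph \<Rightarrow> 'a \<Rightarrow> nat" where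
  "degree G v = card (neighbours G v)"

definition induced :: "'a graph \<Rightarrow> 'a set \<Rightarrow> 'a graph" where
  "induced G Y = (Y, {e \<in> edges G. e \<subseteq> Y})"

text \<open>The counts \<open>|E| \<le> 2|V| - 2\<close> and \<open>|E| = 2|V| - 1\<close> are written additively, since subtraction
  on natural numbers truncates (the empty graph would otherwise count as a circuit).\<close>

definition sparse22 :: "'a graph \<Rightarrow> bool" where
  "sparse22 G \<longleftrightarrow>
     (\<forall>H. subgraph H G \<and> edges H \<noteq> {} \<longrightarrow> card (edges H) + 2 \<le> 2 * card (verts H))"

definition circuit22 :: "'a graph \<Rightarrow> bool" where
  "circuit22 G \<longleftrightarrow> simple_graph G \<and> card (edges G) + 1 = 2 * card (verts G) \<and>
     (\<forall>H. subgraph H G \<and> H \<noteq> G \<and> edges H \<noteq> {} \<longrightarrow>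
        card (edges H) + 2 \<le> 2 * card (verts H))"

definition M22_indep :: "'a set set \<Rightarrow> bool" where
  "M22_indep F \<longleftrightarrow> F = {} \<or> sparse22 (\<Union>F, F)"

text \<open>\<open>M22_circuit E C\<close>: \<open>C\<close> is a circuit (minimal dependent set) of the restriction of
  \<open>\<M>(2,2)\<close> to the edge set \<open>E\<close>.\<close>

definition M22_circuit :: "'a set set \<Rightarrow> 'a set set \<Rightarrow> bool" where
  "M22_circuit E C \<longleftrightarrow> C \<subseteq> E \<and> \<not> M22_indep C \<and> (\<forall>D. D \<subset> C \<longrightarrow> M22_indep D)"

definition M22_connected :: "'a graph \<Rightarrow> bool" where
  "M22_connected G \<longleftrightarrow> simple_graph G \<and>
     (\<forall>v\<in>verts G. degree G v \<noteq> 0) \<and>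
     card (edges G) \<ge> 2 \<and>
     (\<forall>e\<in>edges G. \<forall>f\<in>edges G. e \<noteq> f \<longrightarrow>
        (\<exists>H. subgraph H G \<and> circuit22 H \<and> e \<in> edges H \<and> f \<in> edges H))"

definition partial_union :: "(nat \<Rightarrow> 'b set) \<Rightarrow> nat \<Rightarrow> 'b set" where
  "partial_union C i = (\<Union>j\<in>{1..i}. C j)"

text \<open>Only the values \<open>C 1, \<dots>, C t\<close> of the sequence matter.\<close>

definition ear_decomposition :: "'a graph \<Rightarrow> (nat \<Rightarrow> 'a set set) \<Rightarrow> nat \<Rightarrow> bool" where
  "ear_decomposition G C t \<longleftrightarrow>
     (\<forall>i\<in>{1..t}. M22_circuit (edges G) (C i)) \<and>
     partial_union C t = edges G \<and>
     (\<forall>i\<in>{2..t}.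
        C i \<inter> partial_union C (i - 1) \<noteq> {} \<and>
        C i - partial_union C (i - 1) \<noteq> {} \<and>
        \<not> (\<exists>C'. M22_circuit (edges G) C' \<and>
               C' \<inter> partial_union C (i - 1) \<noteq> {} \<and>
               C' - partial_union C (i - 1) \<noteq> {} \<and>
               C' - partial_union C (i - 1) \<subset> C i - partial_union C (i - 1)))"

definition three_edge_separation :: "'a graph \<Rightarrow> 'a graph \<Rightarrow> 'a graph \<Rightarrow> bool" where
  "three_edge_separation H F1 F2 \<longleftrightarrow>
     verts F1 \<subseteq> verts H \<and> F1 = induced H (verts F1) \<and>
     verts F2 \<subseteq> verts H \<and> F2 = induced H (verts F2) \<and>
     verts F1 \<inter> verts F2 = {} \<and>
     (\<exists>S \<subseteq> edges H. card S = 3 \<and>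
        verts F1 \<union> verts F2 = verts H \<and> edges F1 \<union> edges F2 = edges H - S)"

text \<open>The new vertices are required to be new relative to the graph with \<open>v\<close> already deleted, so
  one of them may reuse the name \<open>v\<close>. Up to isomorphism this is no loss, and it keeps the inverse
  operation meaningful when every element of the type is already a vertex.\<close>

definition generalised_vertex_split :: "'a graph \<Rightarrow> 'a graph \<Rightarrow> bool" where
  "generalised_vertex_split G' G \<longleftrightarrow> simple_graph G' \<and>
     (\<exists>v N1 N2 v1 v2 x.
        v \<in> verts G' \<and>
        N1 \<union> N2 = neighbours G' v \<and> N1 \<inter> N2 = {} \<and> N1 \<noteq> {} \<and> N2 \<noteq> {} \<and>
        v1 \<noteq> v2 \<and> v1 \<notin> verts G' - {v} \<and> v2 \<notin> verts G' - {v} \<and>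
        x \<in> verts G' \<and> x \<noteq> v \<and> x \<notin> N1 \<and>
        verts G = (verts G' - {v}) \<union> {v1, v2} \<and>
        edges G = {e \<in> edges G'. v \<notin> e} \<union> {{v1, w} |w. w \<in> N1} \<union> {{v2, w} |w. w \<in> N2}
                  \<union> {{v1, v2}, {v1, x}})"

definition edge_reduction :: "'a graph \<Rightarrow> 'a graph \<Rightarrow> bool" where
  "edge_reduction G G' \<longleftrightarrow> generalised_vertex_split G' G"

definition edge_deletion :: "'a graph \<Rightarrow> 'a graph \<Rightarrow> bool" where
  "edge_deletion G G' \<longleftrightarrow> (\<exists>e\<in>edges G. G' = (verts G, edges G - {e}))"

definition K4_minus_reduction :: "'a graph \<Rightarrow> 'a graph \<Rightarrow> bool" where
  "K4_minus_reduction G G' \<longleftrightarrow>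
     (\<exists>u1\<in>verts G. \<exists>u2\<in>verts G. \<exists>v1 v2.
        {u1, u2} \<in> edges G \<and> degree G u1 = 3 \<and> degree G u2 = 3 \<and>
        v1 \<noteq> v2 \<and> neighbours G u1 \<inter> neighbours G u2 = {v1, v2} \<and> {v1, v2} \<notin> edges G \<and>
        G' = (verts G - {u1, u2},
              {e \<in> edges G. u1 \<notin> e \<and> u2 \<notin> e} \<union> {{v1, v2}}))"

lemma simple_graph_Union_edges:
  assumes "simple_graph (V, E)" "F \<subseteq> E"
  shows "simple_graph (\<Union>F, F)"
  using assms unfolding simple_graph_def
  by (auto intro: finite_subset[of "\<Union>F" V])

text \<open>The circuits of the matroid are exactly the edge sets of \<open>(2,2)\<close>-circuits.\<close>

lemma M22_circuit_iff_circuit22: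
  assumes G: "simple_graph (V, E)" and CE: "C \<subseteq> E"
  shows "M22_circuit E C \<longleftrightarrow> circuit22 (\<Union>C, C)"
proof
  have sg: "simple_graph (\<Union>F, F)" if "F \<subseteq> C" for F
    using simple_graph_Union_edges[OF G] that CE by blast
  have finU: "finite (\<Union>C)" using sg[of C] by (simp add: simple_graph_def)
  then have finC: "finite C" by (rule finite_UnionD)
  {
    assume M: "M22_circuit E C"
    then have ne: "C \<noteq> {}" and dep: "\<not> sparse22 (\<Union>C, C)"
      and min: "\<And>D. D \<subset> C \<Longrightarrow> D \<noteq> {} \<Longrightarrow> sparse22 (\<Union>D, D)"
      by (auto simp: M22_circuit_def M22_indep_def)
    have small: "card F + 2 \<le> 2 * card U"
      if "F \<subset> C" "F \<noteq> {}" "\<Union>F \<subseteq> U" "finite U" for F U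
    proof -
      have "card F + 2 \<le> 2 * card (\<Union>F)"
        using min[OF that(1,2)] sg[of F] that unfolding sparse22_def subgraph_def by auto
      also have "\<dots> \<le> 2 * card U" using that by (simp add: card_mono)
      finally show ?thesis .
    qed
    obtain U F where UF: "simple_graph (U, F)" "U \<subseteq> \<Union>C" "F \<subseteq> C" "F \<noteq> {}"
      "\<not> card F + 2 \<le> 2 * card U"
      using dep unfolding sparse22_def subgraph_def by auto
    have UnF: "\<Union>F \<subseteq> U" "finite U" using UF(1) by (auto simp: simple_graph_def)
    have "F = C" using small[of F U] UF UnF by blast
    then have "U = \<Union>C" using UF UnF by blast
    then have lo: "2 * card (\<Union>C) \<le> card C + 1" using UF(5) \<open>F = C\<close> by simp
    obtain e where e: "e \<in> C" using ne by blast
    have "card e = 2" using sg[of C] e by (simp add: simple_graph_def)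
    moreover have "card e \<le> card (\<Union>C)" using e finU by (intro card_mono) auto
    ultimately have "card C \<ge> 3" using lo by simp
    then have "card (C - {e}) \<noteq> 0" using e finC by simp
    then have "C - {e} \<noteq> {}" by force
    then have "card (C - {e}) + 2 \<le> 2 * card (\<Union>C)"
      using e finU by (intro small) auto
    then have "card C + 1 \<le> 2 * card (\<Union>C)" using e finC \<open>card C \<ge> 3\<close> by simp
    with lo have cnt: "card C + 1 = 2 * card (\<Union>C)" by simp
    have "card F + 2 \<le> 2 * card U"
      if "simple_graph (U, F)" "U \<subseteq> \<Union>C" "F \<subseteq> C" "(U, F) \<noteq> (\<Union>C, C)" "F \<noteq> {}" for U F
    proof -
      have "\<Union>F \<subseteq> U" "finite U" using that(1) by (auto simp: simple_graph_def)
      moreover from this have "F \<noteq> C" using that by blast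
      ultimately show ?thesis using small that by blast
    qed
    then show "circuit22 (\<Union>C, C)"
      using cnt sg[of C] by (auto simp: circuit22_def subgraph_def)
  }
  {
    assume K: "circuit22 (\<Union>C, C)"
    then have cnt: "card C + 1 = 2 * card (\<Union>C)"
      and sm: "\<And>U F. simple_graph (U, F) \<Longrightarrow> U \<subseteq> \<Union>C \<Longrightarrow> F \<subset> C \<Longrightarrow> F \<noteq> {}
                 \<Longrightarrow> card F + 2 \<le> 2 * card U"
      by (auto simp: circuit22_def subgraph_def)
    have "C \<noteq> {}" using cnt by auto
    moreover have "\<not> sparse22 (\<Union>C, C)"
    proof
      assume "sparse22 (\<Union>C, C)"
      then have "card C + 2 \<le> 2 * card (\<Union>C)"
        using sg[of C] \<open>C \<noteq> {}\<close> by (auto simp: sparse22_def subgraph_def)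
      with cnt show False by simp
    qed
    moreover have "sparse22 (\<Union>D, D)" if "D \<subset> C" for D
      unfolding sparse22_def subgraph_def
    proof (intro allI impI, elim conjE)
      fix H :: "'a graph"
      assume H: "edges H \<noteq> {}" "simple_graph H" "verts H \<subseteq> verts (\<Union>D, D)"
        "edges H \<subseteq> edges (\<Union>D, D)"
      then have "verts H \<subseteq> \<Union>C" "edges H \<subset> C" using that by auto
      then show "card (edges H) + 2 \<le> 2 * card (verts H)"
        using sm[of "verts H" "edges H"] H by simp
    qed
    ultimately show "M22_circuit E C"
      using CE by (auto simp: M22_circuit_def M22_indep_def)
  }
qed

end

theory Submission
  imports Defs
begin

text \<open>
  Let \<open>D\<close> be the union of all ears but the last. Minimality of the last ear forces the edges outside
  \<open>D\<close> to be exactly the \<open>2|Y| + 1\<close> edges incident with \<open>Y\<close> (if \<open>Y\<close> is empty, there is one such edge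
  and it can be deleted). Conversely, a graph obtained from a connected \<open>D\<close> by attaching a set \<open>Y\<close> is
  connected as soon as every nonempty \<open>Z \<subseteq> Y\<close> is incident with at least \<open>2|Z| + 1\<close> edges, with
  equality for \<open>Y\<close>, every such \<open>Z\<close> induces at most \<open>2|Z| - 2\<close> edges, and \<open>Y\<close> has two neighbours in
  \<open>D\<close>. So the admissibility of a reduction inside \<open>Y\<close> is a question about edge counts. A reduction
  at a vertex of degree three (a node) is blocked only by an edge, by a tight set (\<open>2|Z| - 2\<close> induced edges) or by a
  dually tight set (\<open>2|Z| + 1\<close> incident edges).

  Assume that no reduction is admissible. If all vertices of \<open>Y\<close> are nodes, they form a tree and a
  leaf gives a reduction. Otherwise let \<open>U\<close> be a minimal dually tight set containing a vertex that is not
  a node, and partition \<open>U\<close> into its maximal tight subsets. As there are no nontrivial 3-edge-cuts,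
  every part other than a single node has at least four leaving edges, and double counting shows that the
  sum over the parts of (leaving edges + edges leaving \<open>U\<close> - 4) is two. The single nodes among the parts
  fall into three classes (\<open>diamond\<close>, \<open>fan\<close>, pendant), and in each case the count leaves so few
  configurations that one either finds a reduction or a violated edge count.
\<close>

text \<open>Two counts govern everything: a nonempty \<open>Z \<subseteq> Y\<close> induces at most
  2|Z| - 2 edges and is incident with at least 2|Z| + 1. The second bound is the first read in the
  complement: a circuit on n vertices has 2n - 1 edges, and those avoiding \<open>Z\<close> are
  sparse. The bounds differ by 3, so exactly three edges leave \<open>Z\<close> if and only if
  \<open>Z\<close> is tight and dually tight; the separation hypothesis forbids this for two or more
  vertices. Both counts uncross: tight sets that meet have tight union, dually tight sets that meet
  have dually tight union and intersection and no edge between their differences.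

  The obstacle is that a blocking set may reach beyond the region under study. This is why
  \<open>U\<close> is chosen minimal: a dually tight blocker containing a vertex of \<open>U\<close>
  that is not a node contains all of \<open>U\<close>, and a tight blocker leaving \<open>U\<close>
  would cut a smaller dually tight set out of \<open>U\<close>. What can still block lies inside
  \<open>U\<close> and is recorded by its maximal tight subsets. A new edge with both ends outside
  \<open>Y\<close> is not covered by the counts; it occurs only for ears with one or two vertices,
  where circuits of \<open>D\<close> are used directly.\<close>

lemma finite_maximal_set:
  assumes "finite S" "A \<in> S"
  obtains B where "B \<in> S" "\<forall>Z\<in>S. B \<subseteq> Z \<longrightarrow> B = Z"
  using finite_has_maximal[OF assms(1)] assms(2) by (metis empty_iff)

lemma finite_minimal_set:
  assumes "finite S" "A \<in> S"
  obtains B where "B \<in> S" "\<forall>Z\<in>S. Z \<subseteq> B \<longrightarrow> B = Z"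
  using finite_has_minimal[OF assms(1)] assms(2) by (metis empty_iff)

section \<open>Edge counts\<close>

definition edge_set :: "'a set set \<Rightarrow> bool" where
  "edge_set E \<longleftrightarrow> finite E \<and> (\<forall>e\<in>E. card e = 2)"

definition ind :: "'a set set \<Rightarrow> 'a set \<Rightarrow> 'a set set" where
  "ind E Z = {e \<in> E. e \<subseteq> Z}"

definition inc :: "'a set set \<Rightarrow> 'a set \<Rightarrow> 'a set set" where
  "inc E Z = {e \<in> E. e \<inter> Z \<noteq> {}}"

text \<open>Only applied to disjoint \<open>A\<close> and \<open>B\<close>, where it collects the
  edges joining them; it is the exact error term in the two identities below.\<close>

definition btw :: "'a set set \<Rightarrow> 'a set \<Rightarrow> 'a set \<Rightarrow> 'a set set" where
  "btw E A B = {e \<in> E. e \<inter> A \<noteq> {} \<and> e \<inter> B \<noteq> {}}"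

lemma edge_set_finite: "edge_set E \<Longrightarrow> finite E"
  by (simp add: edge_set_def)

lemma edge_set_subset: "edge_set E \<Longrightarrow> F \<subseteq> E \<Longrightarrow> edge_set F"
  by (auto simp: edge_set_def intro: finite_subset)

lemma edge_set_insert: "edge_set E \<Longrightarrow> a \<noteq> b \<Longrightarrow> edge_set (insert {a, b} E)"
  by (auto simp: edge_set_def)

lemma edge_set_Un: "edge_set E \<Longrightarrow> edge_set F \<Longrightarrow> edge_set (E \<union> F)"
  by (auto simp: edge_set_def)

lemma edge_set_edgeE:
  assumes "edge_set E" "e \<in> E"
  obtains a b where "e = {a, b}" "a \<noteq> b"
  using assms by (auto simp: edge_set_def card_2_iff)

lemma edge_set_edgeE':
  assumes "edge_set E" "e \<in> E" "x \<in> e"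
  obtains y where "e = {x, y}" "x \<noteq> y"
proof -
  obtain a b where "e = {a, b}" "a \<noteq> b" using edge_set_edgeE[OF assms(1,2)] .
  then show ?thesis using that[of a] that[of b] assms(3) by auto
qed

lemma edge_set_finite_Union: assumes "edge_set E" shows "finite (\<Union>E)"
proof (rule finite_Union)
  show "finite E" using assms by (simp add: edge_set_def)
  show "finite e" if "e \<in> E" for e using assms that card_ge_0_finite[of e] by (auto simp: edge_set_def)
qed

lemma finite_ind [simp]: "finite E \<Longrightarrow> finite (ind E Z)"
  and finite_inc [simp]: "finite E \<Longrightarrow> finite (inc E Z)"
  and finite_btw [simp]: "finite E \<Longrightarrow> finite (btw E A B)"
  by (auto simp: ind_def inc_def btw_def)

lemma ind_subset: "ind E Z \<subseteq> E"
  by (auto simp: ind_def)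

lemma ind_singleton: "edge_set E \<Longrightarrow> ind E {x} = {}"
  by (auto simp: ind_def edge_set_def subset_singleton_iff)

lemma ind_empty: "edge_set E \<Longrightarrow> ind E {} = {}"
  by (auto simp: ind_def edge_set_def)

lemma edge_cap_disj:
  assumes "edge_set E" "e \<in> E" "e \<inter> A \<noteq> {}" "e \<inter> B \<noteq> {}" "A \<inter> B = {}"
  shows "e \<subseteq> A \<union> B"
proof -
  obtain a b where "a \<in> e" "a \<in> A" "b \<in> e" "b \<in> B" using assms by blast
  moreover have "a \<noteq> b" using calculation assms by blast
  moreover obtain c d where "e = {c, d}" using assms edge_set_edgeE by metis
  ultimately show ?thesis by auto
qed

text \<open>An edge inside \<open>A \<union> B\<close> that is inside neither set must run from
  \<open>A - B\<close> to \<open>B - A\<close>. The error term is kept exact because a later count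
  needs the number of edges between two parts.\<close>

lemma ind_Un_Int:
  assumes E: "edge_set E"
  shows "card (ind E A) + card (ind E B) + card (btw E (A - B) (B - A))
       = card (ind E (A \<union> B)) + card (ind E (A \<inter> B))"
proof -
  have fin: "finite E" using E by (simp add: edge_set_def)
  have u: "ind E (A \<union> B) = (ind E A \<union> ind E B) \<union> btw E (A - B) (B - A)" (is "_ = ?r")
  proof
    show "ind E (A \<union> B) \<subseteq> ?r" by (auto simp: ind_def btw_def)
    have "btw E (A - B) (B - A) \<subseteq> ind E (A \<union> B)"
      using edge_cap_disj[OF E, of _ "A - B" "B - A"] by (fastforce simp: btw_def ind_def)
    then show "?r \<subseteq> ind E (A \<union> B)" by (auto simp: ind_def)
  qed
  have "card (ind E (A \<union> B)) = card (ind E A \<union> ind E B) + card (btw E (A - B) (B - A))"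
    unfolding u using fin by (intro card_Un_disjoint) (auto simp: ind_def btw_def)
  moreover have "ind E A \<inter> ind E B = ind E (A \<inter> B)" by (auto simp: ind_def)
  then have "card (ind E A) + card (ind E B) = card (ind E A \<union> ind E B) + card (ind E (A \<inter> B))"
    using card_Un_Int[of "ind E A" "ind E B"] fin by simp
  ultimately show ?thesis by simp
qed

text \<open>An edge incident with both sets either touches \<open>A \<inter> B\<close> or joins the
  two differences, and never both.\<close>

lemma inc_Un_Int:
  assumes E: "edge_set E"
  shows "card (inc E A) + card (inc E B)
       = card (inc E (A \<union> B)) + card (inc E (A \<inter> B)) + card (btw E (A - B) (B - A))"
proof -
  have fin: "finite E" using E by (simp add: edge_set_def)
  have u: "inc E A \<inter> inc E B = inc E (A \<inter> B) \<union> btw E (A - B) (B - A)"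
    by (auto simp: inc_def btw_def)
  have dis: "inc E (A \<inter> B) \<inter> btw E (A - B) (B - A) = {}"
    using edge_cap_disj[OF E, of _ "A - B" "B - A"] by (fastforce simp: btw_def inc_def)
  have "inc E (A \<union> B) = inc E A \<union> inc E B" by (auto simp: inc_def)
  then show ?thesis
    using card_Un_Int[of "inc E A" "inc E B"] card_Un_disjoint[OF _ _ dis] fin by (simp add: u)
qed

section \<open>Tight sets\<close>

text \<open>Induced edges are counted because they give the densest subgraph on \<open>Z\<close>. A
  single vertex attains the bound, so singletons are tight and every vertex of \<open>W\<close> lies
  in some tight set.\<close>

definition sparse_on :: "'a set set \<Rightarrow> 'a set \<Rightarrow> bool" where
  "sparse_on F W \<longleftrightarrow> (\<forall>Z. Z \<subseteq> W \<and> finite Z \<and> Z \<noteq> {} \<longrightarrow> card (ind F Z) + 2 \<le> 2 * card Z)"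

definition tight :: "'a set set \<Rightarrow> 'a set \<Rightarrow> bool" where
  "tight F Z \<longleftrightarrow> finite Z \<and> Z \<noteq> {} \<and> card (ind F Z) + 2 = 2 * card Z"

text \<open>When \<open>F\<close> is sparse on a finite \<open>W\<close>, the union is itself tight
  by \<open>tight_Un\<close>: it is the unique maximal tight subset of \<open>W\<close> containing
  \<open>x\<close>, and these sets partition \<open>W\<close>.\<close>

definition part :: "'a set set \<Rightarrow> 'a set \<Rightarrow> 'a \<Rightarrow> 'a set" where
  "part F W x = \<Union>{Z. Z \<subseteq> W \<and> tight F Z \<and> x \<in> Z}"

lemma sparse_onD: "sparse_on F W \<Longrightarrow> Z \<subseteq> W \<Longrightarrow> finite Z \<Longrightarrow> Z \<noteq> {} \<Longrightarrow> card (ind F Z) + 2 \<le> 2 * card Z"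
  by (auto simp: sparse_on_def)

lemma tight_singleton: "edge_set F \<Longrightarrow> tight F {x}"
  by (simp add: tight_def ind_singleton)

text \<open>The union and the intersection together induce at least as many edges as the two tight
  sets. Neither may exceed its own bound, so both attain it. The intersection has to be nonempty, as
  the bound is negative for the empty set.\<close>

lemma tight_Un:
  assumes F: "edge_set F" and sp: "sparse_on F W" and "A \<subseteq> W" "B \<subseteq> W"
    and A: "tight F A" and B: "tight F B" and ne: "A \<inter> B \<noteq> {}"
  shows "tight F (A \<union> B)"
proof -
  have fin: "finite A" "finite B" "A \<noteq> {}" using A B by (auto simp: tight_def)
  have "card (ind F (A \<union> B)) + 2 \<le> 2 * card (A \<union> B)"
    using fin assms by (intro sparse_onD[OF sp]) auto
  moreover have "card (ind F (A \<inter> B)) + 2 \<le> 2 * card (A \<inter> B)"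
    using fin assms by (intro sparse_onD[OF sp]) auto
  ultimately show ?thesis
    using ind_Un_Int[OF F, of A B] card_Un_Int[OF fin(1,2)] A B fin by (auto simp: tight_def)
qed

context
  fixes F :: "'a set set" and W :: "'a set"
  assumes F: "edge_set F" and sp: "sparse_on F W" and finW: "finite W"
begin

lemma part_tight:
  assumes "x \<in> W" shows "tight F (part F W x)"
proof -
  let ?S = "{Z. Z \<subseteq> W \<and> tight F Z \<and> x \<in> Z}"
  have "finite ?S" by (rule finite_subset[of _ "Pow W"]) (use finW in auto)
  moreover have "{x} \<in> ?S" using assms tight_singleton[OF F] by auto
  ultimately obtain P where P: "P \<in> ?S" "\<forall>Z\<in>?S. P \<subseteq> Z \<longrightarrow> P = Z"
    by (rule finite_maximal_set)
  have "Z \<subseteq> P" if Z: "Z \<in> ?S" for Z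
  proof -
    have "P \<inter> Z \<noteq> {}" using Z P(1) by blast
    then have "tight F (P \<union> Z)" using tight_Un[OF F sp] Z P(1) by blast
    then have "P \<union> Z \<in> ?S" using Z P(1) by blast
    then show ?thesis using P(2) by blast
  qed
  then have "part F W x = P" using P(1) by (auto simp: part_def)
  then show ?thesis using P(1) by simp
qed

lemma part_self: "x \<in> W \<Longrightarrow> x \<in> part F W x"
  using tight_singleton[OF F, of x] by (auto simp: part_def)

lemma part_subset: "part F W x \<subseteq> W"
  by (auto simp: part_def)

lemma subset_part: "tight F Z \<Longrightarrow> Z \<subseteq> W \<Longrightarrow> x \<in> Z \<Longrightarrow> Z \<subseteq> part F W x"
  by (auto simp: part_def)

lemma part_eq:
  assumes "x \<in> W" "y \<in> part F W x" shows "part F W y = part F W x"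
proof -
  have y: "y \<in> W" using assms part_subset by blast
  have "part F W x \<subseteq> part F W y"
    using subset_part[OF part_tight[OF assms(1)] part_subset assms(2)] .
  moreover have "part F W y \<subseteq> part F W x"
    using subset_part[OF part_tight[OF y] part_subset, of x] part_self[OF assms(1)] calculation
    by blast
  ultimately show ?thesis by blast
qed

lemma part_disjoint:
  assumes "x \<in> W" "y \<in> W" "part F W x \<noteq> part F W y"
  shows "part F W x \<inter> part F W y = {}"
  using part_eq assms by blast

text \<open>Disjoint parts share no edge, as such an edge would lie in the empty set.
  \<open>J\<close> may differ from \<open>F\<close>: the augmentation argument counts two edge sets
  over the parts of one of them.\<close>

lemma card_ind_parts:
  assumes J: "edge_set J"
  shows "card (\<Union>P\<in>part F W ` W. ind J P) = (\<Sum>P\<in>part F W ` W. card (ind J P))"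
proof (rule card_UN_disjoint)
  show "finite (part F W ` W)" using finW by simp
  show "\<forall>P\<in>part F W ` W. finite (ind J P)" using J by (simp add: edge_set_def)
  show "\<forall>P\<in>part F W ` W. \<forall>Q\<in>part F W ` W. P \<noteq> Q \<longrightarrow> ind J P \<inter> ind J Q = {}"
  proof (intro ballI impI)
    fix P Q assume "P \<in> part F W ` W" "Q \<in> part F W ` W" "P \<noteq> Q"
    then have "P \<inter> Q = {}" using part_disjoint by blast
    then have "ind J P \<inter> ind J Q \<subseteq> ind J {}" by (auto simp: ind_def)
    then show "ind J P \<inter> ind J Q = {}" using ind_empty[OF J] by simp
  qed
qed

end

section \<open>Independence, circuits and connectivity\<close>

definition sparse :: "'a set set \<Rightarrow> bool" where
  "sparse F \<longleftrightarrow> sparse_on F UNIV"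

definition circuit :: "'a set set \<Rightarrow> bool" where
  "circuit C \<longleftrightarrow> edge_set C \<and> \<not> sparse C \<and> (\<forall>e\<in>C. sparse (C - {e}))"

lemma sparseD: "sparse F \<Longrightarrow> finite Z \<Longrightarrow> Z \<noteq> {} \<Longrightarrow> card (ind F Z) + 2 \<le> 2 * card Z"
  by (auto simp: sparse_def sparse_on_def)

lemma sparseI: "(\<And>Z. finite Z \<Longrightarrow> Z \<noteq> {} \<Longrightarrow> card (ind F Z) + 2 \<le> 2 * card Z) \<Longrightarrow> sparse F"
  by (auto simp: sparse_def sparse_on_def)

lemma not_sparseE:
  assumes "\<not> sparse F"
  obtains Z where "finite Z" "Z \<noteq> {}" "\<not> card (ind F Z) + 2 \<le> 2 * card Z"
  using assms by (auto simp: sparse_def sparse_on_def)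

lemma sparse_mono:
  assumes "sparse F" "F' \<subseteq> F" "finite F" shows "sparse F'"
proof (rule sparseI)
  fix Z :: "'a set" assume "finite Z" "Z \<noteq> {}"
  have "card (ind F' Z) \<le> card (ind F Z)"
    using assms by (intro card_mono) (auto simp: ind_def)
  then show "card (ind F' Z) + 2 \<le> 2 * card Z" using sparseD[OF assms(1) \<open>finite Z\<close> \<open>Z \<noteq> {}\<close>] by simp
qed

lemma sparse_empty: "sparse {}"
proof (rule sparseI)
  fix Z :: "'a set" assume "finite Z" "Z \<noteq> {}"
  then have "card Z > 0" by (simp add: card_gt_0_iff)
  then show "card (ind {} Z) + 2 \<le> 2 * card Z" by (simp add: ind_def)
qed

lemma sparse_card: "sparse F \<Longrightarrow> finite W \<Longrightarrow> W \<noteq> {} \<Longrightarrow> \<Union>F \<subseteq> W \<Longrightarrow> card F + 2 \<le> 2 * card W"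
proof -
  assume a: "sparse F" "finite W" "W \<noteq> {}" "\<Union>F \<subseteq> W"
  then have "ind F W = F" by (auto simp: ind_def)
  then show ?thesis using sparseD[OF a(1-3)] by simp
qed

text \<open>The exchange property of the matroid. If no edge of \<open>J - I\<close> can be added,
  each lies in a maximal tight set of \<open>I\<close>. Within every such part \<open>I\<close> has
  as many edges as a sparse set can have, and outside the parts every edge of \<open>J\<close>
  already belongs to \<open>I\<close>; hence \<open>J\<close> is not larger.\<close>

lemma sparse_augment:
  assumes I: "edge_set I" "sparse I" and J: "edge_set J" "sparse J" and lt: "card I < card J"
  shows "\<exists>e\<in>J - I. sparse (insert e I)"
proof (rule ccontr)
  assume no: "\<not> ?thesis"
  define W where "W = \<Union>I \<union> \<Union>J"
  have finW: "finite W" using I J edge_set_finite_Union by (auto simp: W_def)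
  have sp: "sparse_on I W" using I(2) by (auto simp: sparse_def sparse_on_def)
  let ?P = "part I W ` W"
  have fin: "finite I" "finite J" using I J by (auto simp: edge_set_def)
  have inpart: "e \<in> (\<Union>P\<in>?P. ind J P)" if e: "e \<in> J - I" for e
  proof -
    have "\<not> sparse (insert e I)" using no e by blast
    then obtain Z where Z: "finite Z" "Z \<noteq> {}" "\<not> card (ind (insert e I) Z) + 2 \<le> 2 * card Z"
      by (rule not_sparseE)
    have iZ: "card (ind I Z) + 2 \<le> 2 * card Z" using sparseD[OF I(2) Z(1,2)] .
    have eZ: "e \<subseteq> Z"
    proof (rule ccontr)
      assume "\<not> e \<subseteq> Z" then have "ind (insert e I) Z = ind I Z" by (auto simp: ind_def)
      then show False using Z(3) iZ by simp
    qed
    then have "ind (insert e I) Z = insert e (ind I Z)" "e \<notin> ind I Z" using e by (auto simp: ind_def)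
    then have "card (ind (insert e I) Z) = Suc (card (ind I Z))" using fin by simp
    then have t: "tight I Z" using Z iZ by (auto simp: tight_def)
    \<comment> \<open>\<open>W\<close> contains all endpoints of \<open>I\<close>, so cutting
      \<open>Z\<close> down to \<open>W\<close> loses no induced edge; by sparsity the smaller set
      is still tight.\<close>
    have "card (ind I (Z \<inter> W)) = card (ind I Z)" by (rule arg_cong[of _ _ card]) (auto simp: ind_def W_def)
    moreover have ne: "e \<subseteq> Z \<inter> W" using eZ e by (auto simp: W_def)
    have "e \<noteq> {}" using e J by (auto simp: edge_set_def)
    then obtain x where x: "x \<in> e" by blast
    have "card (ind I (Z \<inter> W)) + 2 \<le> 2 * card (Z \<inter> W)"
      using sparseD[OF I(2), of "Z \<inter> W"] Z(1) ne x by blast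
    moreover have "card (Z \<inter> W) \<le> card Z" using Z(1) by (intro card_mono) auto
    ultimately have "tight I (Z \<inter> W)" using t ne x Z(1) by (auto simp: tight_def)
    then have "Z \<inter> W \<subseteq> part I W x" using subset_part[OF I(1) sp finW] x ne by blast
    then have "e \<in> ind J (part I W x)" using e ne by (auto simp: ind_def)
    moreover have "x \<in> W" using x ne by blast
    ultimately show ?thesis by blast
  qed
  have dec: "card K = (\<Sum>P\<in>?P. card (ind K P)) + card (K - (\<Union>P\<in>?P. ind K P))"
    if K: "edge_set K" for K
  proof -
    have "(\<Union>P\<in>?P. ind K P) \<subseteq> K" by (auto simp: ind_def)
    then have "card K = card (\<Union>P\<in>?P. ind K P) + card (K - (\<Union>P\<in>?P. ind K P))"
      using K by (metis card_Diff_subset card_mono edge_set_finite finite_subset le_add_diff_inverse)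
    then show ?thesis using card_ind_parts[OF I(1) sp finW K] by simp
  qed
  have "card (ind J P) \<le> card (ind I P)" if "P \<in> ?P" for P
  proof -
    obtain x where x: "x \<in> W" "P = part I W x" using \<open>P \<in> ?P\<close> by blast
    have t: "tight I P" using part_tight[OF I(1) sp finW x(1)] x by simp
    then show ?thesis using sparseD[OF J(2), of P] by (auto simp: tight_def)
  qed
  then have "(\<Sum>P\<in>?P. card (ind J P)) \<le> (\<Sum>P\<in>?P. card (ind I P))" by (rule sum_mono)
  moreover have "card (J - (\<Union>P\<in>?P. ind J P)) \<le> card (I - (\<Union>P\<in>?P. ind I P))"
  proof (rule card_mono)
    show "J - (\<Union>P\<in>?P. ind J P) \<subseteq> I - (\<Union>P\<in>?P. ind I P)"
      using inpart by (fastforce simp: ind_def)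
  qed (use fin in simp)
  ultimately have "card J \<le> card I" using dec[OF I(1)] dec[OF J(1)] by linarith
  then show False using lt by simp
qed

lemma maximal_sparse_superset:
  assumes "edge_set F" "I \<subseteq> F" "sparse I"
  obtains B where "I \<subseteq> B" "B \<subseteq> F" "sparse B" "\<And>e. e \<in> F - B \<Longrightarrow> \<not> sparse (insert e B)"
proof -
  let ?S = "{B. I \<subseteq> B \<and> B \<subseteq> F \<and> sparse B}"
  have "finite ?S" by (rule finite_subset[of _ "Pow F"]) (use assms in \<open>auto simp: edge_set_def\<close>)
  moreover have "I \<in> ?S" using assms by auto
  ultimately obtain B where B: "B \<in> ?S" "\<forall>Z\<in>?S. B \<subseteq> Z \<longrightarrow> B = Z"
    by (rule finite_maximal_set)
  have "\<not> sparse (insert e B)" if "e \<in> F - B" for e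
    using B that by blast
  then show ?thesis using that B(1) by blast
qed

lemma sparse_card_le_maximal:
  assumes F: "edge_set F" and B: "B \<subseteq> F" "sparse B" "\<And>e. e \<in> F - B \<Longrightarrow> \<not> sparse (insert e B)"
    and J: "J \<subseteq> F" "sparse J"
  shows "card J \<le> card B"
  using sparse_augment[OF edge_set_subset[OF F B(1)] B(2) edge_set_subset[OF F J(1)] J(2)] B J
  by (meson Diff_iff not_le subsetD)

text \<open>A rank argument: extend \<open>J\<close> to a basis \<open>K\<close> of
  \<open>F\<close>. It stays maximal in \<open>insert e F\<close>, so no sparse subset there is
  larger than \<open>K\<close>, and \<open>K\<close> is no larger than \<open>B\<close>.\<close>

lemma maximal_sparse_span:
  assumes F: "edge_set F" and e: "card e = 2" "e \<notin> F"
    and B: "B \<subseteq> F" "sparse B" "\<And>e. e \<in> F - B \<Longrightarrow> \<not> sparse (insert e B)"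
    and J: "J \<subseteq> F" "sparse J" "\<not> sparse (insert e J)"
  shows "\<not> sparse (insert e B)"
proof
  assume s: "sparse (insert e B)"
  obtain K where K: "J \<subseteq> K" "K \<subseteq> F" "sparse K" "\<And>e. e \<in> F - K \<Longrightarrow> \<not> sparse (insert e K)"
    using maximal_sparse_superset[OF F J(1,2)] by metis
  have Fe: "edge_set (insert e F)" using F e by (auto simp: edge_set_def)
  have finK: "finite (insert e K)" using K(2) F by (auto simp: edge_set_def intro: finite_subset)
  have "\<not> sparse (insert e K)" using sparse_mono[of "insert e K" "insert e J"] J(3) K(1) finK by blast
  then have "card (insert e B) \<le> card K"
    using K B s by (intro sparse_card_le_maximal[OF Fe]) auto
  moreover have "card K \<le> card B" using sparse_card_le_maximal[OF F B K(2,3)] by simp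
  moreover have "finite B" "e \<notin> B" using B(1) e F by (auto simp: edge_set_def intro: finite_subset)
  ultimately show False by simp
qed

lemma circuit_edge_set: "circuit C \<Longrightarrow> edge_set C"
  by (simp add: circuit_def)

lemma circuit_nonempty: "circuit C \<Longrightarrow> C \<noteq> {}"
  using sparse_empty by (auto simp: circuit_def)

lemma circuit_proper_sparse:
  assumes "circuit C" "F \<subset> C" shows "sparse F"
proof -
  obtain e where "e \<in> C" "F \<subseteq> C - {e}" using assms by blast
  then show ?thesis using assms sparse_mono[of "C - {e}" F] by (auto simp: circuit_def edge_set_def)
qed

lemma circuit_subset_eq: "circuit C \<Longrightarrow> circuit C' \<Longrightarrow> C' \<subseteq> C \<Longrightarrow> C' = C"
  using circuit_proper_sparse by (auto simp: circuit_def)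

text \<open>A vertex set witnessing dependence must induce every edge, since otherwise a proper
  subset would be dependent; this bounds \<open>card C\<close> from below. Removing one edge leaves
  a sparse set, which gives the upper bound.\<close>

lemma circuit_card:
  assumes C: "circuit C" shows "card C + 1 = 2 * card (\<Union>C)"
proof -
  have fin: "finite C" "finite (\<Union>C)" using C edge_set_finite_Union by (auto simp: circuit_def edge_set_def)
  obtain Z where Z: "finite Z" "Z \<noteq> {}" "\<not> card (ind C Z) + 2 \<le> 2 * card Z"
    using C not_sparseE[of C] by (auto simp: circuit_def)
  have "ind C Z = C"
  proof (rule ccontr)
    assume "ind C Z \<noteq> C"
    then have "ind C Z \<subset> C" by (auto simp: ind_def)
    then have "sparse (ind C Z)" using circuit_proper_sparse[OF C] by blast
    moreover have "ind (ind C Z) Z = ind C Z" by (auto simp: ind_def)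
    ultimately show False using sparseD[of "ind C Z" Z] Z by simp
  qed
  then have "\<Union>C \<subseteq> Z" by (auto simp: ind_def)
  then have "card (\<Union>C) \<le> card Z" using Z(1) by (simp add: card_mono)
  then have lo: "2 * card (\<Union>C) \<le> card C + 1" using Z(3) \<open>ind C Z = C\<close> by simp
  obtain e where e: "e \<in> C" using circuit_nonempty[OF C] by blast
  then have "e \<noteq> {}" using C by (auto simp: circuit_def edge_set_def)
  then have "\<Union>C \<noteq> {}" using e by blast
  then have "card (C - {e}) + 2 \<le> 2 * card (\<Union>C)"
    using C e fin by (intro sparse_card) (auto simp: circuit_def)
  then have "card C + 1 \<le> 2 * card (\<Union>C)" using e fin by (simp add: card_Diff_singleton)
  then show ?thesis using lo by simp
qed

lemma circuit_card_ge: assumes "circuit C" shows "card C \<ge> 3"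
proof -
  obtain e where e: "e \<in> C" using circuit_nonempty[OF assms] by blast
  then have "card e = 2" using assms by (auto simp: circuit_def edge_set_def)
  moreover have "card e \<le> card (\<Union>C)"
    using e assms edge_set_finite_Union by (intro card_mono) (auto simp: circuit_def)
  ultimately show ?thesis using circuit_card[OF assms] by simp
qed

lemma dependent_circuit:
  assumes "edge_set F" "\<not> sparse F" obtains C where "C \<subseteq> F" "circuit C"
proof -
  let ?S = "{C. C \<subseteq> F \<and> \<not> sparse C}"
  have "finite ?S" by (rule finite_subset[of _ "Pow F"]) (use assms in \<open>auto simp: edge_set_def\<close>)
  moreover have "F \<in> ?S" using assms by auto
  ultimately obtain C where C: "C \<in> ?S" "\<forall>Z\<in>?S. Z \<subseteq> C \<longrightarrow> C = Z"
    by (rule finite_minimal_set)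
  have "sparse (C - {e})" if "e \<in> C" for e
    using C that by blast
  then show ?thesis using that C(1) edge_set_subset[OF assms(1)] by (auto simp: circuit_def)
qed

lemma insert_dependent_circuit:
  assumes "edge_set (insert e F)" "\<not> sparse (insert e F)" "sparse F"
  obtains C where "C \<subseteq> insert e F" "circuit C" "e \<in> C"
proof -
  obtain C where C: "C \<subseteq> insert e F" "circuit C" using dependent_circuit assms by metis
  have "e \<in> C"
  proof (rule ccontr)
    assume "e \<notin> C"
    then have "C \<subseteq> F" using C by blast
    then show False using sparse_mono[OF assms(3)] C assms(1) by (auto simp: circuit_def edge_set_def)
  qed
  then show ?thesis using that C by blast
qed

text \<open>Let \<open>I\<close> be a basis of the union without \<open>e\<close> and
  \<open>f\<close>. It spans \<open>f\<close> through \<open>C2 - {f}\<close>, so it remains a basis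
  after \<open>f\<close> is put back, so it spans \<open>e\<close> through \<open>C1 - {e}\<close>.
  The circuit that \<open>e\<close> closes with \<open>I\<close> avoids \<open>f\<close>.\<close>

lemma strong_circuit_elimination:
  assumes C1: "circuit C1" and C2: "circuit C2" and f: "f \<in> C1" "f \<in> C2" and e: "e \<in> C1" "e \<notin> C2"
  obtains C where "circuit C" "e \<in> C" "C \<subseteq> C1 \<union> C2 - {f}"
proof -
  define F where "F = (C1 \<union> C2) - {e, f}"
  have es: "edge_set (C1 \<union> C2)" using C1 C2 by (auto simp: circuit_def edge_set_def)
  have F: "edge_set F" using edge_set_subset[OF es] by (auto simp: F_def)
  have F': "edge_set (insert f F)" using edge_set_subset[OF es] f by (auto simp: F_def)
  obtain I where I: "{} \<subseteq> I" "I \<subseteq> F" "sparse I" "\<And>e. e \<in> F - I \<Longrightarrow> \<not> sparse (insert e I)"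
    using maximal_sparse_superset[OF F, of "{}"] sparse_empty by blast
  have c2: "card e = 2" "card f = 2" using es e f by (auto simp: edge_set_def)
  have "insert f (C2 - {f}) = C2" using f by blast
  note Cf = this
  have If: "\<not> sparse (insert f I)"
    by (rule maximal_sparse_span[OF F _ _ I(2-4), of f "C2 - {f}"])
      (use C2 f e c2 Cf in \<open>auto simp: F_def circuit_def\<close>)
  have "insert e (C1 - {e}) = C1" using e by blast
  note Ce = this
  have Ie: "\<not> sparse (insert e I)"
    by (rule maximal_sparse_span[OF F', of e I "C1 - {e}"])
      (use C1 e f c2 I If Ce in \<open>auto simp: F_def circuit_def\<close>)
  moreover have "edge_set (insert e I)" using I(2) F c2 by (auto simp: edge_set_def intro: finite_subset)
  ultimately obtain C where "C \<subseteq> insert e I" "circuit C" "e \<in> C" using insert_dependent_circuit I(3) by metis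
  moreover have "insert e I \<subseteq> C1 \<union> C2 - {f}" using I(2) e f by (auto simp: F_def)
  ultimately show ?thesis using that by blast
qed

text \<open>Two eliminations shrink the pair. The first yields \<open>C3\<close> through
  \<open>e\<close>, containing an edge \<open>h\<close> of \<open>C2\<close> outside
  \<open>C1\<close>; the second removes \<open>h\<close> from \<open>C2 \<union> C3\<close> and
  keeps \<open>g\<close>. The result still meets \<open>C1\<close>, and its union with
  \<open>C1\<close> misses \<open>h\<close>.\<close>

lemma circuit_trans:
  assumes "circuit C1" "circuit C2" "C1 \<subseteq> E" "C2 \<subseteq> E" "C1 \<inter> C2 \<noteq> {}" "e \<in> C1" "g \<in> C2"
  shows "\<exists>C. circuit C \<and> C \<subseteq> E \<and> e \<in> C \<and> g \<in> C"
  using assms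
proof (induction "card (C1 \<union> C2)" arbitrary: C1 C2 rule: less_induct)
  case less
  show ?case
  proof (cases "e \<in> C2 \<or> g \<in> C1")
    case True then show ?thesis using less.prems by blast
  next
    case False
    obtain f where f: "f \<in> C1" "f \<in> C2" using less.prems by blast
    obtain C3 where C3: "circuit C3" "e \<in> C3" "C3 \<subseteq> C1 \<union> C2 - {f}"
      using strong_circuit_elimination[OF less.prems(1,2) f] less.prems False by blast
    have "\<not> C3 \<subseteq> C1" using circuit_subset_eq[OF less.prems(1) C3(1)] C3 f by blast
    then obtain h where h: "h \<in> C3" "h \<in> C2" "h \<notin> C1" using C3 by blast
    show ?thesis
    proof (cases "g \<in> C3")
      case True then show ?thesis using C3 less.prems by blast
    next
      case g: False
      obtain C4 where C4: "circuit C4" "g \<in> C4" "C4 \<subseteq> C2 \<union> C3 - {h}"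
        using strong_circuit_elimination[OF less.prems(2) C3(1) h(2,1) less.prems(7) g] by blast
      have "\<not> C4 \<subseteq> C2" using circuit_subset_eq[OF less.prems(2) C4(1)] C4 h by blast
      then have "C1 \<inter> C4 \<noteq> {}" using C4 C3 by blast
      moreover have "C1 \<union> C4 \<subset> C1 \<union> C2" using C4 C3 h by blast
      then have "card (C1 \<union> C4) < card (C1 \<union> C2)"
        using less.prems(1,2) by (intro psubset_card_mono) (auto simp: circuit_def edge_set_def)
      moreover have "C4 \<subseteq> E" using C4 C3 less.prems by blast
      ultimately show ?thesis using less.hyps[of C1 C4] less.prems C4 by blast
    qed
  qed
qed

section \<open>Connectivity of the matroid on an edge set\<close>

definition conn :: "'a set set \<Rightarrow> bool" where
  "conn E \<longleftrightarrow> edge_set E \<and> card E \<ge> 2 \<and>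
     (\<forall>e\<in>E. \<forall>f\<in>E. e \<noteq> f \<longrightarrow> (\<exists>C. circuit C \<and> C \<subseteq> E \<and> e \<in> C \<and> f \<in> C))"

lemma connD: "conn E \<Longrightarrow> e \<in> E \<Longrightarrow> f \<in> E \<Longrightarrow> e \<noteq> f \<Longrightarrow> \<exists>C. circuit C \<and> C \<subseteq> E \<and> e \<in> C \<and> f \<in> C"
  by (auto simp: conn_def)

lemma conn_edge_set: "conn E \<Longrightarrow> edge_set E"
  by (simp add: conn_def)

lemma conn_circuit:
  assumes "conn E" "e \<in> E" obtains C where "circuit C" "C \<subseteq> E" "e \<in> C"
proof -
  have "E \<noteq> {e}" using assms by (auto simp: conn_def)
  then obtain f where "f \<in> E" "f \<noteq> e" using assms by blast
  then show ?thesis using that connD[OF assms(1,2)] by metis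
qed

text \<open>Any two edges are linked through the hub \<open>h\<close> by
  \<open>circuit_trans\<close>. A circuit in \<open>E\<close> also supplies the bound on
  \<open>card E\<close>.\<close>

lemma conn_via:
  assumes E: "edge_set E" and h: "h \<in> E"
    and "\<And>e. e \<in> E \<Longrightarrow> \<exists>C. circuit C \<and> C \<subseteq> E \<and> e \<in> C \<and> h \<in> C"
  shows "conn E"
proof -
  obtain C where C: "circuit C" "C \<subseteq> E" using assms by blast
  have "card E \<ge> 2" using circuit_card_ge[OF C(1)] card_mono[OF _ C(2)] E by (auto simp: edge_set_def)
  moreover have "\<exists>C. circuit C \<and> C \<subseteq> E \<and> e \<in> C \<and> f \<in> C" if ef: "e \<in> E" "f \<in> E" for e f
  proof -
    obtain C1 C2 where "circuit C1" "C1 \<subseteq> E" "e \<in> C1" "h \<in> C1" "circuit C2" "C2 \<subseteq> E" "f \<in> C2" "h \<in> C2"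
      using assms(3) ef by metis
    then show ?thesis using circuit_trans[of C1 C2 E e f] by blast
  qed
  ultimately show ?thesis using E by (auto simp: conn_def)
qed

lemma circuit_conn: assumes "circuit C" shows "conn C"
proof -
  obtain h where "h \<in> C" using circuit_nonempty[OF assms] by blast
  then show ?thesis using assms by (intro conn_via[of C h]) (auto simp: circuit_def)
qed

lemma conn_Un_circuit:
  assumes D: "conn D" and C: "circuit C" and ne: "C \<inter> D \<noteq> {}"
  shows "conn (D \<union> C)"
proof -
  obtain h where h: "h \<in> C" "h \<in> D" using ne by blast
  show ?thesis
  proof (rule conn_via[of _ h])
    show "edge_set (D \<union> C)" using D C by (auto simp: conn_def circuit_def edge_set_def)
    show "h \<in> D \<union> C" using h by blast
    fix e assume e: "e \<in> D \<union> C"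
    show "\<exists>K. circuit K \<and> K \<subseteq> D \<union> C \<and> e \<in> K \<and> h \<in> K"
    proof (cases "e \<in> C")
      case True then show ?thesis using C h by blast
    next
      case False
      then have "e \<in> D" "e \<noteq> h" using e h by auto
      then show ?thesis using connD[OF D _ h(2)] by blast
    qed
  qed
qed

text \<open>Connectedness forces full rank. For a basis \<open>T\<close>, every edge of
  \<open>D\<close> lies in a tight set of \<open>T\<close>; then so does every pair of vertices,
  because a circuit reaching both has full rank on its own vertices. So \<open>\<Union>D\<close> is
  a single part.\<close>

lemma conn_spanning_tight:
  assumes D: "conn D"
  obtains T where "T \<subseteq> D" "sparse T" "card T + 2 = 2 * card (\<Union>D)"
proof -
  have eD: "edge_set D" using conn_edge_set[OF D] .
  obtain T where T: "{} \<subseteq> T" "T \<subseteq> D" "sparse T" "\<And>e. e \<in> D - T \<Longrightarrow> \<not> sparse (insert e T)"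
    using maximal_sparse_superset[OF eD, of "{}"] sparse_empty by blast
  have eT: "edge_set T" using edge_set_subset[OF eD T(2)] .
  define W where "W = \<Union>D"
  have finW: "finite W" using eD edge_set_finite_Union W_def by blast
  have sp: "sparse_on T W" using T(3) by (auto simp: sparse_def sparse_on_def)
  note pt = part_tight[OF eT sp finW] and ps = part_self[OF eT sp finW]
  have ext: "tight T (Z \<inter> W) \<and> e \<subseteq> Z \<inter> W"
    if "card e = 2" "e \<subseteq> W" "e \<notin> T" "\<not> card (ind (insert e T) Z) + 2 \<le> 2 * card Z" "finite Z" "Z \<noteq> {}" for e Z
  proof -
    have iZ: "card (ind T Z) + 2 \<le> 2 * card Z" using sparseD[OF T(3) that(5,6)] .
    have eZ: "e \<subseteq> Z"
    proof (rule ccontr)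
      assume "\<not> e \<subseteq> Z" then have "ind (insert e T) Z = ind T Z" by (auto simp: ind_def)
      then show False using that(4) iZ by simp
    qed
    then have "ind (insert e T) Z = insert e (ind T Z)" "e \<notin> ind T Z" using that by (auto simp: ind_def)
    then have a: "card (ind (insert e T) Z) = Suc (card (ind T Z))" using eT by (simp add: edge_set_def)
    have b: "card (ind T (Z \<inter> W)) = card (ind T Z)"
      using T(2) by (intro arg_cong[of _ _ card]) (auto simp: ind_def W_def)
    have ne: "Z \<inter> W \<noteq> {}" using that(1,2) eZ by (cases "e = {}") auto
    have "card (ind T (Z \<inter> W)) + 2 \<le> 2 * card (Z \<inter> W)"
      using sparseD[OF T(3), of "Z \<inter> W"] that(5) ne by blast
    moreover have "card (Z \<inter> W) \<le> card Z" using that(5) by (intro card_mono) auto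
    ultimately have "tight T (Z \<inter> W)" using a b that ne iZ by (auto simp: tight_def)
    then show ?thesis using eZ that by blast
  qed
  have dep: "\<exists>Z. tight T Z \<and> Z \<subseteq> W \<and> e \<subseteq> Z"
    if e: "card e = 2" "e \<subseteq> W" "e \<notin> T" and nsp: "\<not> sparse (insert e T)" for e
  proof -
    obtain Z where "finite Z" "Z \<noteq> {}" "\<not> card (ind (insert e T) Z) + 2 \<le> 2 * card Z"
      using nsp by (rule not_sparseE)
    then have "tight T (Z \<inter> W) \<and> e \<subseteq> Z \<inter> W" using ext[OF e] by blast
    then show ?thesis by blast
  qed
  have Din: "\<exists>Z. tight T Z \<and> Z \<subseteq> W \<and> e \<subseteq> Z" if e: "e \<in> D" for e
  proof (cases "e \<in> T")
    case False
    then show ?thesis using dep T(4) e eD by (auto simp: W_def edge_set_def)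
  next
    case eT': True
    show ?thesis
    proof (rule ccontr)
      assume no: "\<not> ?thesis"
      \<comment> \<open>\<open>e\<close> lies in a circuit, so \<open>D - {e}\<close> has the rank
        of \<open>D\<close> and \<open>T - {e}\<close> can be completed by some \<open>g\<close>
        outside \<open>T\<close>. The tight set that forbids adding \<open>g\<close> to
        \<open>T\<close> must contain \<open>e\<close>, since otherwise it would still forbid
        \<open>g\<close> after the exchange.\<close>
      have De: "edge_set (D - {e})" using edge_set_subset[OF eD] by blast
      obtain C where C: "circuit C" "C \<subseteq> D" "e \<in> C" using conn_circuit[OF D e] .
      obtain I where I: "{} \<subseteq> I" "I \<subseteq> D - {e}" "sparse I" "\<And>f. f \<in> D - {e} - I \<Longrightarrow> \<not> sparse (insert f I)"
        using maximal_sparse_superset[OF De, of "{}"] sparse_empty by blast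
      have Ce: "insert e (C - {e}) = C" using C by blast
      have "\<not> sparse (insert e I)"
        by (rule maximal_sparse_span[OF De, of e I "C - {e}"])
          (use C I(2-4) e eD Ce in \<open>auto simp: circuit_def edge_set_def\<close>)
      then have "card T \<le> card I"
        using I T by (intro sparse_card_le_maximal[OF eD, of I T]) auto
      moreover have "finite T" using eT by (simp add: edge_set_def)
      ultimately have "card (T - {e}) < card I" using card_Diff1_less[OF _ eT'] by simp
      moreover have "edge_set (T - {e})" "edge_set I"
        using edge_set_subset[OF eT] edge_set_subset[OF De I(2)] by auto
      moreover have "sparse (T - {e})" using sparse_mono[OF T(3)] eT by (auto simp: edge_set_def)
      ultimately obtain g where g: "g \<in> I - (T - {e})" "sparse (insert g (T - {e}))"
        using sparse_augment I(3) by blast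
      have gT: "g \<in> D" "g \<noteq> e" "g \<notin> T" using g I by auto
      then have "card g = 2" "g \<subseteq> W" using eD by (auto simp: edge_set_def W_def)
      then obtain Z where Z: "tight T Z" "Z \<subseteq> W" "g \<subseteq> Z" using dep gT T(4) by blast
      then have "\<not> e \<subseteq> Z" using no by blast
      then have "ind (insert g (T - {e})) Z = insert g (ind T Z)" using Z by (auto simp: ind_def)
      then have "card (ind (insert g (T - {e})) Z) = Suc (card (ind T Z))"
        using gT eT by (auto simp: ind_def edge_set_def)
      then show False using sparseD[OF g(2), of Z] Z by (auto simp: tight_def)
    qed
  qed
  have joined: "part T W a = part T W b" if ab: "a \<in> W" "b \<in> W" for a b
  proof (cases "a = b")
    case False
    obtain ea eb where ea: "ea \<in> D" "a \<in> ea" and eb: "eb \<in> D" "b \<in> eb" using ab by (auto simp: W_def)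
    obtain C where C: "circuit C" "C \<subseteq> D" "a \<in> \<Union>C" "b \<in> \<Union>C"
    proof (cases "ea = eb")
      case True then show ?thesis using that conn_circuit[OF D ea(1)] ea eb by (metis UnionI)
    next
      case False then show ?thesis using that connD[OF D ea(1) eb(1)] ea eb by (metis UnionI)
    qed
    have "\<exists>Z. tight T Z \<and> Z \<subseteq> W \<and> {a, b} \<subseteq> Z"
    proof (cases "{a, b} \<in> D")
      case True then show ?thesis using Din by blast
    next
      case nD: False
      \<comment> \<open>Without \<open>f\<close> the circuit has as many edges as a sparse set on
        its vertices can have. So it spans even the non-edge \<open>ab\<close>, and hence
        \<open>T\<close> does.\<close>
      obtain f where f: "f \<in> C" using circuit_nonempty[OF C(1)] by blast
      have fin: "finite C" "finite (\<Union>C)" using C(1) edge_set_finite_Union by (auto simp: circuit_def edge_set_def)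
      have "\<not> sparse (insert {a, b} (C - {f}))"
      proof
        assume "sparse (insert {a, b} (C - {f}))"
        then have "card (insert {a, b} (C - {f})) + 2 \<le> 2 * card (\<Union>C)"
          using fin C(3,4) f by (intro sparse_card) auto
        moreover have "card (insert {a, b} (C - {f})) = card C"
          using fin nD C(2) f card_Suc_Diff1[of C f] by (subst card_insert_disjoint) auto
        ultimately show False using circuit_card[OF C(1)] by simp
      qed
      note Cab = this
      have "\<not> sparse (insert {a, b} T)"
        by (rule maximal_sparse_span[OF eD, of "{a, b}" T "C - {f}"])
          (use C False nD f T(2-4) Cab in \<open>auto simp: circuit_def\<close>)
      then show ?thesis using dep[of "{a, b}"] False ab nD T(2) by auto
    qed
    then obtain Z where Z: "tight T Z" "Z \<subseteq> W" "{a, b} \<subseteq> Z" by blast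
    then have "b \<in> part T W a" using subset_part[OF eT sp finW] by blast
    then show ?thesis using part_eq[OF eT sp finW ab(1)] by simp
  qed simp
  have "D \<noteq> {}" using D by (auto simp: conn_def)
  then obtain e where e: "e \<in> D" by blast
  then obtain x y where "e = {x, y}" using edge_set_edgeE[OF eD] by metis
  then have x: "x \<in> W" using e by (auto simp: W_def)
  have "part T W x = W"
    using joined[OF x] ps part_subset[OF eT sp finW] by blast
  then have "tight T W" using pt[OF x] by simp
  moreover have "ind T W = T" using T(2) by (auto simp: ind_def W_def)
  ultimately show ?thesis using that T by (auto simp: tight_def W_def)
qed

section \<open>Translation between the graph definitions and edge sets\<close>

lemma edge_set_nonempty: "edge_set E \<Longrightarrow> e \<in> E \<Longrightarrow> e \<noteq> {}"
  by (auto simp: edge_set_def)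

lemma edge_set_simple_graph: "edge_set F \<Longrightarrow> simple_graph (\<Union>F, F)"
  using edge_set_finite_Union by (auto simp: simple_graph_def edge_set_def)

lemma simple_graph_edge_set: "simple_graph G \<Longrightarrow> edge_set (edges G)"
  by (auto simp: simple_graph_def edge_set_def intro: finite_subset[of _ "Pow (verts G)"])

lemma M22_indep_iff_sparse:
  assumes F: "edge_set F" shows "M22_indep F \<longleftrightarrow> sparse F"
proof
  assume M: "M22_indep F"
  show "sparse F"
  proof (cases "F = {}")
    case True then show ?thesis using sparse_empty by simp
  next
    case False
    show ?thesis
    proof (rule sparseI)
      fix Z :: "'a set" assume Z: "finite Z" "Z \<noteq> {}"
      then have Z0: "card Z > 0" by (simp add: card_gt_0_iff)
      show "card (ind F Z) + 2 \<le> 2 * card Z"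
      proof (cases "ind F Z = {}")
        case True then show ?thesis using Z0 by simp
      next
        case ne: False
        let ?F = "ind F Z"
        have "simple_graph (\<Union>?F, ?F)"
          using edge_set_simple_graph edge_set_subset[OF F ind_subset] by blast
        then have "card ?F + 2 \<le> 2 * card (\<Union>?F)"
          using M False ne by (force simp: M22_indep_def sparse22_def subgraph_def ind_def)
        moreover have "card (\<Union>?F) \<le> card Z" using Z(1) by (intro card_mono) (auto simp: ind_def)
        ultimately show ?thesis by simp
      qed
    qed
  qed
next
  assume s: "sparse F"
  have "card (edges H) + 2 \<le> 2 * card (verts H)"
    if H: "subgraph H (\<Union>F, F)" "edges H \<noteq> {}" for H
  proof -
    have h: "simple_graph H" "edges H \<subseteq> F" using H by (auto simp: subgraph_def)
    have "sparse (edges H)" using sparse_mono[OF s h(2)] F by (simp add: edge_set_def)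
    moreover have "verts H \<noteq> {}" using h H(2) by (auto simp: simple_graph_def)
    ultimately show ?thesis using h by (intro sparse_card) (auto simp: simple_graph_def)
  qed
  then show "M22_indep F" by (auto simp: M22_indep_def sparse22_def)
qed

lemma M22_circuit_iff:
  assumes E: "edge_set E" shows "M22_circuit E C \<longleftrightarrow> C \<subseteq> E \<and> circuit C"
proof (cases "C \<subseteq> E")
  case True
  have C: "edge_set C" using edge_set_subset[OF E True] .
  have i: "M22_indep D \<longleftrightarrow> sparse D" if "D \<subseteq> C" for D
    using M22_indep_iff_sparse[OF edge_set_subset[OF C that]] .
  show ?thesis
  proof
    assume M: "M22_circuit E C"
    have "sparse (C - {e})" if "e \<in> C" for e
      using M i[of "C - {e}"] that by (auto simp: M22_circuit_def)
    then show "C \<subseteq> E \<and> circuit C" using M i[of C] C by (auto simp: M22_circuit_def circuit_def)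
  next
    assume c: "C \<subseteq> E \<and> circuit C"
    then have "\<not> M22_indep C" using i[of C] by (simp add: circuit_def)
    moreover have "M22_indep D" if "D \<subset> C" for D
      using i[of D] circuit_proper_sparse[of C D] c that by auto
    ultimately show "M22_circuit E C" using c by (simp add: M22_circuit_def)
  qed
qed (simp add: M22_circuit_def)

text \<open>A circuit has no isolated vertex: without it the same edges form a proper subgraph that
  already breaks the bound.\<close>

lemma circuit22_iff: "circuit22 H \<longleftrightarrow> verts H = \<Union>(edges H) \<and> circuit (edges H)"
proof -
  have eq: "circuit22 (\<Union>C, C) \<longleftrightarrow> circuit C" if "edge_set C" for C :: "'a set set"
    using M22_circuit_iff_circuit22[OF edge_set_simple_graph[OF that], of C] M22_circuit_iff[OF that, of C]
    by auto
  have "verts H = \<Union>(edges H)" if c: "circuit22 H"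
  proof (rule ccontr)
    assume ne: "verts H \<noteq> \<Union>(edges H)"
    have s: "simple_graph H" using c by (simp add: circuit22_def)
    have eH: "edge_set (edges H)" using simple_graph_edge_set[OF s] .
    have cnt: "card (edges H) + 1 = 2 * card (verts H)" using c by (simp add: circuit22_def)
    then have "edges H \<noteq> {}" by auto
    moreover have "\<Union>(edges H) \<subseteq> verts H" using s by (auto simp: simple_graph_def)
    moreover have "(\<Union>(edges H), edges H) \<noteq> H" using ne by (metis fst_conv)
    ultimately have "card (edges H) + 2 \<le> 2 * card (\<Union>(edges H))"
      using c edge_set_simple_graph[OF eH] by (fastforce simp: circuit22_def subgraph_def)
    moreover have "card (\<Union>(edges H)) \<le> card (verts H)"
      using s \<open>\<Union>(edges H) \<subseteq> verts H\<close> by (auto simp: simple_graph_def intro: card_mono)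
    ultimately show False using cnt by simp
  qed
  then show ?thesis using eq[of "edges H"] simple_graph_edge_set[of H]
    by (metis circuit22_def circuit_edge_set prod.collapse)
qed

lemma M22_connected_iff: "M22_connected (V, E) \<longleftrightarrow> V = \<Union>E \<and> conn E"
proof
  assume M: "M22_connected (V, E)"
  then have s: "simple_graph (V, E)" and dg: "\<forall>v\<in>V. degree (V, E) v \<noteq> 0"
    by (auto simp: M22_connected_def)
  have E: "edge_set E" using simple_graph_edge_set[OF s] by simp
  have "v \<in> \<Union>E" if "v \<in> V" for v
  proof -
    have "neighbours (V, E) v \<noteq> {}" using dg that by (auto simp: degree_def)
    then show ?thesis by (auto simp: neighbours_def)
  qed
  then have "V = \<Union>E" using s by (auto simp: simple_graph_def)
  moreover have "\<exists>C. circuit C \<and> C \<subseteq> E \<and> e \<in> C \<and> f \<in> C" if "e \<in> E" "f \<in> E" "e \<noteq> f" for e f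
  proof -
    obtain H where "subgraph H (V, E)" "circuit22 H" "e \<in> edges H" "f \<in> edges H"
      using M \<open>e \<in> E\<close> \<open>f \<in> E\<close> \<open>e \<noteq> f\<close> unfolding M22_connected_def by (metis snd_conv)
    then show ?thesis by (auto simp: circuit22_iff subgraph_def)
  qed
  then have "conn E" using M E by (auto simp: M22_connected_def conn_def)
  ultimately show "V = \<Union>E \<and> conn E" by simp
next
  assume a: "V = \<Union>E \<and> conn E"
  then have E: "edge_set E" by (simp add: conn_def)
  have s: "simple_graph (V, E)" using edge_set_simple_graph[OF E] a by simp
  have "degree (V, E) v \<noteq> 0" if v: "v \<in> V" for v
  proof -
    obtain e where e: "e \<in> E" "v \<in> e" using v a by blast
    then obtain w where "e = {v, w}" using edge_set_edgeE'[OF E] by metis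
    then have "w \<in> neighbours (V, E) v" using e by (simp add: neighbours_def)
    moreover have "finite (neighbours (V, E) v)"
      by (rule finite_subset[of _ V]) (use s in \<open>auto simp: neighbours_def simple_graph_def\<close>)
    ultimately show ?thesis by (auto simp: degree_def)
  qed
  moreover have "\<exists>H. subgraph H (V, E) \<and> circuit22 H \<and> e \<in> edges H \<and> f \<in> edges H"
    if ef: "e \<in> E" "f \<in> E" "e \<noteq> f" for e f
  proof -
    obtain C where C: "circuit C" "C \<subseteq> E" "e \<in> C" "f \<in> C" using connD[of E e f] a ef by metis
    then have "subgraph (\<Union>C, C) (V, E)" "circuit22 (\<Union>C, C)"
      using a edge_set_simple_graph[OF circuit_edge_set] by (auto simp: subgraph_def circuit22_iff)
    then show ?thesis using C by (metis snd_conv)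
  qed
  ultimately show "M22_connected (V, E)" using s a by (auto simp: M22_connected_def conn_def)
qed

section \<open>Attaching a vertex set to a connected part\<close>

text \<open>Removing any \<open>f \<in> F\<close> from \<open>T \<union> F\<close> leaves a sparse
  set, while \<open>T \<union> F\<close> has one edge too many on \<open>W \<union> Y\<close>. So a
  circuit in it passes through every edge of \<open>F\<close>; counts alone produce the
  circuit.\<close>

lemma tight_extension:
  assumes T: "edge_set T" "sparse T" and W: "finite W" "\<Union>T \<subseteq> W" and Tc: "card T + 2 = 2 * card W"
    and F: "edge_set F" and Y: "finite Y" "Y \<inter> W = {}"
    and FY: "\<And>e. e \<in> F \<Longrightarrow> e \<subseteq> W \<union> Y" "\<And>e. e \<in> F \<Longrightarrow> e \<inter> Y \<noteq> {}"
    and A: "\<And>Z. Z \<subseteq> Y \<Longrightarrow> Z \<noteq> {} \<Longrightarrow> 2 * card Z + 1 \<le> card (inc F Z)"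
    and Fc: "card F = 2 * card Y + 1"
    and B: "\<And>Z. Z \<subseteq> Y \<Longrightarrow> Z \<noteq> {} \<Longrightarrow> card (ind F Z) + 2 \<le> 2 * card Z"
  obtains C where "circuit C" "F \<subseteq> C" "C \<subseteq> T \<union> F"
proof -
  have finT: "finite T" and finF: "finite F" using T F by (auto simp: edge_set_def)
  have sp: "sparse (T \<union> (F - {f}))" if f: "f \<in> F" for f
  proof (rule sparseI)
    fix Z :: "'a set" assume Z: "finite Z" "Z \<noteq> {}"
    let ?F = "F - {f}"
    have cF: "card ?F = 2 * card Y" using Fc f finF by simp
    have le: "card (ind (T \<union> ?F) Z) \<le> card (ind T Z) + card (ind ?F Z)"
    proof -
      have "ind (T \<union> ?F) Z = ind T Z \<union> ind ?F Z" by (auto simp: ind_def)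
      then show ?thesis using card_Un_le by metis
    qed
    have TW: "ind T Z = ind T (Z \<inter> W)" using W by (auto simp: ind_def)
    have split: "card (Z \<inter> W) + card (Z \<inter> Y) \<le> card Z"
    proof -
      have "card (Z \<inter> W \<union> Z \<inter> Y) = card (Z \<inter> W) + card (Z \<inter> Y)"
        using Z Y by (intro card_Un_disjoint) auto
      moreover have "card (Z \<inter> W \<union> Z \<inter> Y) \<le> card Z" using Z by (intro card_mono) auto
      ultimately show ?thesis by simp
    qed
    show "card (ind (T \<union> ?F) Z) + 2 \<le> 2 * card Z"
    proof (cases "Z \<inter> W = {}")
      case True
      have "ind T Z = {}" using TW True ind_empty[OF T(1)] by simp
      moreover have "ind ?F Z \<subseteq> ind F (Z \<inter> Y)"
        using FY(1) True by (fastforce simp: ind_def)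
      then have iF: "card (ind ?F Z) \<le> card (ind F (Z \<inter> Y))" using finF by (intro card_mono) auto
      moreover have "card (ind F (Z \<inter> Y)) + 2 \<le> 2 * card Z"
      proof (cases "Z \<inter> Y = {}")
        case True
        have "card Z > 0" using Z by (simp add: card_gt_0_iff)
        then show ?thesis using ind_empty[OF F] True by simp
      next
        case False
        then show ?thesis using B[of "Z \<inter> Y"] split by simp
      qed
      ultimately show ?thesis using le by simp
    next
      case False
      have "card (ind T Z) + 2 \<le> 2 * card (Z \<inter> W)"
        unfolding TW using Z False by (intro sparseD[OF T(2)]) auto
      \<comment> \<open>Counted through the complement: of the \<open>2 * card Y\<close> edges of
        \<open>?F\<close> at least \<open>2 * card (Y - Z)\<close> meet \<open>Y - Z\<close>. The
        \<open>+ 1\<close> in assumption \<open>A\<close> pays for the removed edge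
        \<open>f\<close>.\<close>
      moreover have "card (ind ?F Z) \<le> 2 * card (Z \<inter> Y)"
      proof -
        have "card (ind ?F Z \<union> inc ?F (Y - Z)) = card (ind ?F Z) + card (inc ?F (Y - Z))"
          using finF by (intro card_Un_disjoint) (auto simp: ind_def inc_def)
        moreover have "card (ind ?F Z \<union> inc ?F (Y - Z)) \<le> card ?F"
          using finF by (intro card_mono) (auto simp: ind_def inc_def)
        moreover have "2 * card (Y - Z) \<le> card (inc ?F (Y - Z))"
        proof (cases "Y - Z = {}")
          case True then show ?thesis by (metis card.empty le0 mult_0_right)
        next
          case False
          have "card (inc F (Y - Z)) \<le> card (insert f (inc ?F (Y - Z)))"
            using finF by (intro card_mono) (auto simp: inc_def)
          also have "\<dots> \<le> Suc (card (inc ?F (Y - Z)))" using finF by (intro card_insert_le_m1) auto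
          finally show ?thesis using A[of "Y - Z"] False by simp
        qed
        moreover have "card (Y - Z) + card (Z \<inter> Y) = card Y"
          using Y card_Int_Diff[of Y Z] by (simp add: Int_commute)
        ultimately show ?thesis using cF by simp
      qed
      ultimately show ?thesis using le split by simp
    qed
  qed
  have disj: "T \<inter> F = {}" using FY(2) W(2) Y(2) by blast
  have "card W > 0" using Tc by (cases "card W") auto
  then have "W \<noteq> {}" by auto
  have "\<not> sparse (T \<union> F)"
  proof
    assume "sparse (T \<union> F)"
    then have "card (T \<union> F) + 2 \<le> 2 * card (W \<union> Y)"
      using W Y FY(1) \<open>W \<noteq> {}\<close> by (intro sparse_card) blast+
    moreover have "card (W \<union> Y) = card W + card Y" using W Y by (intro card_Un_disjoint) auto
    moreover have "card (T \<union> F) = card T + card F" using disj finT finF by (intro card_Un_disjoint) auto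
    ultimately show False using Tc Fc by simp
  qed
  then obtain C where C: "C \<subseteq> T \<union> F" "circuit C"
    using dependent_circuit[OF edge_set_Un[OF T(1) F]] by metis
  have "f \<in> C" if f: "f \<in> F" for f
  proof (rule ccontr)
    assume "f \<notin> C"
    then have "C \<subseteq> T \<union> (F - {f})" using C by blast
    then have "sparse C" using sparse_mono[OF sp[OF f]] finT finF by blast
    then show False using C by (simp add: circuit_def)
  qed
  then show ?thesis using that C by blast
qed

definition outer :: "'a set set \<Rightarrow> 'a set \<Rightarrow> 'a set set" where
  "outer E Y = {e \<in> E. e \<inter> Y = {}}"

text \<open>The last clause asks for two attachment vertices outside \<open>Y\<close>. It rules out
  that the edges at \<open>Y\<close> form a circuit by themselves on \<open>Y\<close> and one
  further vertex, disjoint from \<open>outer E Y\<close>.\<close>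

definition ear :: "'a set set \<Rightarrow> 'a set \<Rightarrow> bool" where
  "ear E Y \<longleftrightarrow> edge_set E \<and> finite Y \<and> conn (outer E Y) \<and> \<Union>E \<subseteq> Y \<union> \<Union>(outer E Y) \<and>
     (\<forall>Z. Z \<subseteq> Y \<longrightarrow> Z \<noteq> {} \<longrightarrow> 2 * card Z + 1 \<le> card (inc E Z)) \<and>
     card (inc E Y) = 2 * card Y + 1 \<and>
     (\<forall>Z. Z \<subseteq> Y \<longrightarrow> Z \<noteq> {} \<longrightarrow> card (ind E Z) + 2 \<le> 2 * card Z) \<and>
     (\<forall>x. \<exists>e\<in>inc E Y. \<not> e \<subseteq> insert x Y)"

lemma earD:
  assumes "ear E Y"
  shows "edge_set E" "finite Y" "conn (outer E Y)" "\<Union>E \<subseteq> Y \<union> \<Union>(outer E Y)"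
    "\<And>Z. Z \<subseteq> Y \<Longrightarrow> Z \<noteq> {} \<Longrightarrow> 2 * card Z + 1 \<le> card (inc E Z)"
    "card (inc E Y) = 2 * card Y + 1"
    "\<And>Z. Z \<subseteq> Y \<Longrightarrow> Z \<noteq> {} \<Longrightarrow> card (ind E Z) + 2 \<le> 2 * card Z"
    "\<And>x. \<exists>e\<in>inc E Y. \<not> e \<subseteq> insert x Y"
proof -
  note h = assms[unfolded ear_def]
  show "edge_set E"
    using h[THEN conjunct1] by blast
  show "finite Y"
    using h[THEN conjunct2, THEN conjunct1] by blast
  show "conn (outer E Y)"
    using h[THEN conjunct2, THEN conjunct2, THEN conjunct1] by blast
  show "\<Union>E \<subseteq> Y \<union> \<Union>(outer E Y)"
    using h[THEN conjunct2, THEN conjunct2, THEN conjunct2, THEN conjunct1] by blast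
  show "\<And>Z. Z \<subseteq> Y \<Longrightarrow> Z \<noteq> {} \<Longrightarrow> 2 * card Z + 1 \<le> card (inc E Z)"
    using h[THEN conjunct2, THEN conjunct2, THEN conjunct2, THEN conjunct2, THEN conjunct1] by blast
  show "card (inc E Y) = 2 * card Y + 1"
    using h[THEN conjunct2, THEN conjunct2, THEN conjunct2, THEN conjunct2, THEN conjunct2, THEN conjunct1] by blast
  show "\<And>Z. Z \<subseteq> Y \<Longrightarrow> Z \<noteq> {} \<Longrightarrow> card (ind E Z) + 2 \<le> 2 * card Z"
    using h[THEN conjunct2, THEN conjunct2, THEN conjunct2, THEN conjunct2, THEN conjunct2, THEN conjunct2, THEN conjunct1] by blast
  show "\<And>x. \<exists>e\<in>inc E Y. \<not> e \<subseteq> insert x Y"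
    using h[THEN conjunct2, THEN conjunct2, THEN conjunct2, THEN conjunct2, THEN conjunct2, THEN conjunct2, THEN conjunct2] by (rule spec)
qed

text \<open>\<open>W\<close> is a parameter because the tight base is either all of
  \<open>outer E Y\<close> or, for edge deletions, a single circuit without one edge.\<close>

lemma ear_circuit:
  assumes e: "ear E Y" and T: "T \<subseteq> outer E Y" "sparse T" "finite W" "\<Union>T \<subseteq> W" "W \<inter> Y = {}"
    "card T + 2 = 2 * card W" "\<Union>(inc E Y) \<subseteq> W \<union> Y"
  obtains C where "circuit C" "inc E Y \<subseteq> C" "C \<subseteq> T \<union> inc E Y"
proof -
  have E: "edge_set E" using e by (simp add: ear_def)
  have eT: "edge_set T" using edge_set_subset[OF E] T(1) by (auto simp: outer_def)
  have eF: "edge_set (inc E Y)" using edge_set_subset[OF E] by (auto simp: inc_def)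
  have 1: "inc (inc E Y) Z = inc E Z" if "Z \<subseteq> Y" for Z using that by (auto simp: inc_def)
  have 2: "ind (inc E Y) Z = ind E Z" if "Z \<subseteq> Y" for Z
    using that edge_set_nonempty[OF E] by (fastforce simp: inc_def ind_def)
  show ?thesis
  proof (rule tight_extension[OF eT T(2-4,6) eF earD(2)[OF e]])
    show "Y \<inter> W = {}" using T by blast
    show "f \<subseteq> W \<union> Y" if "f \<in> inc E Y" for f using T(7) that by blast
    show "f \<inter> Y \<noteq> {}" if "f \<in> inc E Y" for f using that by (simp add: inc_def)
    show "2 * card Z + 1 \<le> card (inc (inc E Y) Z)" if "Z \<subseteq> Y" "Z \<noteq> {}" for Z
      using earD(5)[OF e that] 1 that by simp
    show "card (ind (inc E Y) Z) + 2 \<le> 2 * card Z" if "Z \<subseteq> Y" "Z \<noteq> {}" for Z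
      using earD(7)[OF e that] 2 that by simp
    show "card (inc E Y) = 2 * card Y + 1" using earD(6)[OF e] .
  qed (rule that)
qed

lemma ear_Union: assumes "ear E Y" shows "\<Union>E = Y \<union> \<Union>(outer E Y)"
proof -
  have "y \<in> \<Union>E" if "y \<in> Y" for y
  proof -
    have "card (inc E {y}) > 0" using earD(5)[OF assms, of "{y}"] that by simp
    then have "inc E {y} \<noteq> {}" by auto
    then show ?thesis by (auto simp: inc_def)
  qed
  then show ?thesis using earD(4)[OF assms] by (auto simp: outer_def)
qed

lemma ear_conn: assumes e: "ear E Y" shows "conn E"
proof -
  have D: "conn (outer E Y)" and E: "edge_set E" using earD[OF e] by auto
  obtain T where T: "T \<subseteq> outer E Y" "sparse T" "card T + 2 = 2 * card (\<Union>(outer E Y))"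
    using conn_spanning_tight[OF D] .
  obtain C where C: "circuit C" "inc E Y \<subseteq> C" "C \<subseteq> T \<union> inc E Y"
  proof (rule ear_circuit[OF e T(1,2)])
    show "finite (\<Union>(outer E Y))" using edge_set_finite_Union conn_edge_set[OF D] by blast
    show "\<Union>T \<subseteq> \<Union>(outer E Y)" using T by blast
    show "\<Union>(outer E Y) \<inter> Y = {}" by (auto simp: outer_def)
    show "card T + 2 = 2 * card (\<Union>(outer E Y))" using T by simp
    show "\<Union>(inc E Y) \<subseteq> \<Union>(outer E Y) \<union> Y" using earD(4)[OF e] by (auto simp: inc_def)
  qed
  \<comment> \<open>Otherwise \<open>C\<close> is \<open>inc E Y\<close> with
    \<open>2 * card Y + 1\<close> edges, hence with \<open>card Y + 1\<close> vertices, so there is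
    just one attachment vertex.\<close>
  have "C \<inter> outer E Y \<noteq> {}"
  proof
    assume "C \<inter> outer E Y = {}"
    then have "C \<subseteq> inc E Y" using C(3) T(1) by blast
    then have CY: "C = inc E Y" using C(2) by (rule subset_antisym)
    have Y: "Y \<subseteq> \<Union>(inc E Y)" using ear_Union[OF e] by (auto simp: inc_def outer_def)
    have fin: "finite (\<Union>(inc E Y))" using circuit_edge_set[OF C(1)] edge_set_finite_Union CY by blast
    have "card (inc E Y) + 1 = 2 * card (\<Union>(inc E Y))" using circuit_card[OF C(1)] CY by simp
    moreover have "card (inc E Y) = 2 * card Y + 1" using earD(6)[OF e] .
    ultimately have "card (\<Union>(inc E Y)) = card Y + 1" by simp
    then have "card (\<Union>(inc E Y) - Y) = 1"
      using card_Diff_subset[OF finite_subset[OF Y fin] Y] by simp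
    then obtain x where x: "\<Union>(inc E Y) - Y = {x}" by (rule card_1_singletonE)
    have "\<forall>e\<in>inc E Y. e \<subseteq> insert x Y" using x by blast
    then show False using earD(8)[OF e, of x] by blast
  qed
  then have "conn (outer E Y \<union> C)" using conn_Un_circuit[OF D C(1)] by blast
  moreover have "outer E Y \<union> C = E" using C T by (auto simp: outer_def inc_def)
  ultimately show ?thesis by simp
qed

text \<open>A spanning tight subset of \<open>D\<close> has no room for a further edge, so
  \<open>{a, b}\<close> closes a circuit with it; a circuit has at least three edges and therefore
  meets \<open>D\<close>.\<close>

lemma conn_insert_edge:
  assumes D: "conn D" and ab: "a \<in> \<Union>D" "b \<in> \<Union>D" "a \<noteq> b" "{a, b} \<notin> D"
  shows "conn (insert {a, b} D)"
    and "\<exists>C. circuit C \<and> C \<subseteq> insert {a, b} D \<and> {a, b} \<in> C \<and> C \<inter> D \<noteq> {}"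
proof -
  obtain T where T: "T \<subseteq> D" "sparse T" "card T + 2 = 2 * card (\<Union>D)"
    using conn_spanning_tight[OF D] .
  have eD: "edge_set D" using conn_edge_set[OF D] .
  have eT: "edge_set (insert {a, b} T)"
    using edge_set_insert[OF edge_set_subset[OF eD T(1)] ab(3)] .
  have "\<not> sparse (insert {a, b} T)"
  proof
    assume "sparse (insert {a, b} T)"
    then have "card (insert {a, b} T) + 2 \<le> 2 * card (\<Union>D)"
      using edge_set_finite_Union[OF eD] ab T by (intro sparse_card) auto
    moreover have "card (insert {a, b} T) = card T + 1" using eT ab T by (subst card_insert_disjoint) (auto simp: edge_set_def)
    ultimately show False using T by simp
  qed
  then obtain C where C: "C \<subseteq> insert {a, b} T" "circuit C" "{a, b} \<in> C"
    using insert_dependent_circuit[OF eT] T(2) by metis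
  have "C \<noteq> {{a, b}}" using circuit_card_ge[OF C(2)] by auto
  then have ne: "C \<inter> D \<noteq> {}" using C T by blast
  show "conn (insert {a, b} D)"
  proof -
    have "D \<union> C = insert {a, b} D" using C T by blast
    then show ?thesis using conn_Un_circuit[OF D C(2) ne] by simp
  qed
  show "\<exists>C. circuit C \<and> C \<subseteq> insert {a, b} D \<and> {a, b} \<in> C \<and> C \<inter> D \<noteq> {}"
    using C T ne by blast
qed

text \<open>The edges at \<open>Y\<close> take over the role of \<open>ab\<close> in
  \<open>K\<close>. Without \<open>ab\<close>, \<open>K\<close> is tight on its vertices, so it
  carries a circuit \<open>C\<close> through all edges at \<open>Y\<close>, and \<open>C\<close>
  contains the rest of \<open>K\<close>. Every remaining edge is then linked to
  \<open>C\<close>.\<close>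

lemma ear_delete_edge:
  assumes e: "ear E Y" and K: "circuit K" "K \<subseteq> outer E Y" "{a, b} \<in> K"
    and att: "\<Union>(inc E Y) \<subseteq> \<Union>K \<union> Y" and ab: "a \<in> \<Union>(inc E Y)" "b \<in> \<Union>(inc E Y)"
  shows "conn (E - {{a, b}})"
proof -
  have D: "conn (outer E Y)" and E: "edge_set E" and finY: "finite Y" using earD[OF e] by auto
  have eK: "edge_set K" using circuit_edge_set[OF K(1)] .
  have finK: "finite K" "finite (\<Union>K)" using edge_set_finite[OF eK] edge_set_finite_Union[OF eK] by auto
  have KY: "\<Union>K \<inter> Y = {}" using K(2) by (auto simp: outer_def)
  have cK: "card K = Suc (card (K - {{a, b}}))" using card_Suc_Diff1[OF finK(1) K(3)] by simp
  obtain C where C: "circuit C" "inc E Y \<subseteq> C" "C \<subseteq> (K - {{a, b}}) \<union> inc E Y"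
  proof (rule ear_circuit[OF e, of "K - {{a, b}}" "\<Union>K"])
    show "K - {{a, b}} \<subseteq> outer E Y" using K by blast
    show "sparse (K - {{a, b}})" using K by (simp add: circuit_def)
    show "card (K - {{a, b}}) + 2 = 2 * card (\<Union>K)" using circuit_card[OF K(1)] cK by simp
  qed (use att KY finK in auto)
  have abK: "a \<in> \<Union>K" "b \<in> \<Union>K" using K(3) by auto
  have incK: "inc E Y \<inter> K = {}" using K(2) by (auto simp: inc_def outer_def)
  \<comment> \<open>The part of \<open>C\<close> outside \<open>Y\<close> is tight on a set containing \<open>a\<close> and \<open>b\<close>, so together with \<open>ab\<close>
    it is dependent; being contained in the circuit \<open>K\<close> it must be all of \<open>K\<close>.\<close>
  have KC: "K - {{a, b}} \<subseteq> C"
  proof -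
    let ?T = "C \<inter> (K - {{a, b}})"
    let ?U = "\<Union>C - Y"
    have finC: "finite C" "finite (\<Union>C)"
      using edge_set_finite[OF circuit_edge_set[OF C(1)]] edge_set_finite_Union[OF circuit_edge_set[OF C(1)]] by auto
    have YC: "Y \<subseteq> \<Union>C" using ear_Union[OF e] C(2) by (fastforce simp: inc_def outer_def)
    have "C = ?T \<union> inc E Y" using C by blast
    then have "card C = card (?T \<union> inc E Y)" by metis
    also have "\<dots> = card ?T + card (inc E Y)"
      using finC incK E by (intro card_Un_disjoint) (auto simp: edge_set_def)
    finally have "card C = card ?T + 2 * card Y + 1" using earD(6)[OF e] by simp
    moreover have "card (\<Union>C) = card ?U + card Y"
      using card_Diff_subset[OF finY YC] card_mono[OF finC(2) YC] by simp
    ultimately have cT: "card ?T + 2 = 2 * card ?U" using circuit_card[OF C(1)] by simp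
    have abU: "a \<in> ?U" "b \<in> ?U" using ab abK KY C(2) by blast+
    have "\<not> sparse (insert {a, b} ?T)"
    proof
      assume "sparse (insert {a, b} ?T)"
      then have "card (insert {a, b} ?T) + 2 \<le> 2 * card ?U"
        using finC abU KY by (intro sparse_card) auto
      moreover have "card (insert {a, b} ?T) = Suc (card ?T)" using finC by (subst card_insert_disjoint) auto
      ultimately show False using cT by simp
    qed
    moreover have "insert {a, b} ?T \<subseteq> K" using K by blast
    ultimately have "insert {a, b} ?T = K" using circuit_proper_sparse[OF K(1)] by blast
    then show ?thesis by blast
  qed
  have "card (inc E Y) > 0" using earD(6)[OF e] by simp
  then have "inc E Y \<noteq> {}" by auto
  then obtain h where h: "h \<in> inc E Y" by blast
  have Csub: "C \<subseteq> E - {{a, b}}" using C K incK by (auto simp: inc_def outer_def)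
  show ?thesis
  proof (rule conn_via[of _ h])
    show "edge_set (E - {{a, b}})" using edge_set_subset[OF E] by blast
    show "h \<in> E - {{a, b}}" using h C(2) Csub by blast
    fix f assume f: "f \<in> E - {{a, b}}"
    show "\<exists>C. circuit C \<and> C \<subseteq> E - {{a, b}} \<and> f \<in> C \<and> h \<in> C"
    proof (cases "f \<in> C")
      case True then show ?thesis using C Csub h by blast
    next
      case False
      then have fD: "f \<in> outer E Y" using f C(2) by (auto simp: inc_def outer_def)
      \<comment> \<open>A circuit through \<open>f\<close> and \<open>ab\<close> is freed of
        \<open>ab\<close> by elimination against \<open>K\<close>. The result cannot stay inside
        \<open>K'\<close>, so it meets \<open>K - {{a, b}}\<close> and thereby
        \<open>C\<close>.\<close>
      then obtain K' where K': "circuit K'" "K' \<subseteq> outer E Y" "{a, b} \<in> K'" "f \<in> K'"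
        using connD[OF D, of f "{a, b}"] K f by blast
      have "f \<notin> K" using False KC f by blast
      then obtain K3 where K3: "circuit K3" "f \<in> K3" "K3 \<subseteq> K' \<union> K - {{a, b}}"
        using strong_circuit_elimination[OF K'(1) K(1) K'(3) K(3) K'(4)] by metis
      have "\<not> K3 \<subseteq> K'" using circuit_subset_eq[OF K'(1) K3(1)] K3 K' by blast
      then have "K3 \<inter> C \<noteq> {}" using K3 KC by blast
      moreover have "K3 \<subseteq> E - {{a, b}}" using K3 K K' by (auto simp: outer_def)
      ultimately show ?thesis using circuit_trans[OF K3(1) C(1) _ Csub _ K3(2)] h C(2) by blast
    qed
  qed
qed

section \<open>The last ear\<close>

text \<open>The lower bounds and the sparsity inside \<open>Y\<close> hold because \<open>K\<close>
  is a circuit; the upper bound on the number of new edges holds because a circuit with fewer new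
  edges would be a smaller ear.\<close>

lemma last_ear:
  assumes D: "conn D" and K: "circuit K" "K \<inter> D \<noteq> {}" "K - D \<noteq> {}"
    and min: "\<And>K'. circuit K' \<Longrightarrow> K' \<subseteq> D \<union> K \<Longrightarrow> K' \<inter> D \<noteq> {} \<Longrightarrow> K' - D \<noteq> {} \<Longrightarrow>
                \<not> K' - D \<subset> K - D"
    and Y: "Y = \<Union>K - \<Union>D"
  shows "Y = {} \<Longrightarrow> \<exists>e. e \<notin> D \<and> D \<union> K = insert e D"
    and "Y \<noteq> {} \<Longrightarrow> ear (D \<union> K) Y"
    and "Y \<noteq> {} \<Longrightarrow> outer (D \<union> K) Y = D"
proof -
  have eD: "edge_set D" and eK: "edge_set K" using conn_edge_set[OF D] circuit_edge_set[OF K(1)] .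
  have E: "edge_set (D \<union> K)" using edge_set_Un[OF eD eK] .
  have fin: "finite D" "finite K" "finite (\<Union>D)" "finite (\<Union>K)"
    using eD eK edge_set_finite_Union[OF eD] edge_set_finite_Union[OF eK] by (simp_all add: edge_set_def)
  have finY: "finite Y" using fin Y by simp
  \<comment> \<open>An edge with both ends in \<open>\<Union>D\<close> closes a circuit with
    \<open>D\<close> in which it is the only new edge; minimality then leaves no other new edge in
    \<open>K\<close>.\<close>
  have single: "K - D = {e}" if e: "e \<in> K - D" "e \<subseteq> \<Union>D" for e
  proof -
    obtain a b where ab: "e = {a, b}" "a \<noteq> b" using edge_set_edgeE[OF eK] e by blast
    then obtain C where C: "circuit C" "C \<subseteq> insert e D" "e \<in> C" "C \<inter> D \<noteq> {}"
      using conn_insert_edge(2)[OF D, of a b] e by auto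
    then have "C - D = {e}" using e by blast
    then show ?thesis using min[of C] C e by blast
  qed
  {
    assume "Y = {}"
    then have "\<Union>K \<subseteq> \<Union>D" using Y by blast
    moreover obtain e where e: "e \<in> K - D" using K by blast
    ultimately have "K - D = {e}" using single by blast
    then show "\<exists>e. e \<notin> D \<and> D \<union> K = insert e D" by blast
  }
  assume ne: "Y \<noteq> {}"
  obtain y where y: "y \<in> Y" using ne by blast
  have touch: "e \<inter> Y \<noteq> {}" if e: "e \<in> K - D" for e
  proof
    assume "e \<inter> Y = {}"
    then have s: "K - D = {e}" using single[OF e] e Y by blast
    obtain f where f: "f \<in> K" "y \<in> f" using y Y by blast
    then have "f \<notin> D" using y Y by blast
    then show False using s f y \<open>e \<inter> Y = {}\<close> by blast
  qed
  have inY: "inc (D \<union> K) Y = K - D" using touch Y by (auto simp: inc_def)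
  show outD: "outer (D \<union> K) Y = D" using touch Y by (auto simp: outer_def)
  have incZ: "inc (D \<union> K) Z = inc K Z" "ind (D \<union> K) Z = ind K Z" if "Z \<subseteq> Y" for Z
    using that Y edge_set_nonempty[OF eD] by (fastforce simp: inc_def ind_def)+
  \<comment> \<open>Origin of the bound: \<open>K\<close> has
    \<open>2 * card (\<Union>K) - 1\<close> edges, and those avoiding \<open>Z\<close> form a sparse
    set on \<open>card (\<Union>K) - card Z\<close> vertices.\<close>
  have A: "2 * card Z + 1 \<le> card (inc (D \<union> K) Z)" if Z: "Z \<subseteq> Y" "Z \<noteq> {}" for Z
  proof -
    let ?K = "K - inc K Z"
    have ZK: "Z \<subseteq> \<Union>K" using Z Y by blast
    obtain h where h: "h \<in> K" "h \<in> D" using K by blast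
    have "h \<inter> Y = {}" using h Y by blast
    then have hK: "h \<in> ?K" using h Z by (auto simp: inc_def)
    obtain z where z: "z \<in> Z" using Z by blast
    then obtain g where "g \<in> K" "z \<in> g" using ZK by blast
    then have "?K \<subset> K" using z by (auto simp: inc_def)
    then have s: "sparse ?K" using circuit_proper_sparse[OF K(1)] by blast
    have "card h = 2" using eD h by (simp add: edge_set_def)
    then have "h \<noteq> {}" by auto
    then have "card ?K + 2 \<le> 2 * card (\<Union>K - Z)"
      using hK fin h \<open>h \<inter> Y = {}\<close> Z by (intro sparse_card[OF s]) (auto simp: inc_def)
    moreover have "card ?K = card K - card (inc K Z)"
      using fin by (intro card_Diff_subset) (auto simp: inc_def)
    moreover have "card (inc K Z) \<le> card K" using fin by (intro card_mono) (auto simp: inc_def)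
    moreover have "card (\<Union>K - Z) = card (\<Union>K) - card Z" "card Z \<le> card (\<Union>K)"
      using ZK fin by (auto intro: card_Diff_subset finite_subset card_mono)
    ultimately show ?thesis using circuit_card[OF K(1)] incZ[OF Z(1)] by simp
  qed
  have B: "card (ind (D \<union> K) Z) + 2 \<le> 2 * card Z" if Z: "Z \<subseteq> Y" "Z \<noteq> {}" for Z
  proof -
    obtain h where h: "h \<in> K" "h \<in> D" using K by blast
    have "h \<inter> Y = {}" "h \<noteq> {}" using h Y eD by (auto simp: edge_set_def)
    then have "h \<notin> ind K Z" using Z by (auto simp: ind_def)
    then have "sparse (ind K Z)" using circuit_proper_sparse[OF K(1)] h ind_subset by blast
    then have "card (ind K Z) + 2 \<le> 2 * card Z"
      using Z finY by (intro sparse_card) (auto simp: ind_def intro: finite_subset)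
    then show ?thesis using incZ[OF Z(1)] by simp
  qed
  have Cc: "\<exists>e\<in>inc (D \<union> K) Y. \<not> e \<subseteq> insert x Y" for x
  proof (rule ccontr)
    assume "\<not> ?thesis"
    then have sub: "\<Union>(K - D) \<subseteq> insert x Y" using inY by blast
    have "sparse (K - D)" using circuit_proper_sparse[OF K(1)] K by blast
    then have "card (K - D) + 2 \<le> 2 * card (insert x Y)" using finY sub by (intro sparse_card) auto
    moreover have "2 * card Y + 1 \<le> card (K - D)" using A[OF _ ne] inY by simp
    moreover have "card (insert x Y) \<le> Suc (card Y)" using finY by (intro card_insert_le_m1) auto
    ultimately show False by simp
  qed
  \<comment> \<open>With more new edges, one could be dropped and the others would still be
    dependent over a spanning tight subset of \<open>D\<close>; the resulting circuit contradicts
    minimality.\<close>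
  have up: "card (K - D) \<le> 2 * card Y + 1"
  proof (rule ccontr)
    assume big: "\<not> ?thesis"
    obtain T where T: "T \<subseteq> D" "sparse T" "card T + 2 = 2 * card (\<Union>D)"
      using conn_spanning_tight[OF D] .
    obtain f where f: "f \<in> K - D" using K by blast
    let ?F = "K - D - {f}"
    have "T \<union> ?F \<subseteq> D \<union> K" using T(1) by blast
    then have "edge_set (T \<union> ?F)" by (rule edge_set_subset[OF E])
    moreover have "\<not> sparse (T \<union> ?F)"
    proof
      assume s: "sparse (T \<union> ?F)"
      have "card (T \<union> ?F) + 2 \<le> 2 * card (\<Union>D \<union> Y)"
        using fin finY T Y ne by (intro sparse_card[OF s]) auto
      moreover have "card (\<Union>D \<union> Y) = card (\<Union>D) + card Y"
        using fin finY Y by (intro card_Un_disjoint) auto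
      moreover have "card (T \<union> ?F) = card T + card ?F"
        using fin T by (intro card_Un_disjoint) (auto intro: finite_subset)
      moreover have "Suc (card ?F) = card (K - D)" using f fin by (intro card_Suc_Diff1) auto
      ultimately show False using T big by simp
    qed
    ultimately obtain C where C: "C \<subseteq> T \<union> ?F" "circuit C" by (rule dependent_circuit)
    have "C \<inter> D \<noteq> {}"
    proof
      assume "C \<inter> D = {}"
      then have "C \<subset> K" using C T f by blast
      then show False using circuit_proper_sparse[OF K(1)] C by (auto simp: circuit_def)
    qed
    moreover have "C - D \<noteq> {}"
    proof
      assume "C - D = {}"
      then have "C \<subseteq> T" using C by blast
      then show False using sparse_mono[OF T(2)] C finite_subset[OF T(1) fin(1)] by (auto simp: circuit_def)
    qed
    moreover have "C - D \<subset> K - D" using C T f by blast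
    moreover have "C \<subseteq> D \<union> K" using C T by blast
    ultimately show False using min[of C] C by blast
  qed
  have "card (inc (D \<union> K) Y) = 2 * card Y + 1" using up A[OF _ ne] inY by simp
  then show "ear (D \<union> K) Y"
    unfolding ear_def outD
  proof (intro conjI allI impI)
    show "\<Union>(D \<union> K) \<subseteq> Y \<union> \<Union>D" using Y by blast
  qed (use E finY D A B Cc in simp_all)
qed

section \<open>Reductions\<close>

definition reducible :: "'a set set \<Rightarrow> bool" where
  "reducible E \<longleftrightarrow> (\<exists>G'. edge_reduction (\<Union>E, E) G' \<and> M22_connected G') \<or>
     (\<exists>G'. edge_deletion (\<Union>E, E) G' \<and> M22_connected G') \<or>
     (\<exists>G'. K4_minus_reduction (\<Union>E, E) G' \<and> M22_connected G')"

definition nb :: "'a set set \<Rightarrow> 'a \<Rightarrow> 'a set" where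
  "nb E v = {w. {v, w} \<in> E}"

lemma inc_singleton_nb:
  assumes "edge_set E" shows "inc E {v} = (\<lambda>w. {v, w}) ` nb E v"
proof
  show "inc E {v} \<subseteq> (\<lambda>w. {v, w}) ` nb E v"
  proof
    fix e assume e: "e \<in> inc E {v}"
    then obtain w where "e = {v, w}" using edge_set_edgeE'[OF assms, of e v] by (auto simp: inc_def)
    then show "e \<in> (\<lambda>w. {v, w}) ` nb E v" using e by (auto simp: inc_def nb_def)
  qed
qed (auto simp: inc_def nb_def)

lemma card_inc_singleton:
  assumes "edge_set E" shows "card (inc E {v}) = card (nb E v)"
  unfolding inc_singleton_nb[OF assms]
  by (rule card_image) (auto simp: inj_on_def doubleton_eq_iff)

lemma nb_irrefl: "edge_set E \<Longrightarrow> v \<notin> nb E v"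
  by (auto simp: nb_def edge_set_def)

lemma nb_sym: "w \<in> nb E v \<longleftrightarrow> v \<in> nb E w"
  by (simp add: nb_def insert_commute)

lemma finite_nb: assumes "edge_set E" shows "finite (nb E v)"
  by (rule finite_subset[OF _ edge_set_finite_Union[OF assms]]) (auto simp: nb_def)

text \<open>Supplies the nonempty second neighbour class that a vertex split demands. Inside
  \<open>Y\<close> the degree is at least three; outside, an edge of \<open>outer E Y\<close> avoids
  \<open>w\<close>.\<close>

lemma ear_other_nbr:
  assumes e: "ear E Y" and p: "p \<in> \<Union>E" and w: "w \<in> Y"
  obtains q where "q \<noteq> w" "{p, q} \<in> E"
proof (cases "p \<in> Y")
  case True
  have "card (nb E p) \<ge> 3" using earD(5)[OF e, of "{p}"] True card_inc_singleton[OF earD(1)[OF e], of p] by simp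
  then have "\<not> nb E p \<subseteq> {w}" using card_mono[of "{w}" "nb E p"] by auto
  then show ?thesis using that by (auto simp: nb_def)
next
  case False
  then obtain f where f: "f \<in> outer E Y" "p \<in> f" using p ear_Union[OF e] by blast
  then have fE: "f \<in> E" by (simp add: outer_def)
  obtain q where "f = {p, q}" using edge_set_edgeE'[OF earD(1)[OF e] fE f(2)] by metis
  then show ?thesis using that[of q] f fE w by (auto simp: outer_def)
qed

text \<open>Read as a split of \<open>a\<close> in the smaller graph: \<open>N1 = {b}\<close>, the
  first new vertex is \<open>v\<close>, the second reuses the name \<open>a\<close>, and the extra
  edge goes to \<open>x = c\<close>.\<close>

lemma edge_reduction_node:
  assumes E: "edge_set E" and v: "nb E v = {a, b, c}" and d: "a \<noteq> b" "a \<noteq> c" "b \<noteq> c"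
    and ab: "{a, b} \<notin> E" and q: "q \<noteq> v" "{a, q} \<in> E"
  shows "edge_reduction (\<Union>E, E) (\<Union>E - {v}, insert {a, b} (E - inc E {v}))"
proof -
  let ?E = "insert {a, b} (E - inc E {v})"
  have va: "v \<noteq> a" "v \<noteq> b" "v \<noteq> c" using nb_irrefl[OF E, of v] v by auto
  have edges: "{v, a} \<in> E" "{v, b} \<in> E" "{v, c} \<in> E" using v by (auto simp: nb_def)
  have iv: "inc E {v} = {{v, a}, {v, b}, {v, c}}" using inc_singleton_nb[OF E, of v] v by auto
  have sg: "simple_graph (\<Union>E - {v}, ?E)"
    unfolding simple_graph_def
  proof (intro conjI ballI)
    show "finite (verts (\<Union>E - {v}, ?E))" using edge_set_finite_Union[OF E] by simp
    fix e assume "e \<in> edges (\<Union>E - {v}, ?E)"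
    then have "e = {a, b} \<or> (e \<in> E \<and> v \<notin> e)" by (auto simp: inc_def)
    then show "e \<subseteq> verts (\<Union>E - {v}, ?E)" "card e = 2"
      using edges va d E by (auto simp: edge_set_def)
  qed
  let ?G' = "(\<Union>E - {v}, ?E)"
  let ?N2 = "neighbours ?G' a - {b}"
  have Ea: "{e \<in> ?E. a \<notin> e} = {e \<in> E. a \<notin> e \<and> v \<notin> e}" by (auto simp: inc_def)
  have qb: "q \<in> ?N2" using q ab va by (auto simp: neighbours_def inc_def)
  have "w \<in> ?N2 \<longleftrightarrow> w \<noteq> v \<and> {a, w} \<in> E" for w
    using ab va by (auto simp: neighbours_def inc_def doubleton_eq_iff)
  then have N2: "{{a, w} |w. w \<in> ?N2} = {e \<in> E. a \<in> e \<and> v \<notin> e}"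
  proof -
    assume r: "\<And>w. w \<in> ?N2 \<longleftrightarrow> w \<noteq> v \<and> {a, w} \<in> E"
    show ?thesis
    proof
      show "{{a, w} |w. w \<in> ?N2} \<subseteq> {e \<in> E. a \<in> e \<and> v \<notin> e}" using r va by auto
      show "{e \<in> E. a \<in> e \<and> v \<notin> e} \<subseteq> {{a, w} |w. w \<in> ?N2}"
      proof
        fix e assume e: "e \<in> {e \<in> E. a \<in> e \<and> v \<notin> e}"
        then obtain w where w: "e = {a, w}" using edge_set_edgeE'[OF E, of e a] by auto
        then have "w \<in> ?N2" using r e by auto
        then show "e \<in> {{a, w} |w. w \<in> ?N2}" using w by blast
      qed
    qed
  qed
  have ed: "E = {e \<in> E. a \<notin> e \<and> v \<notin> e} \<union> {{v, b}} \<union> {e \<in> E. a \<in> e \<and> v \<notin> e} \<union> {{v, a}, {v, c}}"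
  proof -
    have "E = {e \<in> E. v \<notin> e} \<union> inc E {v}" by (auto simp: inc_def)
    also have "{e \<in> E. v \<notin> e} = {e \<in> E. a \<notin> e \<and> v \<notin> e} \<union> {e \<in> E. a \<in> e \<and> v \<notin> e}" by blast
    finally show ?thesis unfolding iv by blast
  qed
  have N1: "{{v, w} |w. w \<in> {b}} = {{v, b}}" by auto
  have E4: "edges (\<Union>E, E) = {e \<in> edges ?G'. a \<notin> e} \<union> {{v, w} |w. w \<in> {b}} \<union> {{a, w} |w. w \<in> ?N2}
      \<union> {{v, a}, {v, c}}"
    unfolding N2 N1 using ed Ea by simp
  have bN: "b \<in> neighbours ?G' a" by (simp add: neighbours_def)
  have aV: "a \<in> \<Union>E - {v}" "c \<in> \<Union>E - {v}" "v \<in> \<Union>E" using edges va by auto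
  show ?thesis
    unfolding edge_reduction_def generalised_vertex_split_def
    apply (rule conjI[OF sg])
    apply (rule exI[of _ a], rule exI[of _ "{b}"], rule exI[of _ ?N2], rule exI[of _ v], rule exI[of _ a], rule exI[of _ c])
    using E4 bN aV va d qb by auto
qed

text \<open>The net loss is two edges for one vertex, so the incidence count survives for sets
  meeting \<open>{a, b}\<close>. \<open>h1\<close> covers the sets that meet only \<open>c\<close>
  and lose \<open>vc\<close>, \<open>h2\<close> those in which \<open>ab\<close> is one induced edge
  too many, \<open>h3\<close> the two attachment vertices. Since \<open>a \<in> Y\<close>, the new
  edge does not change \<open>outer\<close>.\<close>

lemma ear_node_reduction:
  assumes e: "ear E Y" and v: "v \<in> Y" "nb E v = {a, b, c}" and d: "a \<noteq> b" "a \<noteq> c" "b \<noteq> c"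
    and ab: "{a, b} \<notin> E" and aY: "a \<in> Y"
    and h1: "\<And>S. S \<subseteq> Y \<Longrightarrow> v \<in> S \<Longrightarrow> c \<in> S \<Longrightarrow> a \<notin> S \<Longrightarrow> b \<notin> S \<Longrightarrow> card (inc E S) \<noteq> 2 * card S + 1"
    and h2: "\<And>Z. Z \<subseteq> Y \<Longrightarrow> a \<in> Z \<Longrightarrow> b \<in> Z \<Longrightarrow> v \<notin> Z \<Longrightarrow> \<not> tight E Z"
    and h3: "\<And>x. \<exists>f\<in>inc (insert {a, b} (E - inc E {v})) (Y - {v}). \<not> f \<subseteq> insert x (Y - {v})"
  shows "reducible E"
proof -
  have E: "edge_set E" and finY: "finite Y" using earD[OF e] by auto
  have finE: "finite E" using E by (simp add: edge_set_def)
  let ?R = "E - inc E {v}" and ?Y = "Y - {v}"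
  let ?E = "insert {a, b} ?R"
  have va: "v \<noteq> a" "v \<noteq> b" "v \<noteq> c" using nb_irrefl[OF E, of v] v by auto
  have edges: "{v, a} \<in> E" "{v, b} \<in> E" "{v, c} \<in> E" using v by (auto simp: nb_def)
  have iv: "inc E {v} = {{v, a}, {v, b}, {v, c}}" using inc_singleton_nb[OF E, of v] v by auto
  have c3: "card (inc E {v}) = 3" unfolding card_inc_singleton[OF E] using v d by simp
  have E0: "card (inc E (insert v Z)) = card (inc ?R Z) + 3" if "v \<notin> Z" for Z
  proof -
    have "inc E (insert v Z) = inc ?R Z \<union> inc E {v}" by (auto simp: inc_def)
    moreover have "card (inc ?R Z \<union> inc E {v}) = card (inc ?R Z) + card (inc E {v})"
      using finE by (intro card_Un_disjoint) (auto simp: inc_def)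
    ultimately show ?thesis using c3 by simp
  qed
  have tch: "card (inc ?E Z) = Suc (card (inc ?R Z))" if "{a, b} \<inter> Z \<noteq> {}" for Z
  proof -
    have "inc ?E Z = insert {a, b} (inc ?R Z)" using that unfolding inc_def by blast
    moreover have "{a, b} \<notin> inc ?R Z" using ab by (simp add: inc_def)
    ultimately show ?thesis using finE by simp
  qed
  have inY: "card (insert v Z) = Suc (card Z)" if "Z \<subseteq> ?Y" for Z
    using that finY by (subst card_insert_disjoint) (auto intro: finite_subset)
  have out: "outer ?E ?Y = outer E Y" using aY va v(1) by (auto simp: outer_def inc_def)
  have "ear ?E ?Y"
    unfolding ear_def out
  proof (intro conjI allI impI)
    show "edge_set ?E" using edge_set_insert[OF edge_set_subset[OF E] d(1)] by blast
    show "finite ?Y" using finY by simp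
    show "conn (outer E Y)" using earD[OF e] by simp
    show "\<Union>?E \<subseteq> ?Y \<union> \<Union>(outer E Y)"
    proof -
      have "x \<in> ?Y \<union> \<Union>(outer E Y)" if "x \<in> \<Union>E" "x \<noteq> v" for x
        using ear_Union[OF e] that by blast
      moreover have "a \<in> \<Union>E" "b \<in> \<Union>E" using edges by auto
      ultimately show ?thesis using va by (auto simp: inc_def)
    qed
    show "2 * card Z + 1 \<le> card (inc ?E Z)" if Z: "Z \<subseteq> ?Y" "Z \<noteq> {}" for Z
    proof -
      have vZ: "v \<notin> Z" and ZY: "insert v Z \<subseteq> Y" using Z v by auto
      have A: "2 * card (insert v Z) + 1 \<le> card (inc E (insert v Z))" using earD(5)[OF e ZY] by simp
      show ?thesis
      proof (cases "{a, b} \<inter> Z \<noteq> {}")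
        case True
        then show ?thesis using A E0[OF vZ] tch[OF True] inY[OF Z(1)] by simp
      next
        case False
        then have eq: "inc ?E Z = inc ?R Z" by (auto simp: inc_def)
        show ?thesis
        proof (cases "c \<in> Z")
          case True
          then have "card (inc E (insert v Z)) \<noteq> 2 * card (insert v Z) + 1"
            using h1[OF ZY] False va by auto
          then show ?thesis using A E0[OF vZ] eq inY[OF Z(1)] by simp
        next
          case c: False
          have "f \<inter> Z = {}" if "f \<in> inc E {v}" for f using that False c vZ unfolding iv by auto
          then have "inc ?R Z = inc E Z" by (auto simp: inc_def[of _ Z])
          moreover have "Z \<subseteq> Y" using Z by blast
          ultimately show ?thesis using eq earD(5)[OF e _ Z(2)] by simp
        qed
      qed
    qed
    show "card (inc ?E ?Y) = 2 * card ?Y + 1"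
    proof -
      have "insert v ?Y = Y" using v by blast
      moreover have "{a, b} \<inter> ?Y \<noteq> {}" using aY va by blast
      ultimately show ?thesis using E0[of ?Y] tch[of ?Y] inY[of ?Y] earD(6)[OF e] by simp
    qed
    show "card (ind ?E Z) + 2 \<le> 2 * card Z" if Z: "Z \<subseteq> ?Y" "Z \<noteq> {}" for Z
    proof -
      have B: "card (ind E Z) + 2 \<le> 2 * card Z" using earD(7)[OF e, of Z] Z by blast
      show ?thesis
      proof (cases "a \<in> Z \<and> b \<in> Z")
        case True
        then have "\<not> tight E Z" using h2[of Z] Z by blast
        then have "card (ind E Z) + 3 \<le> 2 * card Z"
          using B Z finY finite_subset[of Z Y] by (auto simp: tight_def)
        moreover have "card (ind ?E Z) \<le> card (insert {a, b} (ind E Z))"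
          using finE by (intro card_mono) (auto simp: ind_def)
        moreover have "\<dots> \<le> Suc (card (ind E Z))" using finE by (intro card_insert_le_m1) auto
        ultimately show ?thesis by simp
      next
        case False
        then have "card (ind ?E Z) \<le> card (ind E Z)" using finE by (intro card_mono) (auto simp: ind_def)
        then show ?thesis using B by simp
      qed
    qed
    show "\<exists>f\<in>inc ?E ?Y. \<not> f \<subseteq> insert x ?Y" for x using h3 by blast
  qed
  then have "conn ?E" "\<Union>?E = ?Y \<union> \<Union>(outer E Y)" using ear_conn ear_Union out by metis+
  moreover have "?Y \<union> \<Union>(outer E Y) = \<Union>E - {v}" using ear_Union[OF e] v by (auto simp: outer_def)
  ultimately have M: "M22_connected (\<Union>E - {v}, ?E)" by (simp add: M22_connected_iff)
  obtain q where "q \<noteq> v" "{a, q} \<in> E" using ear_other_nbr[OF e _ v(1), of a] edges by blast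
  then have "edge_reduction (\<Union>E, E) (\<Union>E - {v}, ?E)" using edge_reduction_node[OF E v(2) d ab] by blast
  then show ?thesis using M by (auto simp: reducible_def)
qed

text \<open>Only \<open>b\<close> and \<open>c\<close> can cease to be attachment vertices when
  \<open>v\<close> is deleted. The edge \<open>ab\<close> with \<open>a \<in> Y\<close> keeps
  \<open>b\<close>; the new form of \<open>h3\<close> keeps \<open>c\<close> or places it in
  \<open>Y\<close>.\<close>

lemma ear_node_reduction':
  assumes e: "ear E Y" and v: "v \<in> Y" "nb E v = {a, b, c}" and d: "a \<noteq> b" "a \<noteq> c" "b \<noteq> c"
    and ab: "{a, b} \<notin> E" and aY: "a \<in> Y"
    and h1: "\<And>S. S \<subseteq> Y \<Longrightarrow> v \<in> S \<Longrightarrow> c \<in> S \<Longrightarrow> a \<notin> S \<Longrightarrow> b \<notin> S \<Longrightarrow> card (inc E S) \<noteq> 2 * card S + 1"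
    and h2: "\<And>Z. Z \<subseteq> Y \<Longrightarrow> a \<in> Z \<Longrightarrow> b \<in> Z \<Longrightarrow> v \<notin> Z \<Longrightarrow> \<not> tight E Z"
    and h3: "c \<in> Y \<or> (\<exists>y\<in>Y - {v}. {y, c} \<in> E)"
  shows "reducible E"
proof (rule ear_node_reduction[OF e v d ab aY h1 h2])
  fix x
  have E: "edge_set E" using earD[OF e] by auto
  have va: "v \<noteq> a" using nb_irrefl[OF E, of v] v by auto
  let ?E = "insert {a, b} (E - inc E {v})" and ?Y = "Y - {v}"
  obtain f where f: "f \<in> inc E Y" "\<not> f \<subseteq> insert x Y" using earD(8)[OF e] by blast
  then obtain y z where yz: "f = {y, z}" "y \<in> Y" "{y, z} \<in> E" "z \<notin> Y" "z \<noteq> x"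
  proof -
    obtain y where y: "y \<in> f" "y \<in> Y" "f \<in> E" using f by (auto simp: inc_def)
    then obtain z where "f = {y, z}" using edge_set_edgeE'[OF E] by metis
    then show ?thesis using that[of y z] y f by auto
  qed
  have vz: "v \<noteq> z" using yz v by blast
  show "\<exists>f\<in>inc ?E ?Y. \<not> f \<subseteq> insert x ?Y"
  proof (cases "y = v")
    case False
    then have "{y, z} \<in> inc ?E ?Y" using yz vz by (auto simp: inc_def)
    then show ?thesis using yz by blast
  next
    case True
    then have "z \<in> {a, b, c}" using yz v by (auto simp: nb_def)
    then consider "z = b" | "z = c" using yz aY by auto
    then show ?thesis
    proof cases
      case 1
      have "{a, b} \<in> inc ?E ?Y" using aY va by (auto simp: inc_def)
      then show ?thesis using 1 yz by blast
    next
      case 2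
      then obtain y' where "y' \<in> ?Y" "{y', c} \<in> E" using h3 yz by blast
      then have "{y', c} \<in> inc ?E ?Y" using 2 vz by (auto simp: inc_def)
      then show ?thesis using 2 yz by blast
    qed
  qed
qed

lemma K4_minus_reduction_nodes:
  assumes E: "edge_set E" and u: "nb E u = {t, a, b}" and t: "nb E t = {u, a, b}"
    and d: "t \<noteq> a" "t \<noteq> b" "u \<noteq> a" "u \<noteq> b" "a \<noteq> b" and ab: "{a, b} \<notin> E"
  shows "K4_minus_reduction (\<Union>E, E) (\<Union>E - {u, t}, insert {a, b} (E - inc E {u, t}))"
proof -
  have edges: "{u, t} \<in> E" using u by (auto simp: nb_def)
  have nbs: "neighbours (\<Union>E, E) x = nb E x" for x by (simp add: neighbours_def nb_def)
  have ut: "u \<noteq> t" using nb_irrefl[OF E, of u] u by auto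
  have deg: "degree (\<Union>E, E) u = 3" "degree (\<Union>E, E) t = 3"
    using u t d by (simp_all add: degree_def nbs)
  have "nb E u \<inter> nb E t = {a, b}" using u t d ut by auto
  moreover have "{e \<in> E. u \<notin> e \<and> t \<notin> e} \<union> {{a, b}} = insert {a, b} (E - inc E {u, t})"
    by (auto simp: inc_def)
  moreover have "u \<in> \<Union>E" "t \<in> \<Union>E" using edges by auto
  ultimately show ?thesis
    unfolding K4_minus_reduction_def using edges deg d ab
    by (intro bexI[of _ u] bexI[of _ t] exI[of _ a] exI[of _ b]) (simp_all add: nbs)
qed

lemma card_inc_diamond:
  assumes E: "edge_set E" and u: "nb E u = {t, a, b}" and t: "nb E t = {u, a, b}"
    and d: "t \<noteq> a" "t \<noteq> b" "u \<noteq> a" "u \<noteq> b" "a \<noteq> b"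
  shows "inc E {u, t} = {{u, t}, {u, a}, {u, b}, {t, a}, {t, b}}" "card (inc E {u, t}) = 5"
proof -
  have ut: "u \<noteq> t" using nb_irrefl[OF E, of u] u by auto
  have "inc E {u, t} = inc E {u} \<union> inc E {t}" by (auto simp: inc_def)
  then show *: "inc E {u, t} = {{u, t}, {u, a}, {u, b}, {t, a}, {t, b}}"
    using inc_singleton_nb[OF E, of u] inc_singleton_nb[OF E, of t] u t by (auto simp: insert_commute)
  have "distinct [{u, t}, {u, a}, {u, b}, {t, a}, {t, b}]" using d ut by (auto simp: doubleton_eq_iff)
  then show "card (inc E {u, t}) = 5" unfolding * using distinct_card by fastforce
qed

text \<open>No blocker can occur. Five edges go and one comes for two vertices, which balances the
  incidence count; and as \<open>u\<close> and \<open>t\<close> would add five edges but only four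
  to the sparsity bound, a set containing \<open>a\<close> and \<open>b\<close> has room for
  \<open>ab\<close>.\<close>

lemma ear_K4_minus_reduction:
  assumes e: "ear E Y" and Y: "u \<in> Y" "t \<in> Y" "a \<in> Y" and u: "nb E u = {t, a, b}" and t: "nb E t = {u, a, b}"
    and d: "t \<noteq> a" "t \<noteq> b" "u \<noteq> a" "u \<noteq> b" "a \<noteq> b" and ab: "{a, b} \<notin> E"
  shows "reducible E"
proof -
  have E: "edge_set E" and finY: "finite Y" using earD[OF e] by auto
  have finE: "finite E" using E by (simp add: edge_set_def)
  let ?R = "E - inc E {u, t}" and ?Y = "Y - {u, t}"
  let ?E = "insert {a, b} ?R"
  have ut: "u \<noteq> t" using nb_irrefl[OF E, of u] u by auto
  note i5 = card_inc_diamond[OF E u t d]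
  have E0: "card (inc E (insert u (insert t Z))) = card (inc ?R Z) + 5" for Z
  proof -
    have "inc E (insert u (insert t Z)) = inc ?R Z \<union> inc E {u, t}" by (auto simp: inc_def)
    moreover have "card (inc ?R Z \<union> inc E {u, t}) = card (inc ?R Z) + card (inc E {u, t})"
      using finE by (intro card_Un_disjoint) (auto simp: inc_def)
    ultimately show ?thesis using i5 by simp
  qed
  have tch: "card (inc ?E Z) = Suc (card (inc ?R Z))" if "{a, b} \<inter> Z \<noteq> {}" for Z
  proof -
    have "inc ?E Z = insert {a, b} (inc ?R Z)" using that unfolding inc_def by blast
    moreover have "{a, b} \<notin> inc ?R Z" using ab by (simp add: inc_def)
    ultimately show ?thesis using finE by simp
  qed
  have inY: "card (insert u (insert t Z)) = card Z + 2" if "Z \<subseteq> ?Y" for Z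
  proof -
    have "finite Z" using that finY by (auto intro: finite_subset)
    moreover have "u \<notin> insert t Z" "t \<notin> Z" using that ut by auto
    ultimately show ?thesis by simp
  qed
  have out: "outer ?E ?Y = outer E Y" using Y d by (auto simp: outer_def inc_def)
  have "ear ?E ?Y"
    unfolding ear_def out
  proof (intro conjI allI impI)
    show "edge_set ?E" using edge_set_insert[OF edge_set_subset[OF E] d(5)] by blast
    show "finite ?Y" using finY by simp
    show "conn (outer E Y)" using earD[OF e] by simp
    show "\<Union>?E \<subseteq> ?Y \<union> \<Union>(outer E Y)"
    proof -
      have "x \<in> ?Y \<union> \<Union>(outer E Y)" if "x \<in> \<Union>E" "x \<noteq> u" "x \<noteq> t" for x
        using ear_Union[OF e] that by blast
      moreover have "{u, a} \<in> E" "{u, b} \<in> E" using u by (auto simp: nb_def)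
      then have "a \<in> \<Union>E" "b \<in> \<Union>E" by auto
      ultimately show ?thesis using d by (auto simp: inc_def)
    qed
    show "2 * card Z + 1 \<le> card (inc ?E Z)" if Z: "Z \<subseteq> ?Y" "Z \<noteq> {}" for Z
    proof (cases "{a, b} \<inter> Z \<noteq> {}")
      case True
      have "insert u (insert t Z) \<subseteq> Y" using Z Y by blast
      then show ?thesis using earD(5)[OF e, of "insert u (insert t Z)"] E0[of Z] tch[OF True] inY[OF Z(1)] by simp
    next
      case False
      then have "inc ?E Z = inc ?R Z" by (auto simp: inc_def)
      moreover have "f \<inter> Z = {}" if "f \<in> inc E {u, t}" for f
        using that False Z unfolding i5(1) by auto
      then have "inc ?R Z = inc E Z" by (auto simp: inc_def[of _ Z])
      moreover have "Z \<subseteq> Y" using Z by blast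
      ultimately show ?thesis using earD(5)[OF e _ Z(2)] by simp
    qed
    show "card (inc ?E ?Y) = 2 * card ?Y + 1"
    proof -
      have "insert u (insert t ?Y) = Y" using Y by blast
      moreover have "{a, b} \<inter> ?Y \<noteq> {}" using Y d by blast
      ultimately show ?thesis using E0[of ?Y] tch[of ?Y] inY[of ?Y] earD(6)[OF e] by simp
    qed
    show "card (ind ?E Z) + 2 \<le> 2 * card Z" if Z: "Z \<subseteq> ?Y" "Z \<noteq> {}" for Z
    proof (cases "a \<in> Z \<and> b \<in> Z")
      case True
      let ?Z = "insert u (insert t Z)"
      have "?Z \<subseteq> Y" using Z Y by blast
      then have "card (ind E ?Z) + 2 \<le> 2 * card Z + 4" using earD(7)[OF e, of ?Z] inY[OF Z(1)] by simp
      moreover have "card (ind E Z \<union> inc E {u, t}) \<le> card (ind E ?Z)"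
        using finE i5(1) True by (intro card_mono) (auto simp: ind_def inc_def)
      moreover have "card (ind E Z \<union> inc E {u, t}) = card (ind E Z) + card (inc E {u, t})"
        using finE Z by (intro card_Un_disjoint) (auto simp: ind_def inc_def)
      moreover have "card (ind ?E Z) \<le> card (insert {a, b} (ind E Z))"
        using finE by (intro card_mono) (auto simp: ind_def)
      moreover have "card (insert {a, b} (ind E Z)) \<le> Suc (card (ind E Z))"
        using finE by (intro card_insert_le_m1) auto
      ultimately show ?thesis using i5(2) by simp
    next
      case False
      then have "card (ind ?E Z) \<le> card (ind E Z)" using finE by (intro card_mono) (auto simp: ind_def)
      moreover have "Z \<subseteq> Y" using Z by blast
      ultimately show ?thesis using earD(7)[OF e _ Z(2)] by fastforce
    qed
    show "\<exists>f\<in>inc ?E ?Y. \<not> f \<subseteq> insert x ?Y" for x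
    proof -
      obtain f where f: "f \<in> inc E Y" "\<not> f \<subseteq> insert x Y" using earD(8)[OF e] by blast
      show ?thesis
      proof (cases "f \<in> inc E {u, t}")
        case False
        then have "f \<in> inc ?E ?Y" using f by (auto simp: inc_def)
        then show ?thesis using f by blast
      next
        case True
        then have "b \<in> f \<and> b \<notin> insert x Y" using f i5(1) Y by auto
        moreover have "{a, b} \<in> inc ?E ?Y" using Y d by (auto simp: inc_def)
        ultimately show ?thesis by blast
      qed
    qed
  qed
  then have "conn ?E" "\<Union>?E = ?Y \<union> \<Union>(outer E Y)" using ear_conn ear_Union out by metis+
  moreover have "?Y \<union> \<Union>(outer E Y) = \<Union>E - {u, t}" using ear_Union[OF e] Y by (auto simp: outer_def)
  ultimately have "M22_connected (\<Union>E - {u, t}, ?E)" by (simp add: M22_connected_iff)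
  then show ?thesis using K4_minus_reduction_nodes[OF E u t d ab] by (auto simp: reducible_def)
qed

text \<open>The edge \<open>wz\<close> is deleted and \<open>wp\<close> is contracted. As a split of
  \<open>p\<close> in the smaller graph: \<open>N1 = {u, t}\<close>, the new vertices are
  \<open>w\<close> and \<open>p\<close>, and the extra edge goes to \<open>x = z\<close>.\<close>

lemma edge_reduction_contract:
  assumes E: "edge_set E" and w: "nb E w = {u, t, z, p}"
    and d: "u \<noteq> t" "u \<noteq> z" "u \<noteq> p" "t \<noteq> z" "t \<noteq> p" "z \<noteq> p"
    and up: "{u, p} \<notin> E" "{t, p} \<notin> E" and q: "q \<noteq> w" "{p, q} \<in> E"
  shows "edge_reduction (\<Union>E, E) (\<Union>E - {w}, {{u, p}, {t, p}} \<union> (E - inc E {w}))"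
proof -
  let ?E = "{{u, p}, {t, p}} \<union> (E - inc E {w})"
  have wn: "w \<noteq> u" "w \<noteq> t" "w \<noteq> z" "w \<noteq> p" using nb_irrefl[OF E, of w] w by auto
  have edges: "{w, u} \<in> E" "{w, t} \<in> E" "{w, z} \<in> E" "{w, p} \<in> E" using w by (auto simp: nb_def)
  have iw: "inc E {w} = {{w, u}, {w, t}, {w, z}, {w, p}}" using inc_singleton_nb[OF E, of w] w by auto
  let ?G' = "(\<Union>E - {w}, ?E)"
  have sg: "simple_graph ?G'"
    unfolding simple_graph_def
  proof (intro conjI ballI)
    show "finite (verts ?G')" using edge_set_finite_Union[OF E] by simp
    fix e assume "e \<in> edges ?G'"
    then have "e = {u, p} \<or> e = {t, p} \<or> (e \<in> E \<and> w \<notin> e)" by (auto simp: inc_def)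
    then show "e \<subseteq> verts ?G'" "card e = 2"
      using edges wn d E by (auto simp: edge_set_def)
  qed
  let ?N2 = "neighbours ?G' p - {u, t}"
  have Ea: "{e \<in> ?E. p \<notin> e} = {e \<in> E. p \<notin> e \<and> w \<notin> e}" by (auto simp: inc_def)
  have pu: "{p, u} \<notin> E" "{p, t} \<notin> E" using up by (auto simp: insert_commute)
  have r: "x \<in> ?N2 \<longleftrightarrow> x \<noteq> w \<and> {p, x} \<in> E" for x
    using pu wn d by (auto simp: neighbours_def inc_def doubleton_eq_iff)
  have qN: "q \<in> ?N2" using q r by blast
  have N2: "{{p, x} |x. x \<in> ?N2} = {e \<in> E. p \<in> e \<and> w \<notin> e}"
  proof
    show "{{p, x} |x. x \<in> ?N2} \<subseteq> {e \<in> E. p \<in> e \<and> w \<notin> e}" using r wn by auto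
    show "{e \<in> E. p \<in> e \<and> w \<notin> e} \<subseteq> {{p, x} |x. x \<in> ?N2}"
    proof
      fix e assume e: "e \<in> {e \<in> E. p \<in> e \<and> w \<notin> e}"
      then obtain x where x: "e = {p, x}" using edge_set_edgeE'[OF E, of e p] by auto
      then have "x \<in> ?N2" using r e by auto
      then show "e \<in> {{p, x} |x. x \<in> ?N2}" using x by blast
    qed
  qed
  have ed: "E = {e \<in> E. p \<notin> e \<and> w \<notin> e} \<union> {{w, u}, {w, t}} \<union> {e \<in> E. p \<in> e \<and> w \<notin> e} \<union> {{w, p}, {w, z}}"
  proof -
    have "E = {e \<in> E. w \<notin> e} \<union> inc E {w}" by (auto simp: inc_def)
    also have "{e \<in> E. w \<notin> e} = {e \<in> E. p \<notin> e \<and> w \<notin> e} \<union> {e \<in> E. p \<in> e \<and> w \<notin> e}" by blast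
    finally show ?thesis unfolding iw by blast
  qed
  have N1: "{{w, x} |x. x \<in> {u, t}} = {{w, u}, {w, t}}" by auto
  have E4: "edges (\<Union>E, E) = {e \<in> edges ?G'. p \<notin> e} \<union> {{w, x} |x. x \<in> {u, t}} \<union> {{p, x} |x. x \<in> ?N2}
      \<union> {{w, p}, {w, z}}"
    unfolding N2 N1 using ed Ea by simp
  have bN: "u \<in> neighbours ?G' p" "t \<in> neighbours ?G' p" by (auto simp: neighbours_def)
  have aV: "p \<in> \<Union>E - {w}" "z \<in> \<Union>E - {w}" "w \<in> \<Union>E" using edges wn by auto
  show ?thesis
    unfolding edge_reduction_def generalised_vertex_split_def
    apply (rule conjI[OF sg])
    apply (rule exI[of _ p], rule exI[of _ "{u, t}"], rule exI[of _ ?N2], rule exI[of _ w], rule exI[of _ p], rule exI[of _ z])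
    using E4 bN aV wn d qN by auto
qed

text \<open>The new edges \<open>up\<close> and \<open>tp\<close> stand in for \<open>uw\<close> and
  \<open>tw\<close>. \<open>hS\<close> excludes sets at \<open>z\<close> that cannot spare
  \<open>wz\<close>; \<open>hZ\<close> excludes sets in which contracting \<open>wp\<close> creates
  one induced edge too many.\<close>

lemma ear_contract_reduction:
  assumes e: "ear E Y" and Y: "w \<in> Y" "u \<in> Y" "t \<in> Y" and w: "nb E w = {u, t, z, p}"
    and u: "nb E u = {t, w, z}" and t: "nb E t = {u, w, z}"
    and d: "u \<noteq> t" "u \<noteq> z" "u \<noteq> p" "t \<noteq> z" "t \<noteq> p" "z \<noteq> p"
    and hS: "\<And>S. S \<subseteq> Y \<Longrightarrow> z \<in> S \<Longrightarrow> w \<notin> S \<Longrightarrow> card (inc E S) \<noteq> 2 * card S + 1"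
    and hZ: "\<And>Z. Z \<subseteq> Y \<Longrightarrow> w \<in> Z \<Longrightarrow> p \<in> Z \<Longrightarrow> z \<notin> Z \<Longrightarrow> \<not> tight E Z"
  shows "reducible E"
proof -
  have E: "edge_set E" and finY: "finite Y" using earD[OF e] by auto
  have finE: "finite E" using E by (simp add: edge_set_def)
  let ?R = "E - inc E {w}" and ?Y = "Y - {w}"
  let ?N = "{{u, p}, {t, p}}"
  let ?E = "?N \<union> ?R"
  have wn: "w \<noteq> u" "w \<noteq> t" "w \<noteq> z" "w \<noteq> p" using nb_irrefl[OF E, of w] w by auto
  have edges: "{w, u} \<in> E" "{w, t} \<in> E" "{w, z} \<in> E" "{w, p} \<in> E" "{u, z} \<in> E" "{t, z} \<in> E"
    using w u t by (auto simp: nb_def)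
  have iw: "inc E {w} = {{w, u}, {w, t}, {w, z}, {w, p}}" using inc_singleton_nb[OF E, of w] w by auto
  have up: "{u, p} \<notin> E" "{t, p} \<notin> E" using u t d wn by (auto simp: nb_def)
  have c4: "card (inc E {w}) = 4" unfolding card_inc_singleton[OF E] using w d by simp
  have E0: "card (inc E (insert w Z)) = card (inc ?R Z) + 4" for Z
  proof -
    have "inc E (insert w Z) = inc ?R Z \<union> inc E {w}" by (auto simp: inc_def)
    moreover have "card (inc ?R Z \<union> inc E {w}) = card (inc ?R Z) + card (inc E {w})"
      using finE by (intro card_Un_disjoint) (auto simp: inc_def)
    ultimately show ?thesis using c4 by simp
  qed
  have split: "card (inc ?E Z) = card (inc ?N Z) + card (inc ?R Z)" for Z
  proof -
    have "inc ?E Z = inc ?N Z \<union> inc ?R Z" unfolding inc_def by blast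
    moreover have "card (inc ?N Z \<union> inc ?R Z) = card (inc ?N Z) + card (inc ?R Z)"
    proof (rule card_Un_disjoint)
      show "inc ?N Z \<inter> inc ?R Z = {}" using up by (fastforce simp: inc_def)
    qed (use finE in auto)
    ultimately show ?thesis by simp
  qed
  have upne: "{u, p} \<noteq> {t, p}" using d by (auto simp: doubleton_eq_iff)
  have N2: "card (inc ?N Z) = 2" if "p \<in> Z \<or> (u \<in> Z \<and> t \<in> Z)" for Z
  proof -
    have "inc ?N Z = ?N" using that by (auto simp: inc_def)
    then show ?thesis using upne by simp
  qed
  have inY: "card (insert w Z) = Suc (card Z)" if "Z \<subseteq> ?Y" for Z
    using that finY by (subst card_insert_disjoint) (auto intro: finite_subset)
  have out: "outer ?E ?Y = outer E Y" using Y wn by (auto simp: outer_def inc_def)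
  have "ear ?E ?Y"
    unfolding ear_def out
  proof (intro conjI allI impI)
    show "edge_set ?E" using edge_set_Un[of ?N, OF _ edge_set_subset[OF E]] d by (auto simp: edge_set_def)
    show "finite ?Y" using finY by simp
    show "conn (outer E Y)" using earD[OF e] by simp
    show "\<Union>?E \<subseteq> ?Y \<union> \<Union>(outer E Y)"
    proof -
      have "x \<in> ?Y \<union> \<Union>(outer E Y)" if "x \<in> \<Union>E" "x \<noteq> w" for x
        using ear_Union[OF e] that by blast
      moreover have "u \<in> \<Union>E" "t \<in> \<Union>E" "p \<in> \<Union>E" using edges by auto
      ultimately show ?thesis using wn by (auto simp: inc_def)
    qed
    show "2 * card Z + 1 \<le> card (inc ?E Z)" if Z: "Z \<subseteq> ?Y" "Z \<noteq> {}" for Z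
    proof -
      have wZ: "w \<notin> Z" and ZY: "insert w Z \<subseteq> Y" "Z \<subseteq> Y" using Z Y by auto
      show ?thesis
      proof (cases "p \<in> Z")
        case True
        then show ?thesis using earD(5)[OF e ZY(1)] E0[of Z] split[of Z] N2[of Z] inY[OF Z(1)] by simp
      next
        case p: False
        \<comment> \<open>A set without \<open>w\<close> and \<open>p\<close> meets
          \<open>up\<close> and \<open>tp\<close> exactly as it met \<open>wu\<close> and
          \<open>wt\<close>; the only edge it can lose is \<open>wz\<close>.\<close>
        let ?W = "{{w, u}, {w, t}}"
        have cW: "card (inc ?N Z) = card (inc ?W Z)"
        proof -
          have "inc ?N Z = (\<lambda>x. {x, p}) ` ({u, t} \<inter> Z)" using p unfolding inc_def by blast
          moreover have "inc ?W Z = (\<lambda>x. {w, x}) ` ({u, t} \<inter> Z)" using wZ unfolding inc_def by blast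
          moreover have "inj_on (\<lambda>x. {x, p}) A" "inj_on (\<lambda>x. {w, x}) A" for A
            by (auto simp: inj_on_def doubleton_eq_iff)
          ultimately show ?thesis by (metis card_image)
        qed
        have dec: "inc E Z \<subseteq> inc (inc E {w}) Z \<union> inc ?R Z" by (auto simp: inc_def[of _ Z])
        have "inc (inc E {w}) Z \<subseteq> inc ?W Z \<union> {{w, z}}"
          unfolding iw using p wZ by (auto simp: inc_def)
        with dec have "inc E Z \<subseteq> inc ?W Z \<union> inc ?R Z \<union> {{w, z}}" by blast
        moreover have "inc E Z \<subseteq> inc ?W Z \<union> inc ?R Z" if zZ: "z \<notin> Z"
        proof -
          have "inc (inc E {w}) Z \<subseteq> inc ?W Z" unfolding iw using p wZ zZ by (auto simp: inc_def)
          with dec show ?thesis by blast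
        qed
        moreover have cU: "card (inc ?W Z \<union> inc ?R Z) = card (inc ?W Z) + card (inc ?R Z)"
          using finE by (intro card_Un_disjoint) (auto simp: inc_def)
        moreover have finU: "finite (inc ?W Z \<union> inc ?R Z)" using finE by simp
        moreover have "card (inc ?W Z \<union> inc ?R Z \<union> {{w, z}}) \<le> Suc (card (inc ?W Z \<union> inc ?R Z))"
          using finU card_Un_le[of "inc ?W Z \<union> inc ?R Z" "{{w, z}}"] by simp
        ultimately have le: "card (inc E Z) \<le> card (inc ?E Z) + 1" "z \<notin> Z \<Longrightarrow> card (inc E Z) \<le> card (inc ?E Z)"
          using split[of Z] cW card_mono[of "inc ?W Z \<union> inc ?R Z \<union> {{w, z}}" "inc E Z"]
            card_mono[of "inc ?W Z \<union> inc ?R Z" "inc E Z"] by auto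
        show ?thesis
        proof (cases "z \<in> Z")
          case True
          then have "card (inc E Z) \<noteq> 2 * card Z + 1" using hS[OF ZY(2)] wZ by blast
          then show ?thesis using le(1) earD(5)[OF e ZY(2) Z(2)] by simp
        next
          case False
          then show ?thesis using le(2) earD(5)[OF e ZY(2) Z(2)] by simp
        qed
      qed
    qed
    show "card (inc ?E ?Y) = 2 * card ?Y + 1"
    proof -
      have "insert w ?Y = Y" using Y by blast
      moreover have "u \<in> ?Y \<and> t \<in> ?Y" using Y wn by blast
      ultimately show ?thesis using E0[of ?Y] split[of ?Y] N2[of ?Y] inY[of ?Y] earD(6)[OF e] by simp
    qed
    show "card (ind ?E Z) + 2 \<le> 2 * card Z" if Z: "Z \<subseteq> ?Y" "Z \<noteq> {}" for Z
    proof -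
      have wZ: "w \<notin> Z" and ZY: "insert w Z \<subseteq> Y" "Z \<subseteq> Y" using Z Y by auto
      show ?thesis
      proof (cases "p \<in> Z")
        case False
        then have "card (ind ?E Z) \<le> card (ind E Z)" using finE by (intro card_mono) (auto simp: ind_def)
        then show ?thesis using earD(7)[OF e ZY(2) Z(2)] by simp
      next
        case p: True
        have fZ: "finite (insert w Z)" using ZY finY finite_subset by blast
        have B: "card (ind E (insert w Z)) + 2 \<le> 2 * card (insert w Z)" using earD(7)[OF e ZY(1)] by simp
        \<comment> \<open>Each new edge is sent to the edge at \<open>w\<close> that it replaces.
          Neither \<open>wp\<close> nor \<open>wz\<close> is hit. Dropping \<open>w\<close> lowers
          the bound by two: \<open>wp\<close> and \<open>wz\<close> pay for it if
          \<open>z \<in> Z\<close>, otherwise \<open>wp\<close> and the failure of tightness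
          do.\<close>
        let ?f = "\<lambda>e. if e = {u, p} then {w, u} else if e = {t, p} then {w, t} else e"
        have inj: "inj_on ?f (ind ?E Z)"
          using wZ d wn by (auto simp: inj_on_def ind_def doubleton_eq_iff split: if_splits)
        have img: "?f ` ind ?E Z \<subseteq> ind E (insert w Z) - {{w, p}}"
          using edges wZ d wn by (auto simp: ind_def inc_def doubleton_eq_iff)
        have img2: "?f ` ind ?E Z \<subseteq> ind E (insert w Z) - {{w, p}, {w, z}}"
          using edges wZ d wn by (auto simp: ind_def inc_def doubleton_eq_iff)
        have wp: "{w, p} \<in> ind E (insert w Z)" using edges p by (auto simp: ind_def)
        have c1: "card (ind ?E Z) \<le> card (ind E (insert w Z) - {{w, p}})"
          using card_image[OF inj] card_mono[OF _ img] finE by simp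
        have c1': "card (ind E (insert w Z)) = Suc (card (ind E (insert w Z) - {{w, p}}))"
          using card_Suc_Diff1[OF _ wp] finE by simp
        show ?thesis
        proof (cases "z \<in> Z")
          case True
          have "{w, z} \<in> ind E (insert w Z) - {{w, p}}"
            using edges True d by (auto simp: ind_def doubleton_eq_iff)
          then have "card (ind E (insert w Z) - {{w, p}}) = Suc (card (ind E (insert w Z) - {{w, p}} - {{w, z}}))"
            using card_Suc_Diff1[of "ind E (insert w Z) - {{w, p}}" "{w, z}"] finE by simp
          moreover have "ind E (insert w Z) - {{w, p}} - {{w, z}} = ind E (insert w Z) - {{w, p}, {w, z}}" by blast
          moreover have "card (ind ?E Z) \<le> card (ind E (insert w Z) - {{w, p}, {w, z}})"
            using card_image[OF inj] card_mono[OF _ img2] finE by simp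
          ultimately show ?thesis using B c1' inY[OF Z(1)] by simp
        next
          case False
          then have "\<not> tight E (insert w Z)" using hZ[OF ZY(1)] p wn by auto
          then have "card (ind E (insert w Z)) + 3 \<le> 2 * card (insert w Z)"
            using B fZ by (auto simp: tight_def)
          then show ?thesis using c1 c1' inY[OF Z(1)] by simp
        qed
      qed
    qed
    show "\<exists>f\<in>inc ?E ?Y. \<not> f \<subseteq> insert x ?Y" for x
    proof -
      obtain f where f: "f \<in> inc E Y" "\<not> f \<subseteq> insert x Y" using earD(8)[OF e] by blast
      show ?thesis
      proof (cases "f \<in> inc E {w}")
        case False
        then have "f \<in> inc ?E ?Y" using f by (auto simp: inc_def)
        then show ?thesis using f by blast
      next
        case True
        then consider "z \<notin> insert x Y" | "p \<notin> insert x Y" using f iw Y by auto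
        then show ?thesis
        proof cases
          case 1
          have "{u, z} \<in> inc ?E ?Y" using Y edges wn by (auto simp: inc_def)
          then show ?thesis using 1 by blast
        next
          case 2
          have "{u, p} \<in> inc ?E ?Y" using Y wn by (auto simp: inc_def)
          then show ?thesis using 2 by blast
        qed
      qed
    qed
  qed
  then have "conn ?E" "\<Union>?E = ?Y \<union> \<Union>(outer E Y)" using ear_conn ear_Union out by metis+
  moreover have "?Y \<union> \<Union>(outer E Y) = \<Union>E - {w}" using ear_Union[OF e] Y by (auto simp: outer_def)
  ultimately have M: "M22_connected (\<Union>E - {w}, ?E)" by (simp add: M22_connected_iff)
  obtain q where "q \<noteq> w" "{p, q} \<in> E" using ear_other_nbr[OF e _ Y(1), of p] edges by blast
  then have "edge_reduction (\<Union>E, E) (\<Union>E - {w}, ?E)" using edge_reduction_contract[OF E w d up] by blast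
  then show ?thesis using M by (auto simp: reducible_def)
qed

section \<open>Vertex additions and handshakes\<close>

lemma card_ind_insert:
  assumes E: "edge_set E" and v: "v \<notin> Z"
  shows "card (ind E (insert v Z)) = card (ind E Z) + card (nb E v \<inter> Z)"
proof -
  have "ind E (insert v Z) = ind E Z \<union> (\<lambda>w. {v, w}) ` (nb E v \<inter> Z)" (is "?l = ?r")
  proof
    show "?l \<subseteq> ?r"
    proof
      fix e assume e: "e \<in> ?l"
      show "e \<in> ?r"
      proof (cases "v \<in> e")
        case True
        then obtain w where "e = {v, w}" "v \<noteq> w" using edge_set_edgeE'[OF E, of e v] e by (auto simp: ind_def)
        then show ?thesis using e by (auto simp: ind_def nb_def)
      next
        case False then show ?thesis using e by (auto simp: ind_def)
      qed
    qed
  qed (auto simp: ind_def nb_def)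
  moreover have "card (ind E Z \<union> (\<lambda>w. {v, w}) ` (nb E v \<inter> Z)) = card (ind E Z) + card ((\<lambda>w. {v, w}) ` (nb E v \<inter> Z))"
    using v finite_nb[OF E] edge_set_finite[OF E] by (intro card_Un_disjoint) (auto simp: ind_def)
  moreover have "card ((\<lambda>w. {v, w}) ` (nb E v \<inter> Z)) = card (nb E v \<inter> Z)"
    by (rule card_image) (auto simp: inj_on_def doubleton_eq_iff)
  ultimately show ?thesis by simp
qed

lemma card_inc_insert:
  assumes E: "edge_set E" and v: "v \<notin> Z"
  shows "card (inc E (insert v Z)) = card (inc E Z) + card (nb E v - Z)"
proof -
  have "inc E (insert v Z) = inc E Z \<union> (\<lambda>w. {v, w}) ` (nb E v - Z)" (is "?l = ?r")
  proof
    show "?l \<subseteq> ?r"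
    proof
      fix e assume e: "e \<in> ?l"
      show "e \<in> ?r"
      proof (cases "e \<inter> Z = {}")
        case True
        then have "v \<in> e" using e by (auto simp: inc_def)
        then obtain w where "e = {v, w}" using edge_set_edgeE'[OF E, of e v] e by (auto simp: inc_def)
        then show ?thesis using e True by (auto simp: inc_def nb_def)
      next
        case False then show ?thesis using e by (auto simp: inc_def)
      qed
    qed
  qed (auto simp: inc_def nb_def)
  moreover have "card (inc E Z \<union> (\<lambda>w. {v, w}) ` (nb E v - Z)) = card (inc E Z) + card ((\<lambda>w. {v, w}) ` (nb E v - Z))"
    using v finite_nb[OF E] edge_set_finite[OF E] by (intro card_Un_disjoint) (auto simp: inc_def)
  moreover have "card ((\<lambda>w. {v, w}) ` (nb E v - Z)) = card (nb E v - Z)"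
    by (rule card_image) (auto simp: inj_on_def doubleton_eq_iff)
  ultimately show ?thesis by simp
qed

lemma sum_degrees_inc_ind:
  assumes E: "edge_set E" and "finite K"
  shows "(\<Sum>x\<in>K. card (nb E x)) = card (inc E K) + card (ind E K)"
  using assms(2)
proof (induction K)
  case empty then show ?case using ind_empty[OF E] by (simp add: inc_def)
next
  case (insert v K)
  have "card (nb E v - K) + card (nb E v \<inter> K) = card (nb E v)"
    using card_Int_Diff[OF finite_nb[OF E], of v K] by simp
  then show ?case using insert card_ind_insert[OF E insert(2)] card_inc_insert[OF E insert(2)] by simp
qed

lemma sum_degrees_ind:
  assumes E: "edge_set E" and "finite K"
  shows "(\<Sum>x\<in>K. card (nb E x \<inter> K)) = 2 * card (ind E K)"
  using assms(2)
proof (induction K)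
  case empty then show ?case using ind_empty[OF E] by simp
next
  case (insert v K)
  have vv: "nb E v \<inter> insert v K = nb E v \<inter> K" using nb_irrefl[OF E] by auto
  have "card (nb E x \<inter> insert v K) = card (nb E x \<inter> K) + (if x \<in> nb E v then 1 else 0)" if "x \<in> K" for x
  proof (cases "x \<in> nb E v")
    case True
    then have "nb E x \<inter> insert v K = insert v (nb E x \<inter> K)" using nb_sym[of x E v] by auto
    then show ?thesis using True insert finite_nb[OF E] by simp
  next
    case False
    then have "nb E x \<inter> insert v K = nb E x \<inter> K" using nb_sym[of x E v] by auto
    then show ?thesis using False by simp
  qed
  then have "(\<Sum>x\<in>K. card (nb E x \<inter> insert v K)) = (\<Sum>x\<in>K. card (nb E x \<inter> K) + (if x \<in> nb E v then 1 else 0))"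
    by (rule sum.cong[OF refl])
  also have "\<dots> = 2 * card (ind E K) + (\<Sum>x\<in>K. if x \<in> nb E v then 1 else 0)"
    using insert by (simp add: sum.distrib)
  also have "(\<Sum>x\<in>K. if x \<in> nb E v then 1 else 0) = card (nb E v \<inter> K)"
    using insert(1) by (simp add: sum.If_cases Int_commute Collect_mem_eq)
  finally show ?case using insert card_ind_insert[OF E insert(2)] vv by simp
qed

section \<open>Irreducible ears\<close>

text \<open>\<open>no_3_cut\<close> says that at least four edges leave \<open>Z\<close>; the two
  bounds of an ear alone give three. The locale is refuted in the end.\<close>

locale irreducible_ear =
  fixes E :: "'a set set" and Y :: "'a set"
  assumes ear: "ear E Y"
    and no_3_cut: "\<And>Z. Z \<subseteq> Y \<Longrightarrow> 2 \<le> card Z \<Longrightarrow> card (ind E Z) + 4 \<le> card (inc E Z)"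
    and irreducible: "\<not> reducible E"
begin

lemmas E = earD(1)[OF ear] and finY = earD(2)[OF ear]
  and inc_ge = earD(5)[OF ear] and inc_Y = earD(6)[OF ear] and ind_le = earD(7)[OF ear]

lemma finE: "finite E"
  using E by (simp add: edge_set_def)

lemma finite_subY: "Z \<subseteq> Y \<Longrightarrow> finite Z"
  using finY finite_subset by blast

definition node :: "'a \<Rightarrow> bool" where
  "node v \<longleftrightarrow> v \<in> Y \<and> card (nb E v) = 3"

definition dt :: "'a set \<Rightarrow> bool" where
  "dt S \<longleftrightarrow> S \<subseteq> Y \<and> S \<noteq> {} \<and> card (inc E S) = 2 * card S + 1"

lemma dtD: "dt S \<Longrightarrow> S \<subseteq> Y" "dt S \<Longrightarrow> S \<noteq> {}" "dt S \<Longrightarrow> card (inc E S) = 2 * card S + 1" "dt S \<Longrightarrow> finite S"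
  using finite_subY by (auto simp: dt_def)

lemma node_iff_dt: "v \<in> Y \<Longrightarrow> node v \<longleftrightarrow> dt {v}"
  using card_inc_singleton[OF E] by (simp add: node_def dt_def)

lemma nodeE:
  assumes "node v" "a \<in> nb E v"
  obtains b c where "nb E v = {a, b, c}" "a \<noteq> b" "a \<noteq> c" "b \<noteq> c"
proof -
  have "card (nb E v - {a}) = 2" using assms finite_nb[OF E] by (simp add: node_def)
  then obtain b c where "nb E v - {a} = {b, c}" "b \<noteq> c" by (auto simp: card_2_iff)
  then show ?thesis using that[of b c] assms by auto
qed

lemma nodeE2:
  assumes "node v" "a \<in> nb E v" "b \<in> nb E v" "a \<noteq> b"
  obtains c where "nb E v = {a, b, c}" "a \<noteq> c" "b \<noteq> c"
proof -
  obtain p q where "nb E v = {a, p, q}" "a \<noteq> p" "a \<noteq> q" "p \<noteq> q" using nodeE[OF assms(1,2)] .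
  then show ?thesis using assms that[of p] that[of q] by auto
qed

lemma node_nb_eq:
  assumes "node v" "{a, b, c} \<subseteq> nb E v" "a \<noteq> b" "a \<noteq> c" "b \<noteq> c"
  shows "nb E v = {a, b, c}"
  using card_subset_eq[OF finite_nb[OF E] assms(2)] assms by (simp add: node_def)

lemma degree_ge: "v \<in> Y \<Longrightarrow> 3 \<le> card (nb E v)"
  using inc_ge[of "{v}"] card_inc_singleton[OF E, of v] by simp

text \<open>The counting identity meets the lower bound on incident edges: union and intersection
  can have no surplus, and nothing is left for edges between the differences.\<close>

lemma dt_Un_Int:
  assumes A: "dt A" and B: "dt B" and ne: "A \<inter> B \<noteq> {}"
  shows "dt (A \<union> B)" "dt (A \<inter> B)" "btw E (A - B) (B - A) = {}"
proof -
  have fin: "finite A" "finite B" using A B dtD by auto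
  have sub: "A \<union> B \<subseteq> Y" "A \<inter> B \<subseteq> Y" using A B by (auto simp: dt_def)
  have "2 * card (A \<union> B) + 1 \<le> card (inc E (A \<union> B))" "2 * card (A \<inter> B) + 1 \<le> card (inc E (A \<inter> B))"
    using inc_ge sub ne by (blast intro: inc_ge)+
  then have "card (inc E (A \<union> B)) = 2 * card (A \<union> B) + 1 \<and> card (inc E (A \<inter> B)) = 2 * card (A \<inter> B) + 1
      \<and> card (btw E (A - B) (B - A)) = 0"
    using inc_Un_Int[OF E, of A B] card_Un_Int[OF fin] A B unfolding dt_def by linarith
  then show "dt (A \<union> B)" "dt (A \<inter> B)" "btw E (A - B) (B - A) = {}"
    using sub ne finE by (auto simp: dt_def)
qed

lemma dt_cross_no_edge:
  assumes "dt A" "dt B" "A \<inter> B \<noteq> {}" "a \<in> A - B" "b \<in> B - A"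
  shows "{a, b} \<notin> E"
  using dt_Un_Int(3)[OF assms(1-3)] assms(4,5) by (auto simp: btw_def)

text \<open>The incident edges of the two sets exceed twice the number of vertices by two in total,
  those of the union by at least one; an edge between the sets is counted twice in the
  total.\<close>

lemma dt_disjoint_btw:
  assumes A: "dt A" and B: "dt B" and ne: "A \<inter> B = {}"
  shows "card (btw E A B) \<le> 1"
proof -
  have fin: "finite A" "finite B" using A B dtD by auto
  have "2 * card (A \<union> B) + 1 \<le> card (inc E (A \<union> B))" using A B by (intro inc_ge) (auto simp: dt_def)
  moreover have "A - B = A" "B - A = B" using ne by auto
  moreover have "inc E {} = {}" by (simp add: inc_def)
  ultimately show ?thesis
    using inc_Un_Int[OF E, of A B] card_Un_disjoint[OF fin ne] A B ne by (simp add: dt_def)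
qed

text \<open>Two sides without an edge between them would each exceed twice their size by one, while
  \<open>A\<close> does so only once.\<close>

lemma dt_connected:
  assumes "dt A" "B \<subseteq> A" "B \<noteq> {}" "A - B \<noteq> {}"
  obtains x y where "x \<in> B" "y \<in> A - B" "{x, y} \<in> E"
proof (rule ccontr)
  assume no: "\<not> thesis"
  have sub: "B \<subseteq> Y" "A - B \<subseteq> Y" using assms by (auto simp: dt_def)
  have fin: "finite B" "finite (A - B)" using sub finite_subY by auto
  have "btw E (B - (A - B)) (A - B - B) = {}"
  proof (rule ccontr)
    assume "\<not> ?thesis"
    then obtain e x y where e: "e \<in> E" "x \<in> e" "y \<in> e" "x \<in> B" "y \<in> A - B" by (auto simp: btw_def)
    then obtain y' where "e = {x, y'}" using edge_set_edgeE'[OF E] by metis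
    then have "e = {x, y}" using e by auto
    then show False using no that e by blast
  qed
  moreover have "B \<union> (A - B) = A" "B \<inter> (A - B) = {}" using assms by auto
  ultimately have "card (inc E B) + card (inc E (A - B)) = card (inc E A)"
    using inc_Un_Int[OF E, of B "A - B"] by (simp add: inc_def)
  moreover have "card A = card B + card (A - B)"
    using card_Un_disjoint[OF fin] \<open>B \<union> (A - B) = A\<close> by simp
  ultimately show False
    using inc_ge[OF sub(1) assms(3)] inc_ge[OF sub(2) assms(4)] assms(1) by (simp add: dt_def)
qed

lemma tight_finite: "tight E Z \<Longrightarrow> finite Z" "tight E Z \<Longrightarrow> Z \<noteq> {}"
  by (auto simp: tight_def)

lemma sparse_onY: "U \<subseteq> Y \<Longrightarrow> sparse_on E U"
  unfolding sparse_on_def using ind_le by blast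

lemma tight_Un_Y: "tight E A \<Longrightarrow> tight E B \<Longrightarrow> A \<subseteq> Y \<Longrightarrow> B \<subseteq> Y \<Longrightarrow> A \<inter> B \<noteq> {} \<Longrightarrow> tight E (A \<union> B)"
  using tight_Un[OF E sparse_onY[OF order_refl]] by blast

text \<open>As \<open>Z\<close> is tight and \<open>Z - U\<close> sparse, at least
  \<open>2 * card (Z \<inter> U)\<close> edges inside \<open>Z\<close> touch \<open>U\<close>. None
  of them is incident with \<open>U - Z\<close>, which is therefore left with the minimum.\<close>

lemma dt_Diff_tight:
  assumes U: "dt U" and Z: "tight E Z" "Z \<subseteq> Y" and ne: "Z - U \<noteq> {}" "U - Z \<noteq> {}"
  shows "dt (U - Z)"
proof -
  have fin: "finite U" "finite Z" using dtD(4)[OF U] tight_finite[OF Z(1)] by auto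
  have "card (ind E (Z - U)) + 2 \<le> 2 * card (Z - U)" using Z ne by (intro ind_le) auto
  moreover have "card (ind E Z) + 2 = 2 * card Z" using Z by (simp add: tight_def)
  moreover have "card (ind E Z - ind E (Z - U)) = card (ind E Z) - card (ind E (Z - U))"
    using finE by (intro card_Diff_subset) (auto simp: ind_def)
  moreover have "card Z = card (Z - U) + card (Z \<inter> U)" "card U = card (U - Z) + card (Z \<inter> U)"
    using card_Int_Diff[OF fin(1), of Z] card_Int_Diff[OF fin(2), of U] by (simp_all add: Int_commute)
  moreover have "card (inc E (U - Z) \<union> (ind E Z - ind E (Z - U))) \<le> card (inc E U)"
    using finE by (intro card_mono) (auto simp: ind_def inc_def)
  moreover have "card (inc E (U - Z) \<union> (ind E Z - ind E (Z - U))) = card (inc E (U - Z)) + card (ind E Z - ind E (Z - U))"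
    using finE by (intro card_Un_disjoint) (auto simp: ind_def inc_def)
  moreover have "2 * card (U - Z) + 1 \<le> card (inc E (U - Z))" using U ne by (intro inc_ge) (auto simp: dt_def)
  moreover have "card (inc E U) = 2 * card U + 1" using U by (simp add: dt_def)
  ultimately have "card (inc E (U - Z)) = 2 * card (U - Z) + 1" by linarith
  then show ?thesis using U ne by (auto simp: dt_def)
qed

text \<open>The analogue for \<open>U\<close> of the two attachment vertices of \<open>Y\<close>. If
  \<open>x \<in> Y\<close>, then \<open>insert x U\<close> would induce more than
  \<open>2 * card U\<close> edges. If \<open>x \<notin> Y\<close>, either \<open>U = Y\<close> or
  connectedness of \<open>Y\<close> yields an edge into \<open>Y - U\<close>.\<close>

lemma dt_outside:
  assumes U: "dt U" shows "\<exists>e\<in>inc E U. \<not> e \<subseteq> insert x U"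
proof (rule ccontr)
  assume no: "\<not> ?thesis"
  then have sub: "inc E U \<subseteq> ind E (insert x U)" by (auto simp: inc_def ind_def)
  then have le: "card (inc E U) \<le> card (ind E (insert x U))" using finE by (intro card_mono) auto
  have ce: "card (inc E U) = 2 * card U + 1" and UY: "U \<subseteq> Y" "U \<noteq> {}" "finite U" using U dtD by auto
  show False
  proof (cases "x \<in> Y")
    case True
    then have "card (ind E (insert x U)) + 2 \<le> 2 * card (insert x U)" using UY by (intro ind_le) auto
    moreover have "card (insert x U) \<le> Suc (card U)" using UY by (intro card_insert_le_m1) auto
    ultimately show False using le ce by simp
  next
    case x: False
    show False
    proof (cases "U = Y")
      case True then show False using no earD(8)[OF ear, of x] by simp
    next
      case False
      have "dt Y" using UY inc_Y by (auto simp: dt_def)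
      then obtain a b where ab: "a \<in> U" "b \<in> Y - U" "{a, b} \<in> E"
        using dt_connected[of Y U] UY False by blast
      then have "{a, b} \<in> ind E (insert x U)" using sub by (auto simp: inc_def)
      then show False using ab x by (auto simp: ind_def)
    qed
  qed
qed

text \<open>\<open>Z - {v}\<close> induces at most \<open>2 * card Z - 4\<close> edges, so
  \<open>v\<close> accounts for two.\<close>

lemma tight_degree:
  assumes Z: "tight E Z" "Z \<subseteq> Y" and v: "v \<in> Z" "Z \<noteq> {v}"
  shows "2 \<le> card (nb E v \<inter> Z)"
proof -
  have ne: "Z - {v} \<noteq> {}" using v by blast
  have "card (ind E (Z - {v})) + 2 \<le> 2 * card (Z - {v})" using Z ne by (intro ind_le) auto
  moreover have "card Z = Suc (card (Z - {v}))" using card_Suc_Diff1[OF tight_finite(1)[OF Z(1)] v(1)] by simp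
  moreover have "card (ind E Z) = card (ind E (Z - {v})) + card (nb E v \<inter> (Z - {v}))"
    using card_ind_insert[OF E, of v "Z - {v}"] v by (simp add: insert_absorb)
  moreover have "nb E v \<inter> (Z - {v}) = nb E v \<inter> Z" using nb_irrefl[OF E] by blast
  ultimately show ?thesis using Z by (simp add: tight_def)
qed

lemma tight_nb_le:
  assumes Z: "tight E Z" "Z \<subseteq> Y" and v: "v \<in> Y - Z"
  shows "card (nb E v \<inter> Z) \<le> 2"
proof -
  have "card (ind E (insert v Z)) + 2 \<le> 2 * card (insert v Z)" using Z v by (intro ind_le) auto
  then show ?thesis using card_ind_insert[OF E, of v Z] v Z by (simp add: tight_def)
qed

lemma tight_insert:
  assumes Z: "tight E Z" "Z \<subseteq> Y" and v: "v \<in> Y - Z" and ge: "2 \<le> card (nb E v \<inter> Z)"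
  shows "tight E (insert v Z)"
  using tight_nb_le[OF assms(1-3)] ge card_ind_insert[OF E, of v Z] v Z by (simp add: tight_def)

lemma tight_two_nbs:
  assumes Z: "tight E Z" "Z \<subseteq> Y" and v: "v \<in> Y - Z" and ab: "a \<in> nb E v \<inter> Z" "b \<in> nb E v \<inter> Z" "a \<noteq> b"
  shows "tight E (insert v Z)"
proof (rule tight_insert[OF Z v])
  have "card {a, b} \<le> card (nb E v \<inter> Z)" using ab finite_nb[OF E] by (intro card_mono) auto
  then show "2 \<le> card (nb E v \<inter> Z)" using ab by simp
qed

lemma tight_not_all_nbs:
  assumes Z: "tight E Z" "Z \<subseteq> Y" and v: "v \<in> Y - Z" shows "\<not> nb E v \<subseteq> Z"
proof
  assume "nb E v \<subseteq> Z"
  then have "nb E v \<inter> Z = nb E v" by blast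
  then show False using tight_nb_le[OF Z v] degree_ge[of v] v by simp
qed

lemma adjacent_nodes_dt:
  assumes "node u" "node t" "{u, t} \<in> E" shows "dt {u, t}"
proof -
  have ut: "u \<noteq> t" using assms(3) nb_irrefl[OF E, of u] by (auto simp: nb_def)
  have "u \<in> nb E t" using assms(3) by (simp add: nb_def insert_commute)
  then have c: "card (inc E {u, t}) = card (inc E {u}) + card (nb E t - {u})"
    using card_inc_insert[OF E, of t "{u}"] ut by (simp add: insert_commute)
  also have "card (nb E t - {u}) = 2" using \<open>u \<in> nb E t\<close> assms(2) by (simp add: node_def)
  finally show ?thesis using assms ut card_inc_singleton[OF E, of u] by (simp add: node_def dt_def)
qed

lemma dt_insert_node:
  assumes K: "dt K" and y: "node y" "y \<notin> K" "x \<in> K" "{x, y} \<in> E"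
  shows "dt (insert y K)"
proof -
  have "x \<in> nb E y" using y by (simp add: nb_def insert_commute)
  then have "card (nb E y - K) \<le> 2"
    using card_mono[of "nb E y - {x}" "nb E y - K"] y finite_nb[OF E] by (auto simp: node_def)
  moreover have "insert y K \<subseteq> Y" using K y by (auto simp: dt_def node_def)
  moreover have "2 * card (insert y K) + 1 \<le> card (inc E (insert y K))"
    using calculation by (intro inc_ge) auto
  moreover have "card (insert y K) = Suc (card K)" using y dtD(4)[OF K] by simp
  ultimately show ?thesis
    using card_inc_insert[OF E y(2)] dtD(3)[OF K] by (auto simp: dt_def)
qed

text \<open>The degrees sum to \<open>3 * card K\<close>, counting edges inside \<open>K\<close>
  twice, and the lower bound on incident edges does the rest. Sets of nodes thus induce
  forests.\<close>

lemma nodes_ind_le: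
  assumes K: "K \<subseteq> Y" "K \<noteq> {}" "\<And>x. x \<in> K \<Longrightarrow> node x"
  shows "card (ind E K) + 1 \<le> card K"
proof -
  have fin: "finite K" using K finite_subY by blast
  have "(\<Sum>x\<in>K. card (nb E x)) = (\<Sum>x\<in>K. 3)" using K by (intro sum.cong) (auto simp: node_def)
  then have "card (inc E K) + card (ind E K) = 3 * card K" using sum_degrees_inc_ind[OF E fin] by simp
  then show ?thesis using inc_ge[OF K(1,2)] by simp
qed

text \<open>\<open>K\<close> is connected and by \<open>nodes_ind_le\<close> a tree; the handshake
  sum shows that not all vertices besides \<open>c\<close> can have two neighbours in it.\<close>

lemma dt_nodes_leaf:
  assumes K: "dt K" "\<And>x. x \<in> K \<Longrightarrow> node x" and c: "c \<in> K" "K \<noteq> {c}"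
  obtains l where "l \<in> K" "l \<noteq> c" "card (nb E l \<inter> K) = 1"
proof (rule ccontr)
  assume no: "\<not> thesis"
  note leaf = that
  have fin: "finite K" using dtD(4)[OF K(1)] .
  have ge1: "1 \<le> card (nb E x \<inter> K)" if x: "x \<in> K" for x
  proof -
    have "K - {x} \<noteq> {}" using c x by blast
    then obtain y where "y \<in> K - {x}" "{x, y} \<in> E" using dt_connected[OF K(1), of "{x}"] x by auto
    then have "y \<in> nb E x \<inter> K" by (simp add: nb_def)
    then show ?thesis using finite_nb[OF E, of x] by (auto simp: Suc_le_eq card_gt_0_iff)
  qed
  have "card (nb E x \<inter> K) \<noteq> 1" if "x \<in> K" "x \<noteq> c" for x using no leaf that by metis
  then have ge2: "2 \<le> card (nb E x \<inter> K)" if "x \<in> K - {c}" for x using ge1[of x] that by force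
  have "(\<Sum>x\<in>K - {c}. 2) \<le> (\<Sum>x\<in>K - {c}. card (nb E x \<inter> K))" by (rule sum_mono) (rule ge2)
  moreover have "(\<Sum>x\<in>K. card (nb E x \<inter> K)) = card (nb E c \<inter> K) + (\<Sum>x\<in>K - {c}. card (nb E x \<inter> K))"
    using fin c by (intro sum.remove) auto
  moreover have "card K = Suc (card (K - {c}))" using card_Suc_Diff1[OF fin c(1)] by simp
  ultimately have "2 * card K - 1 \<le> 2 * card (ind E K)" using sum_degrees_ind[OF E fin] ge1[OF c(1)] by simp
  then show False using nodes_ind_le[OF dtD(1)[OF K(1)] dtD(2)[OF K(1)] K(2)] \<open>card K = _\<close> by simp
qed

text \<open>Irreducibility turns the absence of both kinds of blocker into a forced edge; reductions
  at nodes are used mostly in this form from here on.\<close>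

lemma node_option:
  assumes v: "node v" "nb E v = {a, b, c}" and d: "a \<noteq> b" "a \<noteq> c" "b \<noteq> c" and aY: "a \<in> Y"
    and h1: "\<And>S. dt S \<Longrightarrow> v \<in> S \<Longrightarrow> c \<in> S \<Longrightarrow> a \<notin> S \<Longrightarrow> b \<notin> S \<Longrightarrow> False"
    and h2: "\<And>Z. Z \<subseteq> Y \<Longrightarrow> a \<in> Z \<Longrightarrow> b \<in> Z \<Longrightarrow> v \<notin> Z \<Longrightarrow> tight E Z \<Longrightarrow> False"
    and h3: "c \<in> Y \<or> (\<exists>y\<in>Y - {v}. {y, c} \<in> E)"
  shows "{a, b} \<in> E"
proof (rule ccontr)
  assume ab: "{a, b} \<notin> E"
  have "reducible E"
  proof (rule ear_node_reduction'[OF ear _ v(2) d ab aY _ _ h3])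
    show "v \<in> Y" using v by (simp add: node_def)
    show "card (inc E S) \<noteq> 2 * card S + 1" if "S \<subseteq> Y" "v \<in> S" "c \<in> S" "a \<notin> S" "b \<notin> S" for S
      using h1[of S] that by (auto simp: dt_def)
    show "\<not> tight E Z" if "Z \<subseteq> Y" "a \<in> Z" "b \<in> Z" "v \<notin> Z" for Z using h2 that by blast
  qed
  then show False using irreducible by simp
qed

end

section \<open>A minimal dually tight set containing a vertex of degree at least four\<close>

locale minimal_core = irreducible_ear +
  fixes U
  assumes U: "dt U" and nonnode: "\<exists>x\<in>U. \<not> node x"
    and minimal: "\<And>S x. dt S \<Longrightarrow> S \<subset> U \<Longrightarrow> x \<in> S \<Longrightarrow> node x"
begin

lemma UY: "U \<subseteq> Y"
  using dtD[OF U] by simp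

lemma finU: "finite U"
  using dtD[OF U] by simp

definition trivial :: "'a \<Rightarrow> bool" where
  "trivial v \<longleftrightarrow> v \<in> U \<and> (\<forall>Z. Z \<subseteq> U \<longrightarrow> tight E Z \<longrightarrow> v \<in> Z \<longrightarrow> Z = {v})"

lemma trivialD: "trivial v \<Longrightarrow> Z \<subseteq> U \<Longrightarrow> tight E Z \<Longrightarrow> v \<in> Z \<Longrightarrow> Z = {v}"
  by (auto simp: trivial_def)

text \<open>Intersecting with \<open>U\<close> keeps dual tightness and the vertex \<open>x\<close>,
  so by minimality the intersection is all of \<open>U\<close>.\<close>

lemma dt_nonnode_superset:
  assumes S: "dt S" and x: "x \<in> S" "x \<in> U" "\<not> node x" shows "U \<subseteq> S"
proof -
  have "dt (S \<inter> U)" using dt_Un_Int(2)[OF S U] x by blast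
  then show ?thesis using minimal[of "S \<inter> U" x] x by blast
qed

lemma dt_nonnode_eq: "dt S \<Longrightarrow> S \<subseteq> U \<Longrightarrow> x \<in> S \<Longrightarrow> \<not> node x \<Longrightarrow> S = U"
  using dt_nonnode_superset by blast

text \<open>A dually tight blocker contains \<open>c\<close>, hence all of \<open>U\<close>, hence
  \<open>a\<close>. A tight blocker \<open>Z\<close> leaving \<open>U\<close> would make
  \<open>U - Z\<close> dually tight, a proper subset of \<open>U\<close> still containing
  \<open>c\<close>. Only tight blockers inside \<open>U\<close> remain.\<close>

lemma available:
  assumes v: "node v" "v \<in> U" "nb E v = {a, b, c}" and d: "a \<noteq> b" "a \<noteq> c" "b \<noteq> c"
    and c: "c \<in> U" "\<not> node c" and a: "a \<in> U"
  shows "{a, b} \<in> E \<or> (\<exists>Z. Z \<subseteq> U \<and> tight E Z \<and> a \<in> Z \<and> b \<in> Z \<and> v \<notin> Z)"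
proof (rule ccontr)
  assume no: "\<not> ?thesis"
  have "{a, b} \<in> E"
  proof (rule node_option[OF v(1,3) d])
    show "a \<in> Y" using a UY by blast
    show False if "dt S" "v \<in> S" "c \<in> S" "a \<notin> S" "b \<notin> S" for S
      using dt_nonnode_superset[OF that(1,3) c] a that by blast
    show False if Z: "Z \<subseteq> Y" "a \<in> Z" "b \<in> Z" "v \<notin> Z" "tight E Z" for Z
    proof (cases "Z \<subseteq> U")
      case True then show False using no Z by blast
    next
      case False
      have vYZ: "v \<in> Y - Z" using Z(4) v(2) UY by blast
      have "c \<notin> Z" using tight_not_all_nbs[OF Z(5,1) vYZ] Z(2,3) v(3) by auto
      moreover have "U - Z \<noteq> {}" "Z - U \<noteq> {}" using False v(2) Z(4) by auto
      then have "dt (U - Z)" using dt_Diff_tight[OF U Z(5,1)] by simp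
      moreover have "U - Z \<subset> U" using a Z(2) by blast
      ultimately show False using minimal[of "U - Z" c] c by simp
    qed
    show "c \<in> Y \<or> (\<exists>y\<in>Y - {v}. {y, c} \<in> E)" using c UY by blast
  qed
  then show False using no by blast
qed

text \<open>With two neighbours of \<open>v\<close> the tight set could absorb \<open>v\<close>,
  against triviality.\<close>

lemma trivial_two_nbs:
  assumes v: "trivial v" and Z: "tight E Z" "Z \<subseteq> U" "v \<notin> Z" and ab: "a \<in> nb E v \<inter> Z" "b \<in> nb E v \<inter> Z"
  shows "a = b"
proof (rule ccontr)
  assume "a \<noteq> b"
  have "v \<in> U" using v by (simp add: trivial_def)
  then have "tight E (insert v Z)" using tight_two_nbs[OF Z(1) _ _ ab \<open>a \<noteq> b\<close>] Z UY by blast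
  then have "insert v Z = {v}" using trivialD[OF v] Z \<open>v \<in> U\<close> by blast
  then show False using ab Z by blast
qed

lemma available_trivial:
  assumes v: "node v" "trivial v" "nb E v = {a, b, c}" and d: "a \<noteq> b" "a \<noteq> c" "b \<noteq> c"
    and c: "c \<in> U" "\<not> node c" and a: "a \<in> U"
  shows "{a, b} \<in> E"
proof -
  have "v \<in> U" using v by (simp add: trivial_def)
  then show ?thesis using available[OF v(1) _ v(3) d c a] trivial_two_nbs[OF v(2), of _ a b] v(3) d by blast
qed

text \<open>Adding an adjacent node preserves dual tightness, so a maximal such set is closed under
  node neighbours in \<open>P\<close>.\<close>

lemma maximal_node_set:
  assumes "node c" "c \<in> P" "P \<subseteq> U"
  obtains K where "dt K" "K \<subseteq> P" "c \<in> K" "\<And>x. x \<in> K \<Longrightarrow> node x"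
    "\<And>x y. x \<in> K \<Longrightarrow> y \<in> P \<Longrightarrow> node y \<Longrightarrow> {x, y} \<in> E \<Longrightarrow> y \<in> K"
proof -
  let ?S = "{K. dt K \<and> K \<subseteq> P \<and> c \<in> K \<and> (\<forall>x\<in>K. node x)}"
  have "c \<in> Y" using assms UY by blast
  have "finite P" using assms finU finite_subset by blast
  then have "finite ?S" by (intro finite_subset[of ?S "Pow P"]) auto
  moreover have "{c} \<in> ?S" using assms node_iff_dt[OF \<open>c \<in> Y\<close>] by auto
  ultimately obtain K where K: "K \<in> ?S" "\<forall>Z\<in>?S. K \<subseteq> Z \<longrightarrow> K = Z" by (rule finite_maximal_set)
  have "y \<in> K" if xy: "x \<in> K" "y \<in> P" "node y" "{x, y} \<in> E" for x y
  proof (rule ccontr)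
    assume y: "y \<notin> K"
    have "dt (insert y K)" using dt_insert_node[OF _ xy(3) y xy(1,4)] K(1) by blast
    then have "insert y K \<in> ?S" using K(1) xy(2,3) by simp
    then have "K = insert y K" by (rule K(2)[rule_format]) blast
    then show False using y by blast
  qed
  then show ?thesis using that[of K] K(1) by blast
qed

text \<open>Otherwise \<open>c\<close> lies in a larger tight set \<open>P \<subseteq> U\<close>.
  The tree \<open>K\<close> of nodes of \<open>P\<close> around \<open>c\<close> is joined to the
  outside of \<open>P\<close> by \<open>vc\<close> alone, and the edges forced at \<open>c\<close>
  or at another leaf of \<open>K\<close> are contradictory.\<close>

lemma trivial_node_nbr:
  assumes v: "node v" "trivial v" and c: "node c" "c \<in> U" "{v, c} \<in> E"
  shows "trivial c"
proof (rule ccontr)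
  assume "\<not> trivial c"
  then obtain P where P: "P \<subseteq> U" "tight E P" "c \<in> P" "P \<noteq> {c}" using c by (auto simp: trivial_def)
  have vU: "v \<in> U" using v by (simp add: trivial_def)
  have vc: "v \<noteq> c" "c \<in> nb E v" "v \<in> nb E c"
    using c(3) nb_irrefl[OF E, of v] by (auto simp: nb_def insert_commute)
  have vP: "v \<notin> P" using trivialD[OF v(2) P(1,2)] P(3) vc by blast
  have PY: "P \<subseteq> Y" using P UY by blast
  have finP: "finite P" using tight_finite[OF P(2)] by simp
  obtain K where K: "dt K" "K \<subseteq> P" "c \<in> K" "\<And>x. x \<in> K \<Longrightarrow> node x"
    "\<And>x y. x \<in> K \<Longrightarrow> y \<in> P \<Longrightarrow> node y \<Longrightarrow> {x, y} \<in> E \<Longrightarrow> y \<in> K"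
    using maximal_node_set[OF c(1) P(3,1)] by blast
  have "card P \<ge> 2"
  proof -
    obtain x where "x \<in> P" "x \<noteq> c" using P by blast
    then have "card {x, c} \<le> card P" using P finP by (intro card_mono) auto
    then show ?thesis using \<open>x \<noteq> c\<close> by simp
  qed
  \<comment> \<open>A set that is both tight and dually tight has exactly three leaving
    edges.\<close>
  have "K \<noteq> P"
  proof
    assume "K = P"
    then show False using dtD(3)[OF K(1)] P(2) no_3_cut[OF PY \<open>card P \<ge> 2\<close>] by (simp add: tight_def)
  qed
  then have PK: "P - K \<noteq> {}" using K by blast
  \<comment> \<open>\<open>P\<close> is tight and \<open>P - K\<close> sparse, so at least
    \<open>2 * card K\<close> of the \<open>2 * card K + 1\<close> edges at \<open>K\<close> lie
    inside \<open>P\<close>; the one remaining is \<open>vc\<close>.\<close>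
  have only: "e \<subseteq> P" if e: "e \<in> inc E K" "e \<noteq> {v, c}" for e
  proof (rule ccontr)
    assume "\<not> e \<subseteq> P"
    let ?I = "ind E P - ind E (P - K)"
    have "card (ind E (P - K)) + 2 \<le> 2 * card (P - K)" using PK PY by (intro ind_le) auto
    moreover have "card ?I = card (ind E P) - card (ind E (P - K))"
      using finE by (intro card_Diff_subset) (auto simp: ind_def)
    moreover have "card P = card (P - K) + card K"
      using card_Diff_subset[OF dtD(4)[OF K(1)] K(2)] card_mono[OF finP K(2)] by simp
    moreover have "card (ind E P) + 2 = 2 * card P" using P(2) by (simp add: tight_def)
    ultimately have "2 * card K \<le> card ?I" by linarith
    moreover have "{v, c} \<in> inc E K" using c K by (auto simp: inc_def)
    then have "card (?I \<union> {e, {v, c}}) \<le> card (inc E K)"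
      using finE e by (intro card_mono) (auto simp: ind_def inc_def)
    moreover have "card (?I \<union> {e, {v, c}}) = card ?I + card {e, {v, c}}"
      using finE \<open>\<not> e \<subseteq> P\<close> vP by (intro card_Un_disjoint) (auto simp: ind_def)
    ultimately show False using dtD(3)[OF K(1)] e by simp
  qed
  have inP: "y \<in> P" if "x \<in> K" "{x, y} \<in> E" "{x, y} \<noteq> {v, c}" for x y
    using only[of "{x, y}"] that by (auto simp: inc_def)
  show False
  proof (cases "K = {c}")
    case True
    obtain q1 q2 where q: "nb E c = {v, q1, q2}" "v \<noteq> q1" "v \<noteq> q2" "q1 \<noteq> q2"
      using nodeE[OF c(1) vc(3)] .
    have cq: "{c, q1} \<in> E" "{c, q2} \<in> E" using q by (auto simp: nb_def)
    then have qP: "q1 \<in> P" "q2 \<in> P" using inP[of c] K(3) q by (auto simp: doubleton_eq_iff)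
    have "q1 \<noteq> c" "q2 \<noteq> c" using nb_irrefl[OF E, of c] q by auto
    then have "\<not> node q1" "\<not> node q2" using K(5)[of c] K(3) True cq qP by auto
    moreover have "nb E c = {v, q2, q1}" using q by auto
    ultimately have "{v, q2} \<in> E \<or> (\<exists>Z. Z \<subseteq> U \<and> tight E Z \<and> v \<in> Z \<and> q2 \<in> Z \<and> c \<notin> Z)"
      using available[OF c(1,2), of v q2 q1] q qP P vU by blast
    then have "{v, q2} \<in> E" using trivialD[OF v(2)] q by blast
    then show False using trivial_two_nbs[OF v(2) P(2,1) vP, of c q2] vc P(3) qP \<open>q2 \<noteq> c\<close> by (auto simp: nb_def)
  next
    case False
    obtain l where l: "l \<in> K" "l \<noteq> c" "card (nb E l \<inter> K) = 1"
      using dt_nodes_leaf[OF K(1,4,3) False] by blast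
    obtain t where t: "nb E l \<inter> K = {t}" using l(3) by (rule card_1_singletonE)
    have nl: "node l" using K l by blast
    have lP: "l \<in> P" and tP: "t \<in> P" and tK: "t \<in> K" and tl: "t \<in> nb E l" using l K t by auto
    obtain y1 y2 where y: "nb E l = {t, y1, y2}" "t \<noteq> y1" "t \<noteq> y2" "y1 \<noteq> y2" using nodeE[OF nl tl] .
    have "{l, x} \<noteq> {v, c}" if "x \<in> nb E l" for x using l vP lP by (auto simp: doubleton_eq_iff)
    then have yP: "y1 \<in> P" "y2 \<in> P" using inP[OF l(1)] y by (auto simp: nb_def)
    have yK: "y1 \<notin> K" "y2 \<notin> K" using t y by auto
    then have yn: "\<not> node y1" "\<not> node y2" using K(5)[OF l(1)] yP y by (auto simp: nb_def)
    have y': "nb E l = {t, y2, y1}" using y by auto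
    have lY: "l \<in> Y" using lP PY by blast
    have o1: "{t, y2} \<in> E \<or> (\<exists>Z. Z \<subseteq> U \<and> tight E Z \<and> t \<in> Z \<and> y2 \<in> Z \<and> l \<notin> Z)"
      using available[OF nl _ y'] y yn yP P lP tP by blast
    have o2: "{t, y1} \<in> E \<or> (\<exists>Z. Z \<subseteq> U \<and> tight E Z \<and> t \<in> Z \<and> y1 \<in> Z \<and> l \<notin> Z)"
      using available[OF nl _ y(1)] y yn yP P lP tP by blast
    have nt: "node t" using K tK by blast
    have lt: "l \<in> nb E t" using tl nb_sym[of t E l] by simp
    \<comment> \<open>\<open>y\<close> is outside \<open>Z\<close>, since \<open>Z\<close> cannot
      contain all neighbours of \<open>l\<close>. So two of the three neighbours of \<open>t\<close>
      are outside \<open>Z\<close>, which leaves too few inside a tight set.\<close>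
    have aux: False if "{t, y} \<in> E" and Z: "Z \<subseteq> U" "tight E Z" "t \<in> Z" "y' \<in> Z" "l \<notin> Z"
      and yy: "nb E l = {t, y, y'}" "t \<noteq> y" "t \<noteq> y'" "y \<noteq> y'" for y y' Z
    proof -
      have ZY: "Z \<subseteq> Y" using Z(1) UY by blast
      have "y \<notin> Z" using tight_not_all_nbs[OF Z(2) ZY, of l] lY Z(3-5) yy(1) by auto
      have "2 \<le> card (nb E t \<inter> Z)" using tight_degree[OF Z(2) ZY Z(3)] Z(4) yy(3) by blast
      moreover have "nb E t \<inter> Z \<subseteq> nb E t - {l, y}" using Z(5) \<open>y \<notin> Z\<close> by blast
      then have "card (nb E t \<inter> Z) \<le> card (nb E t - {l, y})" using finite_nb[OF E] by (intro card_mono) auto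
      moreover have "l \<noteq> y" using nb_irrefl[OF E, of l] yy by auto
      then have "card (nb E t - {l, y}) = 1"
        using nt lt \<open>{t, y} \<in> E\<close> finite_nb[OF E] by (subst card_Diff_subset) (auto simp: node_def nb_def)
      ultimately show False by simp
    qed
    have "{t, y1} \<in> E \<and> {t, y2} \<in> E"
    proof (rule ccontr)
      assume no: "\<not> ?thesis"
      consider "{t, y1} \<in> E" "{t, y2} \<notin> E" | "{t, y1} \<notin> E" "{t, y2} \<in> E" | "{t, y1} \<notin> E" "{t, y2} \<notin> E"
        using no by blast
      then show False
      proof cases
        case 1 then show False using aux[of y1 _ y2] o1 y by blast
      next
        case 2 then show False using aux[of y2 _ y1] o2 y y' by blast
      next
        case 3
        then obtain Z1 Z2 where Z1: "Z1 \<subseteq> U" "tight E Z1" "t \<in> Z1" "y2 \<in> Z1" "l \<notin> Z1"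
          and Z2: "Z2 \<subseteq> U" "tight E Z2" "t \<in> Z2" "y1 \<in> Z2" "l \<notin> Z2" using o1 o2 by blast
        have "tight E (Z1 \<union> Z2)" using tight_Un_Y[OF Z1(2) Z2(2)] Z1 Z2 UY by blast
        moreover have "nb E l \<subseteq> Z1 \<union> Z2" using Z1(3,4) Z2(4) y(1) by simp
        moreover have "Z1 \<union> Z2 \<subseteq> Y" "l \<in> Y - (Z1 \<union> Z2)" using Z1(1,5) Z2(1,5) UY lY by auto
        ultimately show False using tight_not_all_nbs[of "Z1 \<union> Z2" l] by blast
      qed
    qed
    moreover have ly: "l \<noteq> y1" "l \<noteq> y2" using nb_irrefl[OF E, of l] y by auto
    ultimately have nbt: "nb E t = {l, y1, y2}"
      using node_nb_eq[OF nt, of l y1 y2] lt y by (auto simp: nb_def)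
    \<comment> \<open>\<open>t\<close> has no neighbour in \<open>K\<close> besides
      \<open>l\<close>, so the connected \<open>K\<close> would be \<open>{l, t}\<close> with
      \<open>t = c\<close>; but the neighbour \<open>v\<close> of \<open>c\<close> is outside
      \<open>P\<close>.\<close>
    show False
    proof (cases "t = c")
      case True
      then show False using nbt vc(3) lP yP vP by auto
    next
      case tc: False
      have "{l, t} \<noteq> {}" "{l, t} \<subseteq> K" "K - {l, t} \<noteq> {}" using l tK K(3) tc by auto
      then obtain x z where "x \<in> {l, t}" "z \<in> K - {l, t}" "{x, z} \<in> E" using dt_connected[OF K(1)] by metis
      then show False using nbt y yK by (auto simp: nb_def)
    qed
  qed
qed

section \<open>Classification of the trivial nodes\<close>

definition diamond :: "'a \<Rightarrow> 'a \<Rightarrow> 'a \<Rightarrow> 'a \<Rightarrow> bool" where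
  "diamond u t y1 y2 \<longleftrightarrow> node u \<and> node t \<and> trivial u \<and> trivial t \<and> nb E u = {t, y1, y2} \<and> nb E t = {u, y1, y2} \<and>
     t \<noteq> y1 \<and> t \<noteq> y2 \<and> u \<noteq> y1 \<and> u \<noteq> y2 \<and> y1 \<noteq> y2 \<and> y1 \<in> U \<and> \<not> node y1 \<and> y2 \<notin> U \<and> {y1, y2} \<in> E"

text \<open>The final implication is used in contraposition: if \<open>w\<close> and
  \<open>w'\<close> are not adjacent, then \<open>z\<close> lies in \<open>Y\<close> and may be put
  into tight sets.\<close>

definition fan :: "'a \<Rightarrow> 'a \<Rightarrow> 'a \<Rightarrow> 'a \<Rightarrow> bool" where
  "fan u w w' z \<longleftrightarrow> nb E u = {w, w', z} \<and> w \<noteq> w' \<and> w \<in> U \<and> w' \<in> U \<and> \<not> node w \<and> \<not> node w' \<and> z \<notin> U \<and>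
     {w, z} \<in> E \<and> {w', z} \<in> E \<and> (z \<notin> Y \<longrightarrow> {w, w'} \<in> E)"

lemma K4_tight:
  assumes "{x, a} \<in> E" "{x, b} \<in> E" "{x, c} \<in> E" "{a, b} \<in> E" "{a, c} \<in> E" "{b, c} \<in> E"
    and d: "x \<noteq> a" "x \<noteq> b" "x \<noteq> c" "a \<noteq> b" "a \<noteq> c" "b \<noteq> c" and sub: "{x, a, b, c} \<subseteq> Y"
  shows "tight E {x, a, b, c}"
proof -
  have "distinct [{x, a}, {x, b}, {x, c}, {a, b}, {a, c}, {b, c}]" using d by (auto simp: doubleton_eq_iff)
  then have "card {{x, a}, {x, b}, {x, c}, {a, b}, {a, c}, {b, c}} = 6" using distinct_card by fastforce
  moreover have "card {{x, a}, {x, b}, {x, c}, {a, b}, {a, c}, {b, c}} \<le> card (ind E {x, a, b, c})"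
    using assms finE by (intro card_mono) (auto simp: ind_def)
  moreover have "card (ind E {x, a, b, c}) + 2 \<le> 2 * card {x, a, b, c}" using ind_le[OF sub] by simp
  moreover have "card {x, a, b, c} = 4" using d by simp
  ultimately show ?thesis by (simp add: tight_def)
qed

lemma diamond_sym: "diamond u t y1 y2 \<Longrightarrow> diamond t u y1 y2"
  by (auto simp: diamond_def)

text \<open>Some \<open>x\<close> in the tree \<open>T\<close> of nodes around \<open>u\<close> has
  a neighbour \<open>y \<in> U\<close> that is not a node. Forced edges make \<open>x\<close> and a
  neighbour \<open>s \<in> T\<close> share \<open>y\<close> and a third vertex \<open>r\<close>. If
  \<open>yr\<close> were missing, a \<open>K4_minus_reduction\<close> would apply; a complete graph
  inside \<open>U\<close> would be tight, so \<open>r\<close> is outside \<open>U\<close>.\<close>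

lemma trivial_node_with_node_nbr:
  assumes u: "node u" "trivial u" and t: "node t" "t \<in> U" "{u, t} \<in> E"
  shows "\<exists>t y1 y2. diamond u t y1 y2"
proof -
  have uU: "u \<in> U" using u by (simp add: trivial_def)
  obtain T where T: "dt T" "T \<subseteq> U" "u \<in> T" "\<And>x. x \<in> T \<Longrightarrow> node x"
    "\<And>x y. x \<in> T \<Longrightarrow> y \<in> U \<Longrightarrow> node y \<Longrightarrow> {x, y} \<in> E \<Longrightarrow> y \<in> T"
    using maximal_node_set[OF u(1) uU order_refl] by blast
  have tT: "t \<in> T" using T(5)[OF T(3) t(2,1,3)] .
  have ut: "u \<noteq> t" using t(3) nb_irrefl[OF E, of u] by (auto simp: nb_def)
  have triv: "trivial x" if "x \<in> T" for x
  proof (rule ccontr)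
    assume "\<not> trivial x"
    let ?T = "{x \<in> T. trivial x}"
    have "?T \<noteq> {}" "T - ?T \<noteq> {}" using u T(3) that \<open>\<not> trivial x\<close> by auto
    then obtain a b where "a \<in> ?T" "b \<in> T - ?T" "{a, b} \<in> E"
      using dt_connected[OF T(1), of ?T] by blast
    then show False using trivial_node_nbr[of a b] T by blast
  qed
  have "U - T \<noteq> {}" using nonnode T(4) by blast
  then obtain x y where xy: "x \<in> T" "y \<in> U - T" "{x, y} \<in> E"
    using dt_connected[OF U T(2) _ ] T(3) by blast
  have nx: "node x" "trivial x" using T triv xy by auto
  have yn: "\<not> node y" using T(5) xy by blast
  have "T - {x} \<noteq> {}" using tT T(3) ut by blast
  then obtain s where s: "s \<in> T - {x}" "{x, s} \<in> E" using dt_connected[OF T(1), of "{x}"] xy(1) by auto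
  have ns: "node s" "trivial s" using s T triv by auto
  have ynb: "y \<in> nb E x" "s \<in> nb E x" "y \<noteq> s" using xy s by (auto simp: nb_def)
  obtain r where r: "nb E x = {y, s, r}" "y \<noteq> r" "s \<noteq> r" using nodeE2[OF nx(1) ynb] .
  have xx: "x \<noteq> y" "x \<noteq> s" "x \<noteq> r" using nb_irrefl[OF E, of x] r by auto
  have r': "nb E x = {s, r, y}" using r by auto
  have sr: "{s, r} \<in> E" using available_trivial[OF nx r'] ynb r s xy yn T(2) by blast
  have xs: "x \<in> nb E s" "r \<in> nb E s" using s sr by (auto simp: nb_def insert_commute)
  have xr: "{x, r} \<in> E" using r by (auto simp: nb_def)
  have dxs: "dt {x, s}" using adjacent_nodes_dt[OF nx(1) ns(1) s(2)] .
  \<comment> \<open>A triangle of nodes would meet only six edges, one less than required.\<close>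
  have rT: "r \<notin> T"
  proof
    assume rT: "r \<in> T"
    have "card (inc E {r, s, x}) = card (inc E {x, s}) + card (nb E r - {x, s})"
      using card_inc_insert[OF E, of r "{x, s}"] xx r by (simp add: insert_commute)
    moreover have "card (nb E r - {x, s}) = card (nb E r) - card {x, s}"
      using sr xr by (intro card_Diff_subset) (auto simp: nb_def insert_commute)
    moreover have "card (nb E r) = 3" using rT T(4) by (auto simp: node_def)
    moreover have "2 * card {r, s, x} + 1 \<le> card (inc E {r, s, x})"
      using rT s xy dtD(1)[OF T(1)] by (intro inc_ge) auto
    ultimately show False using dtD(3)[OF dxs] xx r by simp
  qed
  have rU: "r \<notin> U \<and> {s, y} \<in> E"
  proof (cases "r \<in> U")
    case True
    then have rn: "\<not> node r" using T(5)[OF xy(1) _ _ xr] rT by blast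
    have r'': "nb E x = {s, y, r}" using r by auto
    have sy: "{s, y} \<in> E" using available_trivial[OF nx r''] ynb r s xy True rn T(2) by blast
    have nbs: "nb E s = {x, y, r}"
      using node_nb_eq[OF ns(1), of x y r] xs sy xx r by (auto simp: nb_def)
    have "{y, r} \<notin> E"
    proof
      assume "{y, r} \<in> E"
      then have "tight E {x, s, y, r}" using K4_tight[of x s y r] s xy xr sr sy xx r ynb True UY T(2) by blast
      then show False using trivialD[OF nx(2), of "{x, s, y, r}"] xx s xy True T(2) by blast
    qed
    then have "reducible E"
      using ear_K4_minus_reduction[OF ear, of x s y r] nx ns xy s r'' nbs ynb r xx UY T(2) by blast
    then show ?thesis using irreducible by simp
  next
    case False
    have r'': "nb E x = {s, y, r}" using r by auto
    \<comment> \<open>As \<open>r\<close> is outside \<open>U\<close>, both blockers are excluded by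
      hand: a dually tight one would cross the dually tight \<open>{x, s}\<close> along the edge
      \<open>rs\<close>, and a tight one would contain at most one neighbour of
      \<open>s\<close>.\<close>
    have "{s, y} \<in> E"
    proof (rule node_option[OF nx(1) r''])
      show "s \<noteq> y" "s \<noteq> r" "y \<noteq> r" using ynb r by auto
      show "s \<in> Y" using s T(2) UY by blast
      show False if S: "dt S" "x \<in> S" "r \<in> S" "s \<notin> S" "y \<notin> S" for S
        using dt_cross_no_edge[OF S(1) dxs, of r s] S xx r sr by (auto simp: insert_commute)
      show False if Z: "Z \<subseteq> Y" "s \<in> Z" "y \<in> Z" "x \<notin> Z" "tight E Z" for Z
      proof -
        have xYZ: "x \<in> Y - Z" using Z nx by (auto simp: node_def)
        have "r \<notin> Z" using tight_not_all_nbs[OF Z(5,1) xYZ] Z(2,3) r(1) by auto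
        then have "nb E s \<inter> Z \<subseteq> nb E s - {x, r}" using Z by blast
        then have "card (nb E s \<inter> Z) \<le> card (nb E s - {x, r})" using finite_nb[OF E] by (intro card_mono) auto
        also have "card (nb E s - {x, r}) = 1"
          using ns xs xx by (subst card_Diff_subset) (auto simp: node_def)
        finally show False using tight_degree[OF Z(5,1,2)] Z ynb by force
      qed
      show "r \<in> Y \<or> (\<exists>y\<in>Y - {x}. {y, r} \<in> E)" using sr s T(2) UY by blast
    qed
    then show ?thesis using False by simp
  qed
  have nbs: "nb E s = {x, y, r}"
    using node_nb_eq[OF ns(1), of x y r] xs rU xx r by (auto simp: nb_def)
  have r'': "nb E x = {s, y, r}" using r by auto
  have yr: "{y, r} \<in> E"
  proof (rule ccontr)
    assume "{y, r} \<notin> E"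
    then have "reducible E"
      using ear_K4_minus_reduction[OF ear, of x s y r] nx ns xy s r'' nbs ynb r xx UY T(2) by blast
    then show False using irreducible by simp
  qed
  have D: "diamond x s y r"
    using nx ns r'' nbs ynb r xx xy yn rU yr by (auto simp: diamond_def)
  have "T = {x, s}"
  proof (rule ccontr)
    assume "T \<noteq> {x, s}"
    then have "T - {x, s} \<noteq> {}" "{x, s} \<subseteq> T" using xy s by auto
    then obtain p q where pq: "p \<in> {x, s}" "q \<in> T - {x, s}" "{p, q} \<in> E" using dt_connected[OF T(1), of "{x, s}"] by blast
    then have "q \<in> {y, r}" using r'' nbs by (auto simp: nb_def)
    then show False using pq xy rT by blast
  qed
  then have "u = x \<or> u = s" using T(3) by blast
  then show ?thesis using D diamond_sym[OF D] by blast
qed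

text \<open>Without a node neighbour in \<open>U\<close>, two neighbours of \<open>u\<close> in
  \<open>U\<close> force edges from both to the third neighbour \<open>z\<close>. If
  \<open>z\<close> were in \<open>U\<close>, the third edge would be forced too and the resulting
  complete graph would be a tight set containing \<open>u\<close>.\<close>

lemma trivial_node_cases:
  assumes u: "node u" "trivial u"
  obtains (diamond) t y1 y2 where "diamond u t y1 y2"
    | (fan) w w' z where "fan u w w' z"
    | (pendant) w where "nb E u \<inter> U = {w}" "\<not> node w"
proof (cases "\<exists>t\<in>U. node t \<and> {u, t} \<in> E")
  case True
  then show ?thesis using trivial_node_with_node_nbr[OF u] diamond by blast
next
  case False
  have nn: "\<not> node x" if "x \<in> nb E u" "x \<in> U" for x using False that by (auto simp: nb_def)
  have uU: "u \<in> U" using u by (simp add: trivial_def)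
  have "U - {u} \<noteq> {}" using nonnode u by blast
  then obtain w where w: "w \<in> U - {u}" "{u, w} \<in> E" using dt_connected[OF U, of "{u}"] uU by auto
  have wn: "w \<in> nb E u" "\<not> node w" using w nn by (auto simp: nb_def)
  show ?thesis
  proof (cases "nb E u \<inter> U = {w}")
    case True then show ?thesis using pendant wn by blast
  next
    case ne: False
    then obtain w' where w': "w' \<in> nb E u" "w' \<in> U" "w' \<noteq> w" using w wn by blast
    obtain z where z: "nb E u = {w, w', z}" "w \<noteq> z" "w' \<noteq> z" using nodeE2[OF u(1) wn(1) w'(1)] w' by metis
    have uu: "u \<noteq> w" "u \<noteq> w'" "u \<noteq> z" using nb_irrefl[OF E, of u] z by auto
    have w'n: "\<not> node w'" using nn w' by blast
    have z1: "nb E u = {w', z, w}" "nb E u = {w, z, w'}" using z by auto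
    have e1: "{w', z} \<in> E" using available_trivial[OF u z1(1)] z w w' wn by blast
    have e2: "{w, z} \<in> E" using available_trivial[OF u z1(2)] z w w' w'n by blast
    have ue: "{u, w} \<in> E" "{u, w'} \<in> E" "{u, z} \<in> E" using z by (auto simp: nb_def)
    have zU: "z \<notin> U"
    proof
      assume zU: "z \<in> U"
      then have "\<not> node z" using nn z by blast
      then have e3: "{w, w'} \<in> E" using available_trivial[OF u z(1)] z w w' zU by blast
      have "tight E {u, w, w', z}" using K4_tight[of u w w' z] ue e1 e2 e3 uu z w' w zU UY uU by blast
      then show False using trivialD[OF u(2), of "{u, w, w', z}"] uu uU w w' zU by blast
    qed
    have "{w, w'} \<in> E" if zY: "z \<notin> Y"
    proof (rule node_option[OF u(1) z(1)])
      show "w \<noteq> w'" "w \<noteq> z" "w' \<noteq> z" "w \<in> Y" using w' z w UY by auto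
      show False if "dt S" "u \<in> S" "z \<in> S" "w \<notin> S" "w' \<notin> S" for S using dtD(1)[OF that(1)] that zY by blast
      show "z \<in> Y \<or> (\<exists>y\<in>Y - {u}. {y, z} \<in> E)" using e2 uu w UY by blast
      \<comment> \<open>Subtracting the edges inside \<open>Z\<close> and \<open>wz\<close>,
        \<open>w'z\<close> from those at \<open>Y\<close> leaves at most
        \<open>2 * card ?R + 1\<close> edges at \<open>?R\<close>. As \<open>u\<close> has no
        neighbour in \<open>?R\<close>, this forces \<open>?R = {u}\<close> with equality
        throughout, and then \<open>z\<close> is the only attachment vertex of
        \<open>Y\<close>.\<close>
      show False if Z: "Z \<subseteq> Y" "w \<in> Z" "w' \<in> Z" "u \<notin> Z" "tight E Z" for Z
      proof -
        let ?R = "Y - Z" and ?F = "{{w, z}, {w', z}}"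
        have uR: "u \<in> ?R" using uU UY Z by blast
        have wz: "{w, z} \<noteq> {w', z}" using w' by (auto simp: doubleton_eq_iff)
        have cR: "card Y = card ?R + card Z"
          using card_Diff_subset[OF tight_finite(1)[OF Z(5)] Z(1)] card_mono[OF finY Z(1)] by simp
        have sub: "inc E ?R \<union> (ind E Z \<union> ?F) \<subseteq> inc E Y"
          using Z e1 e2 edge_set_nonempty[OF E] by (fastforce simp: inc_def ind_def)
        have cc: "card (inc E ?R \<union> (ind E Z \<union> ?F)) = card (inc E ?R) + card (ind E Z) + 2"
        proof -
          have "card (inc E ?R \<union> (ind E Z \<union> ?F)) = card (inc E ?R) + card (ind E Z \<union> ?F)"
            using finE Z zY by (intro card_Un_disjoint) (auto simp: inc_def ind_def)
          moreover have "card (ind E Z \<union> ?F) = card (ind E Z) + card ?F"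
            using finE Z zY by (intro card_Un_disjoint) (auto simp: inc_def ind_def)
          ultimately show ?thesis using wz by simp
        qed
        have "card (inc E ?R \<union> (ind E Z \<union> ?F)) \<le> card (inc E Y)" using sub finE by (intro card_mono) auto
        then have le: "card (inc E ?R) \<le> 2 * card ?R + 1" using cc inc_Y cR Z(5) by (simp add: tight_def)
        have "nb E u - (?R - {u}) = nb E u" using z Z zY by auto
        then have cu: "card (inc E ?R) = card (inc E (?R - {u})) + 3"
          using card_inc_insert[OF E, of u "?R - {u}"] uR u(1) by (simp add: node_def insert_absorb)
        have R: "?R = {u}"
        proof (rule ccontr)
          assume "?R \<noteq> {u}"
          then have "?R - {u} \<noteq> {}" using uR by blast
          then have "2 * card (?R - {u}) + 1 \<le> card (inc E (?R - {u}))" by (intro inc_ge) auto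
          moreover have "card ?R = Suc (card (?R - {u}))" using card_Suc_Diff1[OF _ uR] finY by simp
          ultimately show False using le cu by simp
        qed
        then have "card (inc E ?R) = 3" using u(1) card_inc_singleton[OF E, of u] by (simp add: node_def)
        then have "card (inc E Y) = card (inc E ?R \<union> (ind E Z \<union> ?F))" using cc inc_Y cR R Z(5) by (simp add: tight_def)
        then have eq: "inc E Y = inc E ?R \<union> (ind E Z \<union> ?F)" using card_subset_eq[OF _ sub] finE by simp
        have "e \<subseteq> insert z Y" if e: "e \<in> inc E Y" for e
        proof -
          have "e \<in> inc E {u} \<or> e \<in> ind E Z \<or> e \<in> ?F" using e eq R by auto
          moreover have "inc E {u} = {{u, w}, {u, w'}, {u, z}}" using inc_singleton_nb[OF E, of u] z by auto
          ultimately show ?thesis using Z uU w w' UY by (auto simp: ind_def)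
        qed
        then show False using earD(8)[OF ear, of z] by blast
      qed
    qed
    then have "fan u w w' z" using z w' w wn w'n zU e1 e2 by (auto simp: fan_def)
    then show ?thesis using fan by blast
  qed
qed


section \<open>Counting over the maximal tight subsets\<close>

abbreviation pt :: "'a \<Rightarrow> 'a set" where
  "pt \<equiv> part E U"

definition parts :: "'a set set" where
  "parts = pt ` U"

definition dd :: "'a set \<Rightarrow> nat" where
  "dd P = card {e \<in> inc E P. \<not> e \<subseteq> P}"

definition out :: "'a set \<Rightarrow> nat" where
  "out P = card {e \<in> inc E P. \<not> e \<subseteq> U}"

lemmas pt_tight = part_tight[OF E sparse_onY[OF UY] finU]
  and pt_self = part_self[OF E sparse_onY[OF UY] finU]
  and pt_subset = part_subset[OF E sparse_onY[OF UY] finU]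
  and pt_eq = part_eq[OF E sparse_onY[OF UY] finU]
  and pt_disjoint = part_disjoint[OF E sparse_onY[OF UY] finU]
  and tight_subset_pt = subset_part[OF E sparse_onY[OF UY] finU]

lemma finite_parts: "finite parts"
  using finU by (simp add: parts_def)

lemma partsD: "P \<in> parts \<Longrightarrow> tight E P" "P \<in> parts \<Longrightarrow> P \<subseteq> U" "P \<in> parts \<Longrightarrow> finite P" "P \<in> parts \<Longrightarrow> P \<subseteq> Y"
proof -
  assume "P \<in> parts"
  then obtain x where "x \<in> U" "P = pt x" by (auto simp: parts_def)
  then show "tight E P" "P \<subseteq> U" "finite P" "P \<subseteq> Y"
    using pt_tight pt_subset[of x] tight_finite UY by auto
qed

lemma parts_disjoint: "P \<in> parts \<Longrightarrow> Q \<in> parts \<Longrightarrow> P \<noteq> Q \<Longrightarrow> P \<inter> Q = {}"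
  using pt_disjoint by (auto simp: parts_def)

lemma parts_eq: "P \<in> parts \<Longrightarrow> x \<in> P \<Longrightarrow> P = pt x"
  using pt_eq by (auto simp: parts_def)

lemma pt_in_parts: "x \<in> U \<Longrightarrow> pt x \<in> parts"
  by (simp add: parts_def)

lemma Union_parts: "\<Union>parts = U"
  using pt_self pt_subset by (auto simp: parts_def)

lemma card_inc_part: "card (inc E P) = card (ind E P) + dd P"
proof -
  have "inc E P = ind E P \<union> {e \<in> inc E P. \<not> e \<subseteq> P}"
    using edge_set_nonempty[OF E] by (fastforce simp: inc_def ind_def)
  moreover have "card (ind E P \<union> {e \<in> inc E P. \<not> e \<subseteq> P}) = card (ind E P) + dd P"
    unfolding dd_def using finE by (intro card_Un_disjoint) (auto simp: ind_def inc_def)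
  ultimately show ?thesis by simp
qed

text \<open>An edge joining two parts counts twice in \<open>dd\<close>, an edge leaving
  \<open>U\<close> once in \<open>dd\<close> and once in \<open>out\<close>, so the second sum is
  twice the number of edges at \<open>U\<close> lying in no part. The parts induce
  \<open>2 * card U - 2 * card parts\<close> of the \<open>2 * card U + 1\<close> edges at
  \<open>U\<close>.\<close>

lemma out_sum: "(\<Sum>P\<in>parts. out P) = card {e \<in> inc E U. \<not> e \<subseteq> U}"
  and dd_out_sum: "(\<Sum>P\<in>parts. dd P + out P) = 4 * card parts + 2"
proof -
  let ?I = "\<Union>P\<in>parts. ind E P"
  let ?A = "{e \<in> inc E U. e \<subseteq> U} - ?I" and ?B = "{e \<in> inc E U. \<not> e \<subseteq> U}"
  have finAB: "finite ?A" "finite ?B" using finE by (auto simp: inc_def)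
  have A2: "card {P \<in> parts. e \<inter> P \<noteq> {}} = 2" if e: "e \<in> ?A" for e
  proof -
    have eE: "e \<in> E" "e \<subseteq> U" using e by (auto simp: inc_def)
    obtain a b where ab: "e = {a, b}" using edge_set_edgeE[OF E eE(1)] by metis
    then have abU: "a \<in> U" "b \<in> U" using eE by auto
    have "pt a \<noteq> pt b"
    proof
      assume "pt a = pt b"
      then have "e \<in> ind E (pt a)" using ab abU pt_self eE by (auto simp: ind_def)
      then show False using e abU pt_in_parts by blast
    qed
    moreover have "{P \<in> parts. e \<inter> P \<noteq> {}} = {pt a, pt b}"
    proof -
      have "e \<inter> P \<noteq> {} \<longleftrightarrow> a \<in> P \<or> b \<in> P" for P using ab by auto
      moreover have "a \<in> pt a" "b \<in> pt b" "pt a \<in> parts" "pt b \<in> parts"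
        using pt_self pt_in_parts abU by auto
      moreover have "P = pt a \<or> P = pt b" if "P \<in> parts" "a \<in> P \<or> b \<in> P" for P
        using parts_eq[OF that(1)] that(2) by blast
      ultimately show ?thesis by blast
    qed
    ultimately show ?thesis by simp
  qed
  have B1: "card {P \<in> parts. e \<inter> P \<noteq> {}} = 1" if e: "e \<in> ?B" for e
  proof -
    obtain a where a: "a \<in> e" "a \<in> U" "e \<in> E" using e by (auto simp: inc_def)
    then obtain b where ab: "e = {a, b}" using edge_set_edgeE'[OF E] by metis
    then have "b \<notin> U" using e a by (auto simp: inc_def)
    then have "e \<inter> P \<noteq> {} \<longleftrightarrow> a \<in> P" if "P \<in> parts" for P using ab partsD(2)[OF that] by auto
    moreover have "a \<in> pt a" "pt a \<in> parts" using pt_self pt_in_parts a(2) by auto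
    moreover have "P = pt a" if "P \<in> parts" "a \<in> P" for P using parts_eq[OF that] .
    ultimately have "{P \<in> parts. e \<inter> P \<noteq> {}} = {pt a}" by blast
    then show ?thesis by simp
  qed
  have sA: "(\<Sum>P\<in>parts. card {e \<in> ?A. e \<inter> P \<noteq> {}}) = 2 * card ?A"
    using sum_multicount_gen[OF finite_parts finAB(1), of "\<lambda>P e. e \<inter> P \<noteq> {}" "\<lambda>_. 2"] A2 by simp
  have sB: "(\<Sum>P\<in>parts. card {e \<in> ?B. e \<inter> P \<noteq> {}}) = card ?B"
    using sum_multicount_gen[OF finite_parts finAB(2), of "\<lambda>P e. e \<inter> P \<noteq> {}" "\<lambda>_. 1"] B1 by simp
  have o: "out P = card {e \<in> ?B. e \<inter> P \<noteq> {}}" if "P \<in> parts" for P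
  proof -
    have "{e \<in> inc E P. \<not> e \<subseteq> U} = {e \<in> ?B. e \<inter> P \<noteq> {}}" using partsD(2)[OF that] by (auto simp: inc_def)
    then show ?thesis by (simp add: out_def)
  qed
  have d: "dd P = card {e \<in> ?A. e \<inter> P \<noteq> {}} + card {e \<in> ?B. e \<inter> P \<noteq> {}}" if P: "P \<in> parts" for P
  proof -
    have "{e \<in> inc E P. \<not> e \<subseteq> P} = {e \<in> ?A. e \<inter> P \<noteq> {}} \<union> {e \<in> ?B. e \<inter> P \<noteq> {}}" (is "?l = ?r")
    proof
      show "?l \<subseteq> ?r"
      proof
        fix e assume e: "e \<in> ?l"
        then have eU: "e \<in> inc E U" "e \<inter> P \<noteq> {}" "\<not> e \<subseteq> P" using partsD(2)[OF P] by (auto simp: inc_def)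
        have "e \<notin> ?I"
        proof
          assume "e \<in> ?I"
          then obtain Q where Q: "Q \<in> parts" "e \<subseteq> Q" by (auto simp: ind_def)
          then have "Q = P" using parts_disjoint[OF Q(1) P] eU by blast
          then show False using Q eU by blast
        qed
        then show "e \<in> ?r" using eU by blast
      qed
      show "?r \<subseteq> ?l" using P partsD(2)[OF P] by (auto simp: inc_def ind_def)
    qed
    moreover have "card ({e \<in> ?A. e \<inter> P \<noteq> {}} \<union> {e \<in> ?B. e \<inter> P \<noteq> {}}) = card {e \<in> ?A. e \<inter> P \<noteq> {}} + card {e \<in> ?B. e \<inter> P \<noteq> {}}"
      using finE by (intro card_Un_disjoint) (auto simp: inc_def)
    ultimately show ?thesis by (simp add: dd_def)
  qed
  show os: "(\<Sum>P\<in>parts. out P) = card ?B" using sB o by simp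
  have "(\<Sum>P\<in>parts. dd P) = 2 * card ?A + card ?B" using sA sB d by (simp add: sum.distrib)
  then have tot: "(\<Sum>P\<in>parts. dd P + out P) = 2 * (card ?A + card ?B)" using os by (simp add: sum.distrib)
  have cI: "card ?I = (\<Sum>P\<in>parts. card (ind E P))"
    using card_ind_parts[OF E sparse_onY[OF UY] finU E] by (simp add: parts_def)
  have "(\<Sum>P\<in>parts. card (ind E P) + 2) = (\<Sum>P\<in>parts. 2 * card P)"
    using partsD(1) by (intro sum.cong) (auto simp: tight_def)
  then have "(\<Sum>P\<in>parts. card (ind E P)) + 2 * card parts = 2 * (\<Sum>P\<in>parts. card P)"
    by (simp only: sum.distrib sum_distrib_left[symmetric]) simp
  moreover have "(\<Sum>P\<in>parts. card P) = card U"
  proof -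
    have "pairwise disjnt parts" using parts_disjoint by (simp add: pairwise_def disjnt_def)
    then show ?thesis using card_Union_disjoint[of parts] partsD(3) Union_parts by simp
  qed
  ultimately have cI2: "card ?I + 2 * card parts = 2 * card U" using cI by simp
  have "inc E U = ?I \<union> (?A \<union> ?B)" 
  proof -
    have "?I \<subseteq> inc E U" using partsD(2) edge_set_nonempty[OF E] by (fastforce simp: ind_def inc_def)
    then show ?thesis by blast
  qed
  moreover have "card (?I \<union> (?A \<union> ?B)) = card ?I + card (?A \<union> ?B)"
  proof (rule card_Un_disjoint)
    show "finite ?I" using finE finite_parts by auto
    show "?I \<inter> (?A \<union> ?B) = {}" using partsD(2) by (fastforce simp: ind_def)
  qed (use finAB in auto)
  moreover have "card (?A \<union> ?B) = card ?A + card ?B" using finAB by (intro card_Un_disjoint) auto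
  ultimately show "(\<Sum>P\<in>parts. dd P + out P) = 4 * card parts + 2" using tot cI2 dtD(3)[OF U] by simp
qed

lemma card_U: "2 \<le> card U"
proof (rule ccontr)
  assume "\<not> ?thesis"
  obtain x where x: "x \<in> U" "\<not> node x" using nonnode by blast
  have "U = {x}"
  proof (rule card_subset_eq[OF finU, symmetric])
    show "{x} \<subseteq> U" using x by simp
    then show "card {x} = card U" using card_mono[OF finU, of "{x}"] \<open>\<not> 2 \<le> card U\<close> by simp
  qed
  then show False using U x node_iff_dt[of x] UY by auto
qed

lemma out_sum_ge: "4 \<le> (\<Sum>P\<in>parts. out P)"
proof -
  have "inc E U = ind E U \<union> {e \<in> inc E U. \<not> e \<subseteq> U}"
    using edge_set_nonempty[OF E] by (fastforce simp: inc_def ind_def)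
  moreover have "card (ind E U \<union> {e \<in> inc E U. \<not> e \<subseteq> U}) = card (ind E U) + card {e \<in> inc E U. \<not> e \<subseteq> U}"
    using finE by (intro card_Un_disjoint) (auto simp: ind_def inc_def)
  ultimately show ?thesis using out_sum no_3_cut[OF UY card_U] by simp
qed

lemma dd_singleton: "dd {v} = card (nb E v)"
  using card_inc_part[of "{v}"] card_inc_singleton[OF E, of v] ind_singleton[OF E, of v] by simp

lemma out_singleton: assumes "v \<in> U" shows "out {v} = card (nb E v - U)"
proof -
  have "{e \<in> inc E {v}. \<not> e \<subseteq> U} = (\<lambda>w. {v, w}) ` (nb E v - U)"
    unfolding inc_singleton_nb[OF E] using assms by auto
  moreover have "card ((\<lambda>w. {v, w}) ` (nb E v - U)) = card (nb E v - U)"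
    by (rule card_image) (auto simp: inj_on_def doubleton_eq_iff)
  ultimately show ?thesis by (simp add: out_def)
qed

lemma trivial_pt: assumes "trivial v" shows "pt v = {v}" "{v} \<in> parts" "v \<in> U"
proof -
  show vU: "v \<in> U" using assms by (simp add: trivial_def)
  show "pt v = {v}" using trivialD[OF assms pt_subset pt_tight[OF vU] pt_self[OF vU]] .
  then show "{v} \<in> parts" using pt_in_parts[OF vU] by simp
qed

text \<open>A part with two vertices or more has four leaving edges by \<open>no_3_cut\<close>, a
  single vertex that is not a node by its degree; a node forming its own part is trivial by
  maximality of parts.\<close>

lemma part_cases:
  assumes P: "P \<in> parts"
  obtains (node) v where "P = {v}" "node v" "trivial v" | (big) "4 \<le> dd P"
proof (cases "2 \<le> card P")
  case True
  then show ?thesis using big no_3_cut[OF partsD(4)[OF P] True] card_inc_part[of P] by simp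
next
  case False
  obtain x where x: "x \<in> U" "P = pt x" using P by (auto simp: parts_def)
  have xP: "x \<in> P" using pt_self x by simp
  have Px: "P = {x}"
  proof (rule card_subset_eq[OF partsD(3)[OF P], symmetric])
    show "{x} \<subseteq> P" using xP by simp
    then show "card {x} = card P" using card_mono[OF partsD(3)[OF P], of "{x}"] False by simp
  qed
  have xY: "x \<in> Y" using x UY by blast
  show ?thesis
  proof (cases "card (nb E x) = 3")
    case True
    moreover have "trivial x"
      unfolding trivial_def using x Px tight_subset_pt[of _ x] by blast
    ultimately show ?thesis using node Px xY by (simp add: node_def)
  next
    case False
    then show ?thesis using big degree_ge[OF xY] Px dd_singleton by simp
  qed
qed

lemma nonnode_dd: "a \<in> U \<Longrightarrow> \<not> node a \<Longrightarrow> 4 \<le> dd (pt a)"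
  using part_cases[OF pt_in_parts[of a]] pt_self[of a] by (metis singletonD)

lemma out_edge:
  assumes "{a, b} \<in> E" "a \<in> P" "b \<notin> U" shows "1 \<le> out P"
proof -
  have "{a, b} \<in> {e \<in> inc E P. \<not> e \<subseteq> U}" using assms by (auto simp: inc_def)
  then have "0 < out P" unfolding out_def using finE by (subst card_gt_0_iff) auto
  then show ?thesis by simp
qed

lemma out_edge_unique:
  assumes P: "out P = 1" "P \<subseteq> U" and "{a, b} \<in> E" "a \<in> P" "b \<notin> U" "{a', b'} \<in> E" "a' \<in> P" "b' \<notin> U"
  shows "a' = a \<and> b' = b"
proof -
  obtain e where e: "{e \<in> inc E P. \<not> e \<subseteq> U} = {e}" using P(1) unfolding out_def by (rule card_1_singletonE)
  have "{a, b} \<in> {e \<in> inc E P. \<not> e \<subseteq> U}" "{a', b'} \<in> {e \<in> inc E P. \<not> e \<subseteq> U}"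
    using assms by (auto simp: inc_def)
  then have "{a, b} = {a', b'}" using e by simp
  moreover have "a \<noteq> b'" "a' \<noteq> b" using assms by auto
  ultimately show ?thesis by (auto simp: doubleton_eq_iff)
qed

lemma out_edge_zero:
  assumes P: "out P = 0" "P \<subseteq> U" and "{a, b} \<in> E" "a \<in> P" shows "b \<in> U"
  using out_edge[OF assms(3,4)] P by fastforce

lemma diamond_out:
  assumes "diamond u t y1 y2" shows "dd {u} = 3" "out {u} = 1"
proof -
  have u: "nb E u = {t, y1, y2}" "node u" "trivial u" "trivial t" "y1 \<in> U" "y2 \<notin> U"
    using assms by (auto simp: diamond_def)
  then have "nb E u - U = {y2}" using trivial_pt(3) by auto
  then show "out {u} = 1" using out_singleton[OF trivial_pt(3)[OF u(3)]] by simp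
  show "dd {u} = 3" using u by (simp add: dd_singleton node_def)
qed

text \<open>A trivial node has at most one neighbour in any tight set avoiding it, so
  \<open>w\<close> and \<open>w'\<close> lie in different parts.\<close>

lemma fan_out:
  assumes "fan u w w' z" "node u" "trivial u" shows "dd {u} = 3" "out {u} = 1" "pt w \<noteq> pt w'"
proof -
  have f: "nb E u = {w, w', z}" "w \<in> U" "w' \<in> U" "z \<notin> U" "w \<noteq> w'" "\<not> node w" using assms by (auto simp: fan_def)
  then have "nb E u - U = {z}" by auto
  then show "out {u} = 1" using out_singleton[OF trivial_pt(3)[OF assms(3)]] by simp
  show "dd {u} = 3" using assms by (simp add: dd_singleton node_def)
  show "pt w \<noteq> pt w'"
  proof
    assume eq: "pt w = pt w'"
    have ww: "w \<in> pt w" "w' \<in> pt w" using pt_self f eq by auto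
    have "u \<notin> pt w"
    proof
      assume "u \<in> pt w"
      then have "pt w = {u}" using trivialD[OF assms(3) pt_subset pt_tight[OF f(2)]] by simp
      then show False using ww assms f by simp
    qed
    then show False
      using trivial_two_nbs[OF assms(3) pt_tight[OF f(2)] pt_subset, of w w'] ww f by auto
  qed
qed

lemma pendant_out:
  assumes "nb E u \<inter> U = {w}" "node u" "trivial u" shows "dd {u} = 3" "out {u} = 2"
proof -
  have "card (nb E u) = card (nb E u \<inter> U) + card (nb E u - U)"
    using card_Int_Diff[OF finite_nb[OF E]] by simp
  then show "out {u} = 2" using out_singleton[OF trivial_pt(3)[OF assms(3)]] assms by (simp add: node_def)
  show "dd {u} = 3" using assms by (simp add: dd_singleton node_def)
qed

text \<open>The weights are 3 + 1 for diamonds and fans, 3 + 2 for pendant nodes and at least 4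
  otherwise. No part has negative surplus over 4, so the total surplus of two is a real restriction
  on every family of parts.\<close>

lemma part_weight_ge: assumes P: "P \<in> parts" shows "4 \<le> dd P + out P"
  using P
proof (cases rule: part_cases)
  case (node v)
  from node(2,3) show ?thesis
  proof (cases rule: trivial_node_cases)
    case (diamond t y1 y2) then show ?thesis using diamond_out node by simp
  next
    case (fan w w' z) then show ?thesis using fan_out node by simp
  next
    case (pendant w) then show ?thesis using pendant_out node by simp
  qed
qed simp

lemma weight_bound:
  assumes A: "A \<subseteq> parts" shows "(\<Sum>P\<in>A. dd P + out P) \<le> 4 * card A + 2"
proof -
  have fin: "finite A" "finite (parts - A)" using A finite_parts finite_subset by auto
  have "(\<Sum>P\<in>parts. dd P + out P) = (\<Sum>P\<in>parts - A. dd P + out P) + (\<Sum>P\<in>A. dd P + out P)"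
    using sum.subset_diff[OF A finite_parts] by simp
  moreover have "(\<Sum>P\<in>parts - A. 4) \<le> (\<Sum>P\<in>parts - A. dd P + out P)"
    by (rule sum_mono) (use part_weight_ge in auto)
  moreover have "card parts = card (parts - A) + card A"
    using card_Diff_subset[OF fin(1) A] card_mono[OF finite_parts A] by simp
  ultimately show ?thesis using dd_out_sum by simp
qed

lemma exists_out_part:
  assumes A: "A \<subseteq> parts" and lt: "(\<Sum>P\<in>A. out P) < 4"
  obtains R where "R \<in> parts - A" "1 \<le> out R"
proof (rule ccontr)
  assume no: "\<not> thesis"
  have "out R = 0" if "R \<in> parts - A" for R
  proof (rule ccontr)
    assume "out R \<noteq> 0"
    then have "1 \<le> out R" by simp
    then show False using no \<open>R \<in> parts - A\<close> \<open>\<And>R. R \<in> parts - A \<Longrightarrow> 1 \<le> out R \<Longrightarrow> thesis\<close> by blast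
  qed
  then have "(\<Sum>P\<in>parts - A. out P) = 0" by simp
  then show False using sum.subset_diff[OF A finite_parts, of out] lt out_sum_ge by simp
qed

section \<open>Excluding diamonds and fans\<close>

lemma diamond_inc:
  assumes D: "diamond u t y1 y2" and Q: "y1 \<in> Q" "Q \<subseteq> U" "u \<notin> Q" "t \<notin> Q"
  shows "card (inc E (insert u (insert t Q))) = card (inc E Q) + 3"
proof -
  have d: "nb E u = {t, y1, y2}" "nb E t = {u, y1, y2}" "y2 \<notin> U" "u \<noteq> y2" "t \<noteq> y2" "t \<noteq> y1" "u \<noteq> y1"
    using D by (auto simp: diamond_def)
  have ut: "u \<noteq> t" using nb_irrefl[OF E, of u] d by auto
  have "y2 \<notin> Q" using d Q by blast
  then have "nb E t - Q = {u, y2}" "nb E u - insert t Q = {y2}" using d Q by auto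
  then show ?thesis
    using card_inc_insert[OF E, of t Q] card_inc_insert[OF E, of u "insert t Q"] Q ut d by simp
qed

lemma diamond_not_in_pt:
  assumes D: "diamond u t y1 y2" shows "u \<notin> pt y1" "t \<notin> pt y1"
proof -
  have d: "trivial u" "trivial t" "y1 \<in> U" "u \<noteq> y1" "t \<noteq> y1" using D by (auto simp: diamond_def)
  have "x \<notin> pt y1" if x: "trivial x" "x \<noteq> y1" for x
  proof
    assume "x \<in> pt y1"
    then have "pt y1 = {x}" using trivialD[OF x(1) pt_subset pt_tight[OF d(3)]] by blast
    then show False using pt_self[OF d(3)] x(2) by simp
  qed
  then show "u \<notin> pt y1" "t \<notin> pt y1" using d by blast+
qed

text \<open>With four leaving edges the tight \<open>pt y1\<close> is incident with
  \<open>2 * card (pt y1) + 2\<close> edges. The nodes \<open>u\<close> and \<open>t\<close> add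
  three more, \<open>ut\<close> and the two edges to \<open>y2\<close>, so the enlarged set is
  dually tight and by minimality equals \<open>U\<close>.\<close>

lemma diamond_dd4_U:
  assumes D: "diamond u t y1 y2" and 4: "dd (pt y1) = 4"
  shows "insert u (insert t (pt y1)) = U"
proof -
  let ?P = "pt y1"
  have d: "y1 \<in> U" "\<not> node y1" "trivial u" "trivial t" "u \<noteq> t"
    using D nb_irrefl[OF E, of u] by (auto simp: diamond_def)
  note un = diamond_not_in_pt[OF D]
  have fin: "finite ?P" using pt_tight[OF d(1)] by (simp add: tight_def)
  have "card (inc E ?P) = 2 * card ?P + 2"
    using card_inc_part[of ?P] 4 pt_tight[OF d(1)] by (simp add: tight_def)
  then have "card (inc E (insert u (insert t ?P))) = 2 * card ?P + 5"
    using diamond_inc[OF D pt_self[OF d(1)] pt_subset un] by simp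
  moreover have "card (insert u (insert t ?P)) = card ?P + 2" using un fin d by simp
  moreover have sub: "insert u (insert t ?P) \<subseteq> U" using pt_subset[of y1] trivial_pt(3) d by auto
  ultimately have "dt (insert u (insert t ?P))" using UY by (auto simp: dt_def)
  then show ?thesis using dt_nonnode_eq[OF _ sub, of y1] pt_self[OF d(1)] d by blast
qed

text \<open>This configuration needs the contraction at a vertex of degree four. \<open>U\<close>
  consists of \<open>u\<close>, \<open>t\<close> and the part of \<open>w\<close>; the part shrinks
  to \<open>w\<close>, and neither blocker of the contraction can exist.\<close>

lemma diamond_dd4:
  assumes D: "diamond u t w z" and 4: "dd (pt w) = 4"
  shows False
proof -
  let ?P = "pt w"
  have d: "w \<in> U" "\<not> node w" "trivial u" "trivial t" "node u" "node t" "z \<notin> U"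
    "nb E u = {t, w, z}" "nb E t = {u, w, z}" "u \<noteq> w" "t \<noteq> w" "u \<noteq> z" "t \<noteq> z" "w \<noteq> z" "{w, z} \<in> E"
    using D by (auto simp: diamond_def)
  have ut: "u \<noteq> t" using nb_irrefl[OF E, of u] d by auto
  note un = diamond_not_in_pt[OF D] and UP = diamond_dd4_U[OF D 4]
  have wP: "w \<in> ?P" using pt_self d by simp
  have fin: "finite ?P" and tP: "card (ind E ?P) + 2 = 2 * card ?P" using pt_tight[OF d(1)] by (auto simp: tight_def)
  have cP: "card (inc E ?P) = 2 * card ?P + 2" using card_inc_part[of ?P] 4 tP by simp
  have ed: "{u, w} \<in> E" "{t, w} \<in> E" "{u, z} \<in> E" "{t, z} \<in> E" "{u, t} \<in> E" using d by (auto simp: nb_def)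
  have nw: "{u, t, z} \<subseteq> nb E w" using ed d by (auto simp: nb_def insert_commute)
  have zP: "z \<notin> ?P" using d pt_subset by blast
  have Pw: "?P = {w}"
  proof (rule ccontr)
    assume "?P \<noteq> {w}"
    let ?K = "?P - {w}"
    have Kne: "?K \<noteq> {}" using \<open>?P \<noteq> {w}\<close> wP by blast
    have KY: "?K \<subseteq> Y" using pt_subset UY by blast
    have ins: "insert w ?K = ?P" using wP by blast
    have cK: "card ?P = Suc (card ?K)" using card_Suc_Diff1[OF fin wP] by simp
    have "card {u, t, z} \<le> card (nb E w - ?K)" using nw un zP finite_nb[OF E] by (intro card_mono) auto
    then have "3 \<le> card (nb E w - ?K)" using ut d by simp
    then have "card (inc E ?K) \<le> 2 * card ?K + 1"
      using card_inc_insert[OF E, of w ?K] ins cP cK by simp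
    then have "dt ?K" using inc_ge[OF KY Kne] KY Kne by (auto simp: dt_def)
    moreover have "?K \<subset> U" using pt_subset d by blast
    ultimately have "node x" if "x \<in> ?K" for x using minimal that by blast
    then have "card (ind E ?K) + 1 \<le> card ?K" using nodes_ind_le[OF KY Kne] by blast
    moreover have "card (nb E w \<inter> ?K) \<le> card ?K" using fin by (intro card_mono) auto
    ultimately show False using card_ind_insert[OF E, of w ?K] ins tP cK by simp
  qed
  then have U3: "U = {u, t, w}" using UP by auto
  have "card (nb E w) = 4" using 4 Pw dd_singleton by simp
  then have "card (nb E w - {u, t, z}) = 1" using nw ut d by (subst card_Diff_subset) auto
  then obtain p where p: "nb E w - {u, t, z} = {p}" by (rule card_1_singletonE)
  have pn: "p \<noteq> u" "p \<noteq> t" "p \<noteq> z" using p by auto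
  have nbw: "nb E w = {u, t, z, p}" using p nw by auto
  have wp: "w \<noteq> p" using nb_irrefl[OF E, of w] nbw by auto
  have Ys: "w \<in> Y" "u \<in> Y" "t \<in> Y" using d UY trivial_pt(3) by auto
  have dut: "dt {u, t}" using adjacent_nodes_dt[OF d(5,6) ed(5)] .
  have "reducible E"
  proof (rule ear_contract_reduction[OF ear Ys nbw d(8,9)])
    show "u \<noteq> t" "u \<noteq> z" "u \<noteq> p" "t \<noteq> z" "t \<noteq> p" "z \<noteq> p" using ut d pn by auto
    show "card (inc E S) \<noteq> 2 * card S + 1" if S: "S \<subseteq> Y" "z \<in> S" "w \<notin> S" for S
    proof
      assume "card (inc E S) = 2 * card S + 1"
      then have dS: "dt S" using S by (auto simp: dt_def)
      \<comment> \<open>An edge at \<open>z\<close> is impossible in each case: it joins the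
        differences of \<open>S\<close> and a dually tight set meeting it, or two edges join
        \<open>S\<close> to the disjoint \<open>U\<close>.\<close>
      consider "u \<in> S" "t \<in> S" | "u \<in> S" "t \<notin> S" | "u \<notin> S" "t \<in> S" | "u \<notin> S" "t \<notin> S" by blast
      then show False
      proof cases
        case 1
        then show False using dt_cross_no_edge[OF dS U, of z w] S d U3 by (auto simp: insert_commute)
      next
        case 2
        then show False using dt_cross_no_edge[OF dS dut, of z t] S d ed by (auto simp: insert_commute)
      next
        case 3
        then show False using dt_cross_no_edge[OF dS dut, of z u] S d ed by (auto simp: insert_commute)
      next
        case 4
        then have "S \<inter> U = {}" using U3 S by blast
        then have "card (btw E S U) \<le> 1" using dt_disjoint_btw[OF dS U] by blast
        moreover have "card {{u, z}, {t, z}} \<le> card (btw E S U)"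
          using ed S U3 finE by (intro card_mono) (auto simp: btw_def)
        moreover have "{u, z} \<noteq> {t, z}" using ut by (auto simp: doubleton_eq_iff)
        ultimately show False by simp
      qed
    qed
    show "\<not> tight E Z" if Z: "Z \<subseteq> Y" "w \<in> Z" "p \<in> Z" "z \<notin> Z" for Z
    proof
      assume tZ: "tight E Z"
      \<comment> \<open>Every vertex of \<open>Z\<close> needs two neighbours in \<open>Z\<close>,
        and \<open>z\<close> is outside, so \<open>u\<close> and \<open>t\<close> belong to
        \<open>Z\<close> together or not at all. Without them \<open>w\<close> keeps only
        \<open>p\<close>; with them, removing both takes away three edges for two vertices and
        leaves too many.\<close>
      have deg: "u \<in> Z \<Longrightarrow> t \<in> Z" "t \<in> Z \<Longrightarrow> u \<in> Z"
      proof -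
        show "t \<in> Z" if "u \<in> Z"
        proof (rule ccontr)
          assume "t \<notin> Z"
          then have "nb E u \<inter> Z \<subseteq> {w}" using d Z by auto
          then have "card (nb E u \<inter> Z) \<le> 1" using card_mono[of "{w}"] by fastforce
          then show False using tight_degree[OF tZ Z(1) that] Z d by force
        qed
        show "u \<in> Z" if "t \<in> Z"
        proof (rule ccontr)
          assume "u \<notin> Z"
          then have "nb E t \<inter> Z \<subseteq> {w}" using d Z by auto
          then have "card (nb E t \<inter> Z) \<le> 1" using card_mono[of "{w}"] by fastforce
          then show False using tight_degree[OF tZ Z(1) that] Z d by force
        qed
      qed
      show False
      proof (cases "u \<in> Z")
        case False
        then have "nb E w \<inter> Z \<subseteq> {p}" using nbw deg Z by auto
        then have "card (nb E w \<inter> Z) \<le> 1" using card_mono[of "{p}"] by fastforce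
        then show False using tight_degree[OF tZ Z(1,2)] Z wp by force
      next
        case True
        let ?Z = "Z - {u, t}"
        have tZ': "t \<in> Z" using deg True by simp
        have finZ: "finite Z" using tZ by (simp add: tight_def)
        have i: "insert u (insert t ?Z) = Z" using True tZ' by blast
        have "nb E t \<inter> ?Z = {w}" "nb E u \<inter> insert t ?Z = {t, w}" using d Z ut by auto
        then have "card (ind E Z) = card (ind E ?Z) + 3"
          using card_ind_insert[OF E, of t ?Z] card_ind_insert[OF E, of u "insert t ?Z"] i ut d by simp
        moreover have "card Z = card ?Z + 2"
          using card_insert_disjoint[of "insert t ?Z" u] card_insert_disjoint[of ?Z t] finZ i ut by simp
        moreover have "card (ind E ?Z) + 2 \<le> 2 * card ?Z" using Z d by (intro ind_le) auto
        ultimately show False using tZ by (simp add: tight_def)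
      qed
    qed
  qed
  then show False using irreducible by simp
qed

lemma nonnode_out_weight:
  assumes "a \<in> U" "\<not> node a" "{a, b} \<in> E" "b \<notin> U"
  shows "4 \<le> dd (pt a)" "1 \<le> out (pt a)" "pt a \<in> parts"
  using nonnode_dd[OF assms(1,2)] out_edge[OF assms(3) pt_self[OF assms(1)] assms(4)] pt_in_parts[OF assms(1)] .

text \<open>The part of \<open>y1\<close> has weight at least six and thus takes the whole surplus
  of two.\<close>

lemma diamond_weight:
  assumes D: "diamond u t y1 y2"
  shows "5 \<le> dd (pt y1)" "1 \<le> out (pt y1)" "pt y1 \<in> parts"
proof -
  have d: "y1 \<in> U" "\<not> node y1" "{y1, y2} \<in> E" "y2 \<notin> U" using D by (auto simp: diamond_def)
  show "1 \<le> out (pt y1)" "pt y1 \<in> parts" using nonnode_out_weight[OF d] by auto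
  show "5 \<le> dd (pt y1)" using nonnode_out_weight(1)[OF d] diamond_dd4[OF D] by (cases "dd (pt y1) = 4") auto
qed

text \<open>The parts of \<open>w\<close> and \<open>w'\<close> each have four leaving edges and an
  edge to \<open>z\<close>, which uses up the surplus. Then all trivial nodes have the neighbours
  \<open>w\<close>, \<open>w'\<close>, \<open>z\<close>, and a second one exists because four edges
  leave \<open>U\<close>.\<close>

lemma no_fan:
  assumes F: "fan u w w' z" and u: "node u" "trivial u" shows False
proof -
  let ?P = "pt w" and ?Q = "pt w'"
  have f: "nb E u = {w, w', z}" "w \<noteq> w'" "w \<in> U" "w' \<in> U" "\<not> node w" "\<not> node w'" "z \<notin> U"
    "{w, z} \<in> E" "{w', z} \<in> E" "z \<notin> Y \<Longrightarrow> {w, w'} \<in> E" using F by (auto simp: fan_def)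
  note wP = nonnode_out_weight[OF f(3,5,8,7)] and wQ = nonnode_out_weight[OF f(4,6,9,7)]
  note fo = fan_out[OF F u]
  have two: "(dd ?P + out ?P) + (dd ?Q + out ?Q) \<le> 10"
    using weight_bound[of "{?P, ?Q}"] wP wQ fo(3) by simp
  then have vals: "dd ?P = 4" "out ?P = 1" "dd ?Q = 4" "out ?Q = 1" using wP wQ by auto
  have other: "dd R + out R = 4" if R: "R \<in> parts" "R \<noteq> ?P" "R \<noteq> ?Q" for R
  proof -
    have "(dd R + out R) + ((dd ?P + out ?P) + (dd ?Q + out ?Q)) \<le> 14"
      using weight_bound[of "{R, ?P, ?Q}"] R wP wQ fo(3) by simp
    then show ?thesis using vals part_weight_ge[OF R(1)] by simp
  qed
  have selfP: "w \<in> ?P" "w' \<in> ?Q" using pt_self f by auto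
  have not_node: "{x} \<noteq> ?P \<and> {x} \<noteq> ?Q" if "node x" for x using selfP f that by (metis singletonD)
  \<comment> \<open>A diamond or a pendant node would need more surplus. Another fan hangs at the
    same two parts, and the unique edge out of \<open>U\<close> at each of them determines
    \<open>w\<close>, \<open>w'\<close> and \<open>z\<close>.\<close>
  have same: "nb E x = {w, w', z}" if x: "node x" "trivial x" for x
  proof -
    have w4: "dd {x} + out {x} = 4" using other[OF trivial_pt(2)[OF x(2)]] not_node[OF x(1)] by blast
    from x show ?thesis
    proof (cases rule: trivial_node_cases)
      case (diamond t y1 y2)
      note dw = diamond_weight[OF diamond]
      then have "pt y1 = ?P \<or> pt y1 = ?Q" using other[OF dw(3)] by force
      then show ?thesis using dw vals by auto
    next
      case (fan v v' y)
      have g: "nb E x = {v, v', y}" "v \<in> U" "v' \<in> U" "\<not> node v" "\<not> node v'" "y \<notin> U" "{v, y} \<in> E" "{v', y} \<in> E"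
        using fan by (auto simp: fan_def)
      note wv = nonnode_out_weight[OF g(2,4,7,6)] and wv' = nonnode_out_weight[OF g(3,5,8,6)]
      have "pt v = ?P \<or> pt v = ?Q" "pt v' = ?P \<or> pt v' = ?Q"
        using other[OF wv(3)] other[OF wv'(3)] wv wv' by force+
      moreover have "pt v \<noteq> pt v'" using fan_out(3)[OF fan x] .
      ultimately consider "pt v = ?P" "pt v' = ?Q" | "pt v = ?Q" "pt v' = ?P" by metis
      then show ?thesis
      proof cases
        case 1
        then have "v \<in> ?P" "v' \<in> ?Q" using pt_self[OF g(2)] pt_self[OF g(3)] by auto
        then show ?thesis
          using out_edge_unique[OF vals(2) pt_subset f(8) selfP(1) f(7) g(7) _ g(6)]
            out_edge_unique[OF vals(4) pt_subset f(9) selfP(2) f(7) g(8) _ g(6)] g(1) by auto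
      next
        case 2
        then have "v \<in> ?Q" "v' \<in> ?P" using pt_self[OF g(2)] pt_self[OF g(3)] by auto
        then show ?thesis
          using out_edge_unique[OF vals(2) pt_subset f(8) selfP(1) f(7) g(8) _ g(6)]
            out_edge_unique[OF vals(4) pt_subset f(9) selfP(2) f(7) g(7) _ g(6)] g(1) by auto
      qed
    next
      case (pendant v)
      then show ?thesis using pendant_out[OF pendant(1) x] w4 by simp
    qed
  qed
  have uparts: "{u} \<in> parts" "u \<in> U" using trivial_pt u by auto
  have "?P \<noteq> {u}" "?Q \<noteq> {u}" using not_node[OF u(1)] by metis+
  then have "(\<Sum>P\<in>{?P, ?Q, {u}}. out P) = 3" using vals fo by simp
  then obtain R where R: "R \<in> parts - {?P, ?Q, {u}}" "1 \<le> out R"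
    using exists_out_part[of "{?P, ?Q, {u}}"] wP wQ uparts by auto
  have RR: "dd R + out R = 4" using other R by blast
  then have "\<not> 4 \<le> dd R" using R by simp
  then obtain u2 where u2: "R = {u2}" "node u2" "trivial u2" using R part_cases[of R] by blast
  have nu2: "nb E u2 = {w, w', z}" using same u2 by blast
  have u2u: "u2 \<noteq> u" "u2 \<in> U" using R u2 trivial_pt by auto
  have PQ: "?P \<inter> ?Q = {}" using parts_disjoint[OF wP(3) wQ(3) fo(3)] .
  have un: "u \<notin> ?P" "u \<notin> ?Q" "u2 \<notin> ?P" "u2 \<notin> ?Q"
    using parts_eq[OF wP(3)] parts_eq[OF wQ(3)] trivial_pt(1) u u2 not_node by metis+
  have zPQ: "z \<notin> ?P" "z \<notin> ?Q" using f pt_subset by blast+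
  \<comment> \<open>With b edges between \<open>?P\<close> and \<open>?Q\<close>, the set
    \<open>?A\<close> is incident with \<open>2 * card ?A + 2 - b\<close> edges, so b is at most 1.
    If b = 1, then \<open>?A\<close> is \<open>U\<close> and only \<open>z\<close> is attached; if b
    = 0, adding \<open>z\<close> gives a tight set.\<close>
  let ?B = "?P \<union> ?Q"
  let ?A = "insert u2 (insert u ?B)"
  have finP: "finite ?P" "finite ?Q" using partsD(3) wP wQ by auto
  have tPQ: "card (ind E ?P) + 2 = 2 * card ?P" "card (ind E ?Q) + 2 = 2 * card ?Q"
    using partsD(1) wP wQ by (auto simp: tight_def)
  have iPQ: "card (inc E ?P) = 2 * card ?P + 2" "card (inc E ?Q) = 2 * card ?Q + 2"
    using card_inc_part[of ?P] card_inc_part[of ?Q] vals tPQ by auto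
  have cB: "card ?B = card ?P + card ?Q" using card_Un_disjoint[OF finP PQ] .
  have df: "?P - ?Q = ?P" "?Q - ?P = ?Q" using PQ by auto
  have incB: "card (inc E ?B) + card (btw E ?P ?Q) = 2 * card ?B + 4"
    using inc_Un_Int[OF E, of ?P ?Q] iPQ cB PQ df by (simp add: inc_def)
  have indB: "card (ind E ?B) + 4 = 2 * card ?B + card (btw E ?P ?Q)"
    using ind_Un_Int[OF E, of ?P ?Q] tPQ cB PQ df ind_empty[OF E] by simp
  have uz: "u \<noteq> z" "u2 \<noteq> z" using f uparts u2u by auto
  have "u2 \<notin> nb E u" using f(1) un selfP uz by auto
  then have nB: "nb E u - ?B = {z}" "nb E u2 - insert u ?B = {z}"
    "nb E u \<inter> ?B = {w, w'}" "nb E u2 \<inter> insert u ?B = {w, w'}"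
    using f(1) nu2 selfP zPQ uz un by auto
  have uB: "u \<notin> ?B" "u2 \<notin> insert u ?B" using un u2u by auto
  have incA: "card (inc E ?A) = card (inc E ?B) + 2"
    using card_inc_insert[OF E uB(1)] card_inc_insert[OF E uB(2)] nB by simp
  have indA: "card (ind E ?A) = card (ind E ?B) + 4"
    using card_ind_insert[OF E uB(1)] card_ind_insert[OF E uB(2)] nB f(2) by simp
  have cA: "card ?A = card ?B + 2" using uB finP by simp
  have AU: "?A \<subseteq> U" using uparts u2u pt_subset by auto
  have AY: "?A \<subseteq> Y" using AU UY by blast
  have "2 * card ?A + 1 \<le> card (inc E ?A)" using inc_ge[OF AY] by simp
  then have b1: "card (btw E ?P ?Q) \<le> 1" using incA incB cA by simp
  show False
  proof (cases "card (btw E ?P ?Q) = 1")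
    case True
    then have "dt ?A" using incA incB cA AY by (auto simp: dt_def)
    then have UA: "?A = U" using dt_nonnode_eq[OF _ AU, of w] selfP f by blast
    have "e \<subseteq> insert z U" if e: "e \<in> inc E U" for e
    proof -
      obtain a where a: "a \<in> e" "a \<in> U" "e \<in> E" using e by (auto simp: inc_def)
      then obtain b where ab: "e = {a, b}" using edge_set_edgeE'[OF E] by metis
      have "b \<in> U \<or> b = z"
      proof (rule ccontr)
        assume nb: "\<not> (b \<in> U \<or> b = z)"
        have abE: "{a, b} \<in> E" using a ab by simp
        have "a \<notin> ?P" using out_edge_unique[OF vals(2) pt_subset f(8) selfP(1) f(7) abE] nb by blast
        moreover have "a \<notin> ?Q" using out_edge_unique[OF vals(4) pt_subset f(9) selfP(2) f(7) abE] nb by blast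
        ultimately have "a = u \<or> a = u2" using a UA by blast
        then have "b \<in> {w, w', z}" using abE f(1) nu2 by (auto simp: nb_def)
        then show False using nb f by blast
      qed
      then show ?thesis using a ab by auto
    qed
    then show False using dt_outside[OF U, of z] by blast
  next
    case False
    then have b0: "card (btw E ?P ?Q) = 0" using b1 by simp
    have "{w, w'} \<notin> E"
    proof
      assume "{w, w'} \<in> E"
      then have "{w, w'} \<in> btw E ?P ?Q" using selfP by (auto simp: btw_def)
      then show False using b0 finE by (auto simp: card_eq_0_iff)
    qed
    then have zY: "z \<in> Y" using f(10) by blast
    \<comment> \<open>\<open>?A\<close> is two edges short of tight; the four edges from
      \<open>z\<close> to \<open>w\<close>, \<open>w'\<close>, \<open>u\<close>, \<open>u2\<close>
      make up for this and for the new vertex.\<close>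
    let ?Z = "insert z ?A"
    have zA: "z \<notin> ?A" using f(7) AU by blast
    have ZY: "?Z \<subseteq> Y" using zY AY by blast
    have "{w, w', u, u2} \<subseteq> nb E z \<inter> ?A"
    proof -
      have "{u, z} \<in> E" "{u2, z} \<in> E" using f(1) nu2 by (auto simp: nb_def)
      then show ?thesis using f(8,9) selfP by (auto simp: nb_def insert_commute)
    qed
    then have "card {w, w', u, u2} \<le> card (nb E z \<inter> ?A)" using finite_nb[OF E] by (intro card_mono) auto
    moreover have "u \<noteq> w" "u \<noteq> w'" "u2 \<noteq> w" "u2 \<noteq> w'" using un selfP by auto
    then have "card {w, w', u, u2} = 4" using f(2) u2u(1) by auto
    moreover have "card (ind E ?Z) + 2 \<le> 2 * card ?Z" using ind_le[OF ZY] by simp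
    moreover have "card ?Z = card ?A + 1" using zA finP by simp
    ultimately have tZ: "tight E ?Z"
      using card_ind_insert[OF E zA] indA indB b0 cA finP by (simp add: tight_def)
    have "U \<noteq> ?A"
    proof
      assume "U = ?A"
      then have "card (inc E ?A) = 2 * card ?A + 1" using dtD(3)[OF U] by metis
      then show False using incA incB cA b0 by linarith
    qed
    then have ne: "U - ?Z \<noteq> {}" using AU f(7) by blast
    have "?Z - U \<noteq> {}" using f(7) by blast
    then have dR: "dt (U - ?Z)" using dt_Diff_tight[OF U tZ ZY _ ne] by blast
    \<comment> \<open>The rest of \<open>U\<close> consists of nodes, so its parts induce forests
      and are single vertices. Such a trivial node would have all its neighbours in the tight
      \<open>?Z\<close>.\<close>
    then have nR: "node x" if "x \<in> U - ?Z" for x using minimal[OF dR _ that] uparts by blast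
    obtain x where x: "x \<in> U - ?Z" using ne by blast
    have xn: "node x" and xU: "x \<in> U" using nR x by auto
    have "pt x \<subseteq> U - ?Z"
    proof -
      have "pt x \<inter> Q = {}" if "Q \<in> parts" "x \<notin> Q" for Q
        using parts_disjoint[OF pt_in_parts[OF xU] that(1)] pt_self[OF xU] that(2) by blast
      then have "pt x \<inter> ?P = {}" "pt x \<inter> ?Q = {}" "pt x \<inter> {u} = {}" "pt x \<inter> {u2} = {}"
        using x wP(3) wQ(3) uparts trivial_pt(2)[OF u2(3)] by auto
      then show ?thesis using pt_subset[of x] f(7) by blast
    qed
    then have "card (ind E (pt x)) + 1 \<le> card (pt x)"
      using nodes_ind_le[of "pt x"] nR UY pt_self[OF xU] by blast
    then have "card (pt x) \<le> 1" using pt_tight[OF xU] by (simp add: tight_def)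
    then have ptx: "pt x = {x}"
      using pt_self[OF xU] partsD(3)[OF pt_in_parts[OF xU]] card_le_Suc0_iff_eq[of "pt x"] by auto
    have "trivial x" unfolding trivial_def using xU ptx tight_subset_pt[of _ x] by blast
    then have "nb E x = {w, w', z}" using same xn by blast
    then have "nb E x \<subseteq> ?Z" using selfP by auto
    then show False using tight_not_all_nbs[OF tZ ZY, of x] x UY by blast
  qed
qed

text \<open>The part of \<open>y1\<close>, \<open>u\<close> and \<open>t\<close> send only three
  edges out of \<open>U\<close>, so a fourth comes from another trivial node. No surplus is left, so
  that node belongs to a second diamond on the same \<open>y1\<close> and \<open>y2\<close>.\<close>

lemma no_diamond: "\<not> diamond u t y1 y2"
proof
  assume D: "diamond u t y1 y2"
  let ?P = "pt y1"
  note dw = diamond_weight[OF D]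
  have d: "y1 \<in> U" "\<not> node y1" "{y1, y2} \<in> E" "y2 \<notin> U" "node u" "node t" "trivial u" "trivial t" "u \<noteq> t"
    "nb E u = {t, y1, y2}" "nb E t = {u, y1, y2}"
    using D nb_irrefl[OF E, of u] by (auto simp: diamond_def)
  have "dd ?P + out ?P \<le> 6" using weight_bound[of "{?P}"] dw by simp
  then have vals: "dd ?P = 5" "out ?P = 1" using dw by auto
  have other: "dd R + out R = 4" if R: "R \<in> parts" "R \<noteq> ?P" for R
  proof -
    have "(dd R + out R) + (dd ?P + out ?P) \<le> 10" using weight_bound[of "{R, ?P}"] R dw by simp
    then show ?thesis using vals part_weight_ge[OF R(1)] by simp
  qed
  have selfP: "y1 \<in> ?P" using pt_self d by auto
  have not_node: "{x} \<noteq> ?P" if "node x" for x using selfP d that by (metis singletonD)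
  note un = diamond_not_in_pt[OF D]
  have "?P \<noteq> {u}" "?P \<noteq> {t}" using not_node[OF d(5)] not_node[OF d(6)] by metis+
  then have "(\<Sum>P\<in>{?P, {u}, {t}}. out P) = 3"
    using vals diamond_out[OF D] diamond_out[OF diamond_sym[OF D]] d(9) by simp
  then obtain R where R: "R \<in> parts - {?P, {u}, {t}}" "1 \<le> out R"
    using exists_out_part[of "{?P, {u}, {t}}"] dw trivial_pt(2) d by auto
  have "dd R + out R = 4" using other R by blast
  then have "\<not> 4 \<le> dd R" using R by simp
  then obtain u2 where u2: "R = {u2}" "node u2" "trivial u2" using R part_cases[of R] by blast
  have w4: "dd {u2} + out {u2} = 4" using other[of "{u2}"] R u2 by blast
  obtain t2 where D2: "diamond u2 t2 y1 y2"
    using u2(2,3)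
  proof (cases rule: trivial_node_cases)
    case (diamond t' a b)
    have a: "a \<in> U" "{a, b} \<in> E" "b \<notin> U" using diamond by (auto simp: diamond_def)
    have "pt a = ?P" using other[OF diamond_weight(3)[OF diamond]] diamond_weight[OF diamond] by force
    then have "a \<in> ?P" using pt_self[OF a(1)] by simp
    then have "a = y1 \<and> b = y2" using out_edge_unique[OF vals(2) pt_subset d(3) selfP d(4) a(2) _ a(3)] by blast
    then show ?thesis using that diamond by blast
  next
    case (fan v v' y) then show ?thesis using no_fan[OF fan u2(2,3)] by simp
  next
    case (pendant v) then show ?thesis using pendant_out[OF pendant(1) u2(2,3)] w4 by simp
  qed
  have e: "nb E u2 = {t2, y1, y2}" "nb E t2 = {u2, y1, y2}" "trivial t2" "u2 \<noteq> t2"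
    using D2 nb_irrefl[OF E, of u2] by (auto simp: diamond_def)
  note un2 = diamond_not_in_pt[OF D2]
  have u2n: "u2 \<noteq> u" "u2 \<noteq> t" using R u2 by auto
  have t2n: "t2 \<noteq> u" "t2 \<noteq> t"
  proof -
    have "u2 \<notin> nb E u" "u2 \<notin> nb E t" using d(10,11) u2n D2 by (auto simp: diamond_def)
    moreover have "u2 \<in> nb E t2" using e by simp
    ultimately show "t2 \<noteq> u" "t2 \<noteq> t" by auto
  qed
  let ?Q = "insert u (insert t ?P)"
  let ?A = "insert u2 (insert t2 ?Q)"
  have Usub: "u \<in> U" "t \<in> U" "u2 \<in> U" "t2 \<in> U" using trivial_pt(3) d u2 e by auto
  have QU: "?Q \<subseteq> U" and AU: "?A \<subseteq> U" using Usub pt_subset by auto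
  have fin: "finite ?P" and tP: "card (ind E ?P) + 2 = 2 * card ?P" using pt_tight[OF d(1)] by (auto simp: tight_def)
  \<comment> \<open>The part is incident with \<open>2 * card ?P + 3\<close> edges and each diamond
    adds three for two vertices; the total is minimal for \<open>?A\<close>. So \<open>?A\<close> is
    \<open>U\<close>, and all edges out of \<open>U\<close> end in \<open>y2\<close>.\<close>
  have "card (inc E ?Q) = card (inc E ?P) + 3" using diamond_inc[OF D selfP pt_subset un] .
  moreover have "card (inc E ?A) = card (inc E ?Q) + 3"
    using diamond_inc[OF D2 _ QU] selfP un2 u2n t2n by simp
  moreover have "card (inc E ?P) = 2 * card ?P + 3" using card_inc_part[of ?P] vals tP by simp
  moreover have "card ?A = card ?P + 4" using fin un un2 u2n t2n d(9) e(4) by simp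
  ultimately have "dt ?A" using AU UY by (auto simp: dt_def)
  then have UA: "?A = U" using dt_nonnode_eq[OF _ AU, of y1] selfP d by blast
  have "f \<subseteq> insert y2 U" if f: "f \<in> inc E U" for f
  proof -
    obtain a where a: "a \<in> f" "a \<in> U" "f \<in> E" using f by (auto simp: inc_def)
    then obtain b where ab: "f = {a, b}" using edge_set_edgeE'[OF E] by metis
    have "b \<in> U \<or> b = y2"
    proof (rule ccontr)
      assume nb: "\<not> (b \<in> U \<or> b = y2)"
      have abE: "{a, b} \<in> E" using a ab by simp
      have "a \<notin> ?P" using out_edge_unique[OF vals(2) pt_subset d(3) selfP d(4) abE] nb by blast
      then have "a \<in> {u, t, u2, t2}" using a UA by blast
      then have "b \<in> {u, t, u2, t2, y1, y2}" using abE d(10,11) e(1,2) by (auto simp: nb_def)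
      then show False using nb Usub d by blast
    qed
    then show ?thesis using a ab by auto
  qed
  then show False using dt_outside[OF U, of y2] by blast
qed

lemma all_pendant:
  assumes "node v" "trivial v" obtains w where "nb E v \<inter> U = {w}" "\<not> node w"
  using assms
proof (cases rule: trivial_node_cases)
  case (diamond t y1 y2) then show ?thesis using no_diamond by blast
next
  case (fan w w' z) then show ?thesis using no_fan assms by blast
qed (use that in blast)

lemma out_le_weight:
  assumes "P \<in> parts" shows "out P + 3 \<le> dd P + out P" "\<not> (\<exists>v. P = {v} \<and> node v \<and> trivial v) \<Longrightarrow> out P + 4 \<le> dd P + out P"
  using assms by (cases rule: part_cases; auto simp: dd_singleton node_def)+

text \<open>A pendant node has surplus one and sends two edges out of \<open>U\<close>; any other
  part has at least as much surplus as edges out of \<open>U\<close>. Surplus two against four such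
  edges leaves exactly two pendant nodes and no other edge out of \<open>U\<close>.\<close>

lemma contradiction: False
proof -
  let ?N = "{P \<in> parts. \<exists>v. P = {v} \<and> node v \<and> trivial v}"
  have finN: "finite ?N" using finite_parts by simp
  have N5: "dd P = 3 \<and> out P = 2" if "P \<in> ?N" for P
  proof -
    obtain v where v: "P = {v}" "node v" "trivial v" using \<open>P \<in> ?N\<close> by blast
    obtain w where "nb E v \<inter> U = {w}" using all_pendant[OF v(2,3)] by blast
    then show ?thesis using pendant_out[OF _ v(2,3)] v by blast
  qed
  have cN: "card ?N \<le> 2"
  proof -
    have "(\<Sum>P\<in>?N. dd P + out P) = (\<Sum>P\<in>?N. 5)" using N5 by (intro sum.cong) auto
    then show ?thesis using weight_bound[of ?N] by simp
  qed
  have "(\<Sum>P\<in>parts. dd P + out P) = (\<Sum>P\<in>parts - ?N. dd P + out P) + (\<Sum>P\<in>?N. dd P + out P)"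
    by (rule sum.subset_diff) (use finite_parts in auto)
  moreover have "(\<Sum>P\<in>?N. dd P + out P) = (\<Sum>P\<in>?N. 5)" using N5 by (intro sum.cong) auto
  moreover have "(\<Sum>P\<in>parts. out P) = (\<Sum>P\<in>parts - ?N. out P) + (\<Sum>P\<in>?N. out P)"
    by (rule sum.subset_diff) (use finite_parts in auto)
  moreover have "(\<Sum>P\<in>?N. out P) = (\<Sum>P\<in>?N. 2)" using N5 by (intro sum.cong) auto
  moreover have "(\<Sum>P\<in>parts - ?N. out P + 4) \<le> (\<Sum>P\<in>parts - ?N. dd P + out P)"
    by (rule sum_mono) (use out_le_weight(2) in blast)
  then have "(\<Sum>P\<in>parts - ?N. out P) + 4 * card (parts - ?N) \<le> (\<Sum>P\<in>parts - ?N. dd P + out P)"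
    by (simp add: sum.distrib)
  moreover have "card parts = card (parts - ?N) + card ?N"
    using card_Diff_subset[OF finN, of parts] card_mono[OF finite_parts, of ?N] by auto
  ultimately have N2: "card ?N = 2" and out0: "(\<Sum>P\<in>parts - ?N. out P) = 0"
    using dd_out_sum out_sum_ge cN by simp_all
  have out0': "\<forall>P\<in>parts - ?N. out P = 0"
    using out0 sum_eq_0_iff[of "parts - ?N" out] finite_parts by blast
  obtain P1 P2 where P12: "?N = {P1, P2}" "P1 \<noteq> P2" using N2 by (auto simp: card_2_iff)
  then have "P1 \<in> ?N" "P2 \<in> ?N" by auto
  then obtain u1 u2 where u: "P1 = {u1}" "node u1" "trivial u1" "P2 = {u2}" "node u2" "trivial u2" by blast
  have u12: "u1 \<noteq> u2" using P12 u by auto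
  have uU: "u1 \<in> U" "u2 \<in> U" using trivial_pt(3) u by auto
  obtain w1 w2 where w: "nb E u1 \<inter> U = {w1}" "\<not> node w1" "nb E u2 \<inter> U = {w2}" "\<not> node w2"
    using all_pendant[OF u(2,3)] all_pendant[OF u(5,6)] by metis
  \<comment> \<open>Removing the two pendant nodes takes away four edges, so \<open>?R\<close> still
    meets only \<open>2 * card ?R + 1\<close>. All but two of these are induced, one more than
    sparsity allows.\<close>
  let ?R = "U - {u1, u2}"
  have RY: "?R \<subseteq> Y" using UY by blast
  have Rne: "?R \<noteq> {}" using nonnode u by blast
  have ins: "insert u1 (insert u2 ?R) = U" using uU by blast
  have wR: "w1 \<in> ?R" "w2 \<in> ?R" using w u by auto
  have nn: "u1 \<notin> nb E u2" "u2 \<notin> nb E u1" using w u uU by auto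
  have "nb E u1 - insert u2 ?R = nb E u1 - U" "nb E u2 - ?R = nb E u2 - U"
    using nn nb_irrefl[OF E] by auto
  moreover have "card (nb E u1 - U) = 2" "card (nb E u2 - U) = 2"
    using pendant_out(2)[OF w(1) u(2,3)] pendant_out(2)[OF w(3) u(5,6)] out_singleton uU by auto
  ultimately have "card (inc E U) = card (inc E ?R) + 4"
    using card_inc_insert[OF E, of u2 ?R] card_inc_insert[OF E, of u1 "insert u2 ?R"] ins u12 by simp
  moreover have "card U = card ?R + 2"
    using card_Diff_subset[of "{u1, u2}" U] uU u12 card_mono[OF finU, of "{u1, u2}"] by simp
  ultimately have iR: "card (inc E ?R) = 2 * card ?R + 1" using dtD(3)[OF U] by simp
  have "inc E ?R \<subseteq> ind E ?R \<union> {{u1, w1}, {u2, w2}}"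
  proof
    fix e assume e: "e \<in> inc E ?R"
    then obtain a where a: "a \<in> e" "a \<in> ?R" "e \<in> E" by (auto simp: inc_def)
    then obtain b where ab: "e = {a, b}" using edge_set_edgeE'[OF E] by metis
    have abE: "{a, b} \<in> E" using a ab by simp
    have aU: "a \<in> U" using a by blast
    have "pt a \<notin> ?N" using P12 u pt_self[OF aU] a by auto
    then have "pt a \<in> parts - ?N" using pt_in_parts[OF aU] by blast
    then have "out (pt a) = 0" by (rule out0'[rule_format])
    then have bU: "b \<in> U" using out_edge_zero[OF _ pt_subset abE pt_self[OF aU]] by blast
    consider "b \<in> ?R" | "b = u1" | "b = u2" using bU by blast
    then show "e \<in> ind E ?R \<union> {{u1, w1}, {u2, w2}}"
    proof cases
      case 1 then show ?thesis using a ab by (auto simp: ind_def)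
    next
      case 2
      then have "a \<in> nb E u1 \<inter> U" using abE aU by (simp add: nb_def insert_commute)
      then show ?thesis using w 2 ab by auto
    next
      case 3
      then have "a \<in> nb E u2 \<inter> U" using abE aU by (simp add: nb_def insert_commute)
      then show ?thesis using w 3 ab by auto
    qed
  qed
  then have "card (inc E ?R) \<le> card (ind E ?R \<union> {{u1, w1}, {u2, w2}})" using finE by (intro card_mono) auto
  also have "\<dots> \<le> card (ind E ?R) + card {{u1, w1}, {u2, w2}}" by (rule card_Un_le)
  also have "\<dots> \<le> card (ind E ?R) + 2" using card_insert_le_m1[of 2 "{{u2, w2}}" "{u1, w1}"] by simp
  finally show False using iR ind_le[OF RY Rne] by simp
qed

end

section \<open>Ears consisting of nodes only, and the final contradiction\<close>

context irreducible_ear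
begin

lemma Y_nonempty: "Y \<noteq> {}"
proof
  assume "Y = {}"
  then show False using inc_Y by (simp add: inc_def)
qed

lemma dt_Y: "dt Y"
  using Y_nonempty inc_Y by (simp add: dt_def)

text \<open>The common neighbour \<open>v\<close> keeps \<open>a\<close> and \<open>b\<close> from
  becoming isolated, so connectedness of the remaining edges would make the deletion
  admissible.\<close>

lemma not_conn_delete:
  assumes "{a, b} \<in> E" "{v, a} \<in> E" "{v, b} \<in> E" "v \<noteq> a" "v \<noteq> b"
  shows "\<not> conn (E - {{a, b}})"
proof
  assume c: "conn (E - {{a, b}})"
  have ne: "{v, a} \<in> E - {{a, b}}" "{v, b} \<in> E - {{a, b}}" using assms by (auto simp: doubleton_eq_iff)
  then have "a \<in> \<Union>(E - {{a, b}})" "b \<in> \<Union>(E - {{a, b}})" by blast+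
  moreover have "\<Union>E = \<Union>(E - {{a, b}}) \<union> {a, b}" using assms(1) by blast
  ultimately have "\<Union>E = \<Union>(E - {{a, b}})" by blast
  then have "M22_connected (\<Union>E, E - {{a, b}})" using c by (simp add: M22_connected_iff)
  moreover have "edge_deletion (\<Union>E, E) (\<Union>E, E - {{a, b}})" using assms(1) by (auto simp: edge_deletion_def)
  ultimately show False using irreducible by (auto simp: reducible_def)
qed

lemma outer_eq: "outer E Y = E - inc E Y"
  by (auto simp: outer_def inc_def)

lemma outside_in_outer: "x \<in> \<Union>E \<Longrightarrow> x \<notin> Y \<Longrightarrow> x \<in> \<Union>(outer E Y)"
  using earD(4)[OF ear] by blast

text \<open>At a leaf both blockers would have to contain a vertex outside \<open>Y\<close>, so only
  the loss of the second attachment vertex can block. This leaves ears with one or two vertices,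
  where the new edge lies outside \<open>Y\<close> and circuits of \<open>outer E Y\<close> replace
  the counts.\<close>

lemma not_all_nodes:
  assumes all: "\<And>x. x \<in> Y \<Longrightarrow> node x" shows False
proof -
  have D: "conn (outer E Y)" using earD(3)[OF ear] .
  obtain v0 where v0: "v0 \<in> Y" using Y_nonempty by blast
  show False
  proof (cases "Y = {v0}")
    case Y1: True
    let ?v = v0
    have nv: "node ?v" using all v0 by blast
    \<comment> \<open>Deleting \<open>?v\<close> leaves \<open>outer E Y\<close>, which stays
      connected with a new edge, so a missing edge between two neighbours would give an admissible
      reduction.\<close>
    have opt: "{p, q} \<in> outer E Y" if n: "nb E ?v = {p, q, r}" and d: "p \<noteq> q" "p \<noteq> r" "q \<noteq> r" for p q r
    proof (rule ccontr)
      have vn: "?v \<noteq> p" "?v \<noteq> q" using nb_irrefl[OF E, of ?v] n by auto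
      have pq: "{?v, p} \<in> E" "{?v, q} \<in> E" using n by (auto simp: nb_def)
      have pD: "p \<in> \<Union>(outer E Y)" "q \<in> \<Union>(outer E Y)"
        using outside_in_outer[of p] outside_in_outer[of q] pq vn Y1 by auto
      assume "{p, q} \<notin> outer E Y"
      then have nE: "{p, q} \<notin> E" using vn Y1 by (auto simp: outer_def)
      obtain s where s: "s \<noteq> ?v" "{p, s} \<in> E" using ear_other_nbr[OF ear _ v0, of p] pq by blast
      have "edge_reduction (\<Union>E, E) (\<Union>E - {?v}, insert {p, q} (E - inc E {?v}))"
        using edge_reduction_node[OF E n d nE s] .
      moreover have "insert {p, q} (E - inc E {?v}) = insert {p, q} (outer E Y)" using outer_eq Y1 by simp
      moreover have "conn (insert {p, q} (outer E Y))"
        using conn_insert_edge(1)[OF D pD d(1)] nE by (auto simp: outer_def)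
      moreover have "\<Union>E - {?v} = \<Union>(insert {p, q} (outer E Y))"
        using ear_Union[OF ear] pD Y1 by (auto simp: outer_def)
      ultimately show False using irreducible by (auto simp: reducible_def M22_connected_iff)
    qed
    have "nb E ?v \<noteq> {}" using nv by (auto simp: node_def)
    then obtain a where "a \<in> nb E ?v" by blast
    then obtain b c where n: "nb E ?v = {a, b, c}" "a \<noteq> b" "a \<noteq> c" "b \<noteq> c" using nodeE[OF nv] by metis
    have n': "nb E ?v = {a, c, b}" using n by auto
    have ed: "{a, b} \<in> outer E Y" "{a, c} \<in> outer E Y" using opt[OF n] opt[OF n' n(3,2) n(4)[symmetric]] .
    have "{a, b} \<noteq> {a, c}" using n by (auto simp: doubleton_eq_iff)
    \<comment> \<open>A circuit through both \<open>ab\<close> and \<open>ac\<close> contains all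
      three attachment vertices, as \<open>ear_delete_edge\<close> demands.\<close>
    then obtain K where K: "circuit K" "K \<subseteq> outer E Y" "{a, b} \<in> K" "{a, c} \<in> K"
      using connD[OF D ed] by blast
    have ie: "inc E Y = {{?v, a}, {?v, b}, {?v, c}}" using inc_singleton_nb[OF E, of ?v] n Y1 by auto
    have abc: "a \<in> \<Union>K" "b \<in> \<Union>K" "c \<in> \<Union>K" using K(3,4) by blast+
    have "conn (E - {{a, b}})"
    proof (rule ear_delete_edge[OF ear K(1-3)])
      show "\<Union>(inc E Y) \<subseteq> \<Union>K \<union> Y" unfolding ie using abc v0 by simp
      show "a \<in> \<Union>(inc E Y)" "b \<in> \<Union>(inc E Y)" unfolding ie by auto
    qed
    moreover have "{?v, a} \<in> E" "{?v, b} \<in> E" "?v \<noteq> a" "?v \<noteq> b"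
      using n nb_irrefl[OF E, of ?v] by (auto simp: nb_def)
    ultimately show False using not_conn_delete[of a b ?v] ed by (auto simp: outer_def)
  next
    case False
    obtain l where l: "l \<in> Y" "card (nb E l \<inter> Y) = 1"
      using dt_nodes_leaf[OF dt_Y _ v0 False] all by metis
    obtain c where c: "nb E l \<inter> Y = {c}" using l(2) by (rule card_1_singletonE)
    have cl: "c \<in> nb E l" "c \<in> Y" using c by auto
    have nl: "node l" and nc: "node c" using all l cl by auto
    obtain x1 x2 where x: "nb E l = {c, x1, x2}" "c \<noteq> x1" "c \<noteq> x2" "x1 \<noteq> x2" using nodeE[OF nl cl(1)] .
    have xY: "x1 \<notin> Y" "x2 \<notin> Y" using c x by auto
    have lc: "l \<noteq> c" "{l, c} \<in> E" "l \<in> nb E c" using nb_irrefl[OF E, of l] x by (auto simp: nb_def insert_commute)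
    have lx: "l \<noteq> x1" "l \<noteq> x2" using nb_irrefl[OF E, of l] x by auto
    \<comment> \<open>Adding \<open>cp\<close> fails only if \<open>p\<close> would become the sole attachment vertex.\<close>
    have fail: "f \<subseteq> insert p (Y - {l})"
      if n: "nb E l = {c, p, q}" "c \<noteq> p" "c \<noteq> q" "p \<noteq> q" and cp: "{c, p} \<notin> E"
        and pq: "p \<notin> Y" "q \<notin> Y" and f: "f \<in> E" "l \<notin> f" "f \<inter> (Y - {l}) \<noteq> {}" for p q f
    proof (rule ccontr)
      assume nf: "\<not> f \<subseteq> insert p (Y - {l})"
      have "reducible E"
      proof (rule ear_node_reduction[OF ear l(1) n cp cl(2)])
        show "card (inc E S) \<noteq> 2 * card S + 1" if "S \<subseteq> Y" "l \<in> S" "q \<in> S" "c \<notin> S" "p \<notin> S" for S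
          using that pq by blast
        show "\<not> tight E Z" if "Z \<subseteq> Y" "c \<in> Z" "p \<in> Z" "l \<notin> Z" for Z using that pq by blast
        show "\<exists>g\<in>inc (insert {c, p} (E - inc E {l})) (Y - {l}). \<not> g \<subseteq> insert x (Y - {l})" for x
        proof (cases "x = p")
          case True
          have "f \<in> inc (insert {c, p} (E - inc E {l})) (Y - {l})" using f by (auto simp: inc_def)
          then show ?thesis using True nf by blast
        next
          case False
          have "{c, p} \<in> inc (insert {c, p} (E - inc E {l})) (Y - {l})" using cl lc by (auto simp: inc_def)
          moreover have "\<not> {c, p} \<subseteq> insert x (Y - {l})" using False pq(1) by auto
          ultimately show ?thesis by (rule bexI[rotated])
        qed
      qed
      then show False using irreducible by simp
    qed
    have x': "nb E l = {c, x2, x1}" using x by auto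
    \<comment> \<open>If one of the two edges is present, it keeps a second attachment vertex alive
      for the other reduction. If neither is, every edge at \<open>Y - {l}\<close> except
      \<open>lc\<close> lies in \<open>Y - {l}\<close> together with \<open>x1\<close> and also
      together with \<open>x2\<close>, hence is induced, which is too many.\<close>
    have c1: "{c, x1} \<in> E \<and> {c, x2} \<in> E"
    proof (rule ccontr)
      assume no: "\<not> ?thesis"
      have n1: "{c, x1} \<notin> E"
      proof
        assume a: "{c, x1} \<in> E"
        then have "{c, x2} \<notin> E" using no by blast
        then have "{c, x1} \<subseteq> insert x2 (Y - {l})"
          using fail[OF x' x(3,2) x(4)[symmetric] _ xY(2,1) a] lc lx cl by auto
        then show False using xY x by blast
      qed
      have n2: "{c, x2} \<notin> E"
      proof
        assume a: "{c, x2} \<in> E"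
        then have "{c, x2} \<subseteq> insert x1 (Y - {l})"
          using fail[OF x(1-4) n1 xY a] lc lx cl by auto
        then show False using xY x by blast
      qed
      have RY: "Y - {l} \<subseteq> Y" "Y - {l} \<noteq> {}" using cl lc by auto
      have "inc E (Y - {l}) \<subseteq> insert {l, c} (ind E (Y - {l}))"
      proof
        fix f assume f: "f \<in> inc E (Y - {l})"
        show "f \<in> insert {l, c} (ind E (Y - {l}))"
        proof (cases "l \<in> f")
          case True
          then obtain y where y: "f = {l, y}" using edge_set_edgeE'[OF E, of f l] f by (auto simp: inc_def)
          then have "y \<in> nb E l \<inter> Y" using f by (auto simp: inc_def nb_def)
          then show ?thesis using c y by auto
        next
          case False
          have fE: "f \<in> E" "f \<inter> (Y - {l}) \<noteq> {}" using f by (auto simp: inc_def)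
          have "f \<subseteq> insert x1 (Y - {l})" using fail[OF x(1-4) n1 xY fE(1) False fE(2)] .
          moreover have "f \<subseteq> insert x2 (Y - {l})"
            using fail[OF x' x(3,2) x(4)[symmetric] n2 xY(2,1) fE(1) False fE(2)] .
          ultimately show ?thesis using fE x(4) by (auto simp: ind_def)
        qed
      qed
      then have "card (inc E (Y - {l})) \<le> card (insert {l, c} (ind E (Y - {l})))"
        using finE by (intro card_mono) auto
      also have "\<dots> \<le> Suc (card (ind E (Y - {l})))" using finE by (intro card_insert_le_m1) auto
      finally show False using inc_ge[OF RY] ind_le[OF RY] by simp
    qed
    have nbc: "nb E c = {l, x1, x2}"
      using node_nb_eq[OF nc, of l x1 x2] c1 lc lx x by (auto simp: nb_def)
    have Y2: "Y = {l, c}"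
    proof (rule ccontr)
      assume "Y \<noteq> {l, c}"
      then have "{l, c} \<subseteq> Y" "Y - {l, c} \<noteq> {}" using l cl by auto
      then obtain p q where "p \<in> {l, c}" "q \<in> Y - {l, c}" "{p, q} \<in> E" using dt_connected[OF dt_Y, of "{l, c}"] by blast
      then show False using x(1) nbc xY by (auto simp: nb_def)
    qed
    have lxE: "{l, x1} \<in> E" "{l, x2} \<in> E" using x by (auto simp: nb_def)
    have xD: "x1 \<in> \<Union>(outer E Y)" "x2 \<in> \<Union>(outer E Y)"
      using outside_in_outer[of x1] outside_in_outer[of x2] lxE xY by auto
    have ie: "inc E Y = {{l, c}, {l, x1}, {l, x2}, {c, x1}, {c, x2}}"
      using card_inc_diamond(1)[OF E x(1) nbc x(2,3) lx x(4)] Y2 by simp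
    show False
    proof (cases "{x1, x2} \<in> E")
      case False
      have "K4_minus_reduction (\<Union>E, E) (\<Union>E - {l, c}, insert {x1, x2} (E - inc E {l, c}))"
        using K4_minus_reduction_nodes[OF E x(1) nbc x(2,3) lx x(4) False] .
      moreover have "insert {x1, x2} (E - inc E {l, c}) = insert {x1, x2} (outer E Y)" using outer_eq Y2 by simp
      moreover have "conn (insert {x1, x2} (outer E Y))"
        using conn_insert_edge(1)[OF D xD x(4)] False by (auto simp: outer_def)
      moreover have "\<Union>E - {l, c} = \<Union>(insert {x1, x2} (outer E Y))"
        using ear_Union[OF ear] xD Y2 by (auto simp: outer_def)
      ultimately show False using irreducible by (auto simp: reducible_def M22_connected_iff)
    next
      case True
      then have xo: "{x1, x2} \<in> outer E Y" using xY by (auto simp: outer_def)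
      obtain K where K: "circuit K" "K \<subseteq> outer E Y" "{x1, x2} \<in> K" using conn_circuit[OF D xo] .
      have "conn (E - {{x1, x2}})"
      proof (rule ear_delete_edge[OF ear K])
        have "x1 \<in> \<Union>K" "x2 \<in> \<Union>K" using K(3) by blast+
        then show "\<Union>(inc E Y) \<subseteq> \<Union>K \<union> Y" unfolding ie using l(1) cl(2) by simp
        show "x1 \<in> \<Union>(inc E Y)" "x2 \<in> \<Union>(inc E Y)" unfolding ie by auto
      qed
      then show False using not_conn_delete[OF True lxE lx] by blast
    qed
  qed
qed

lemma absurd: False
proof (cases "\<exists>x\<in>Y. \<not> node x")
  case False then show False using not_all_nodes by blast
next
  case True
  let ?S = "{S. dt S \<and> (\<exists>x\<in>S. \<not> node x)}"
  have "finite ?S" by (rule finite_subset[of _ "Pow Y"]) (use finY in \<open>auto simp: dt_def\<close>)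
  moreover have "Y \<in> ?S" using True dt_Y by blast
  ultimately obtain U where U: "U \<in> ?S" "\<forall>Z\<in>?S. Z \<subseteq> U \<longrightarrow> U = Z" by (rule finite_minimal_set)
  interpret minimal_core E Y U
  proof
    show "dt U" "\<exists>x\<in>U. \<not> node x" using U(1) by auto
    show "node x" if "dt S" "S \<subset> U" "x \<in> S" for S x
    proof (rule ccontr)
      assume "\<not> node x"
      then have "S \<in> ?S" using that by blast
      then have "U = S" using U(2) that(2) by blast
      then show False using that(2) by simp
    qed
  qed
  show False using contradiction .
qed

end

section \<open>From the ear decomposition to its last ear\<close>

lemma partial_union_Suc: "partial_union C (Suc i) = partial_union C i \<union> C (Suc i)"
proof -
  have "{1..Suc i} = insert (Suc i) {1..i}" by auto
  then show ?thesis by (auto simp: partial_union_def)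
qed

lemma ear_decomposition_conn:
  assumes circ: "\<And>i. i \<in> {1..t} \<Longrightarrow> circuit (C i)"
    and meet: "\<And>i. i \<in> {2..t} \<Longrightarrow> C i \<inter> partial_union C (i - 1) \<noteq> {}"
  shows "1 \<le> i \<Longrightarrow> i \<le> t \<Longrightarrow> conn (partial_union C i)"
proof (induction i rule: nat_induct_at_least)
  case base
  have "partial_union C 1 = C 1" by (simp add: partial_union_def)
  then show ?case using circuit_conn[OF circ[of 1]] base by simp
next
  case (Suc i)
  then show ?case
    using conn_Un_circuit[of "partial_union C i" "C (Suc i)"] circ[of "Suc i"] meet[of "Suc i"]
    by (simp add: partial_union_Suc)
qed

theorem theorem6p5:
  fixes V :: "'a set" and E :: "'a set set"
    and C :: "nat \<Rightarrow> 'a set set" and t :: nat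
    and H :: "nat \<Rightarrow> 'a graph" and X Y :: "'a set"
  assumes "M22_connected (V, E)"
    and "ear_decomposition (V, E) C t"
    and "t \<ge> 2"
    and "\<And>i. i \<in> {1..t} \<Longrightarrow> H i = (\<Union>(C i), C i)"
    and "Y = verts (H t) - (\<Union>i\<in>{1..t - 1}. verts (H i))"
    and "X = verts (H t) - Y"
    and "\<not> (\<exists>F1 F2. three_edge_separation (H t) F1 F2 \<and>
              card (verts F1) \<ge> 2 \<and> card (verts F2) \<ge> 2 \<and>
              (subgraph F1 (induced (H t) Y) \<or> subgraph F2 (induced (H t) Y)))"
  shows "(\<exists>G'. edge_reduction (V, E) G' \<and> M22_connected G') \<or>
         (\<exists>G'. edge_deletion (V, E) G' \<and> M22_connected G') \<or>
         (\<exists>G'. K4_minus_reduction (V, E) G' \<and> M22_connected G')"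
proof -
  have VE: "V = \<Union>E" and cE: "conn E" using assms(1) by (auto simp: M22_connected_iff)
  have E: "edge_set E" using conn_edge_set[OF cE] .
  define D K where "D = partial_union C (t - 1)" and "K = C t"
  have circ: "circuit (C i)" "C i \<subseteq> E" if "i \<in> {1..t}" for i
    using assms(2) that M22_circuit_iff[OF E] by (auto simp: ear_decomposition_def)
  have meet: "C i \<inter> partial_union C (i - 1) \<noteq> {}" if "i \<in> {2..t}" for i
    using assms(2) that by (auto simp: ear_decomposition_def)
  have D: "conn D" unfolding D_def using assms(3)
    by (intro ear_decomposition_conn[of t] circ(1) meet) auto
  have K: "circuit K" "K \<inter> D \<noteq> {}" using circ(1)[of t] meet[of t] assms(3) by (auto simp: K_def D_def)
  have EDK: "E = D \<union> K"
    using assms(2,3) partial_union_Suc[of C "t - 1"] by (simp add: ear_decomposition_def D_def K_def)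
  have KD: "K - D \<noteq> {}" using assms(2,3) by (simp add: ear_decomposition_def D_def K_def)
  have min: "\<not> K' - D \<subset> K - D" if "circuit K'" "K' \<subseteq> D \<union> K" "K' \<inter> D \<noteq> {}" "K' - D \<noteq> {}" for K'
  proof -
    have "t \<in> {2..t}" using assms(3) by simp
    then show ?thesis
      using assms(2) that EDK M22_circuit_iff[OF E, of K'] unfolding ear_decomposition_def D_def K_def
      by (metis snd_conv)
  qed
  have Ht: "H t = (\<Union>K, K)" using assms(3) assms(4)[of t] by (simp add: K_def)
  have "verts (H i) = \<Union>(C i)" if "i \<in> {1..t - 1}" for i
    using assms(4)[of i] that by auto
  then have "(\<Union>i\<in>{1..t - 1}. verts (H i)) = (\<Union>i\<in>{1..t - 1}. \<Union>(C i))" by auto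
  also have "\<dots> = \<Union>D" unfolding D_def partial_union_def by blast
  finally have "(\<Union>i\<in>{1..t - 1}. verts (H i)) = \<Union>D" .
  then have Y: "Y = \<Union>K - \<Union>D" using assms(5) Ht by simp
  note le = last_ear[OF D K KD min Y]
  have "reducible E"
  proof (cases "Y = {}")
    case True
    have "\<exists>e. e \<notin> D \<and> D \<union> K = insert e D" by (rule le(1)) (use True in auto)
    then obtain e where e: "e \<notin> D" "E = insert e D" using EDK by auto
    have "\<Union>E = \<Union>D" using True Y EDK by blast
    then have "M22_connected (\<Union>E, D)" using D by (simp add: M22_connected_iff)
    moreover have "edge_deletion (\<Union>E, E) (\<Union>E, D)"
      unfolding edge_deletion_def using e by (intro bexI[of _ e]) auto
    ultimately show ?thesis by (auto simp: reducible_def)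
  next
    case False
    have "ear (D \<union> K) Y" by (rule le(2)) (use False in auto)
    then have ear: "ear E Y" using EDK by simp
    show ?thesis
    proof (rule ccontr)
      assume irr: "\<not> reducible E"
      have finE: "finite E" using E by (simp add: edge_set_def)
      \<comment> \<open>The bounds of an ear give at least three leaving edges. Edges of
        \<open>D\<close> do not meet \<open>Z\<close>, so exactly three would be the cut
        \<open>?S\<close> of a forbidden separation of \<open>H t\<close>.\<close>
      have "card (ind E Z) + 4 \<le> card (inc E Z)" if Z: "Z \<subseteq> Y" "2 \<le> card Z" for Z
      proof (rule ccontr)
        assume no: "\<not> ?thesis"
        have Zne: "Z \<noteq> {}" using Z by auto
        have n3: "card (inc E Z) = card (ind E Z) + 3"
          using no earD(5)[OF ear Z(1) Zne] earD(7)[OF ear Z(1) Zne] by simp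
        have ZD: "Z \<inter> \<Union>D = {}" and ZK: "Z \<subseteq> \<Union>K" using Z Y by auto
        let ?S = "inc E Z - ind E Z"
        have SK: "?S \<subseteq> K" using EDK ZD by (auto simp: inc_def)
        have "ind E Z \<subseteq> inc E Z" using edge_set_nonempty[OF E] by (fastforce simp: ind_def inc_def)
        then have cS: "card ?S = 3" using n3 finE by (simp add: card_Diff_subset)
        let ?F1 = "induced (H t) Z" and ?F2 = "induced (H t) (\<Union>K - Z)"
        have v: "verts ?F1 = Z" "verts ?F2 = \<Union>K - Z" by (auto simp: induced_def)
        have e1: "edges ?F1 = {e \<in> K. e \<subseteq> Z}" "edges ?F2 = {e \<in> K. e \<subseteq> \<Union>K - Z}"
          by (auto simp: induced_def Ht)
        have "edges ?F1 \<union> edges ?F2 = K - ?S"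
          unfolding e1 using EDK edge_set_nonempty[OF E] by (fastforce simp: inc_def ind_def)
        then have "three_edge_separation (H t) ?F1 ?F2"
          unfolding three_edge_separation_def v using ZK SK cS Ht by auto
        \<comment> \<open>An edge common to \<open>K\<close> and \<open>D\<close> avoids
          \<open>Z\<close> and supplies two vertices of the other side.\<close>
        moreover have "card (verts ?F2) \<ge> 2"
        proof -
          obtain h where h: "h \<in> K" "h \<in> D" using K by blast
          then have "h \<subseteq> \<Union>K - Z" using ZD by blast
          then have "card h \<le> card (\<Union>K - Z)"
            using edge_set_finite_Union[OF circuit_edge_set[OF K(1)]] by (intro card_mono) auto
          moreover have "card h = 2" using h E EDK by (auto simp: edge_set_def)
          ultimately show ?thesis using v by simp
        qed
        moreover have "subgraph ?F1 (induced (H t) Y)"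
          using Z finite_subset[OF Z(1) earD(2)[OF ear]] E EDK
          by (auto simp: subgraph_def simple_graph_def induced_def Ht edge_set_def)
        ultimately show False using assms(7) Z(2) v by metis
      qed
      then have "irreducible_ear E Y" using ear irr by (simp add: irreducible_ear_def)
      then show False by (rule irreducible_ear.absurd)
    qed
  qed
  then show ?thesis unfolding reducible_def VE .
qed

end
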